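(* Let $S_1,\ldots,S_N\subset\mathbb{C}^{n+1}$ be complex $n$-spheres in general position (including the determinant condition stated in the context), let $I\subset\{1,\ldots,N\}$ with $|I|<n$, let $J\subset\{1,\ldots,N\}\setminus I$, and let $S^{I,J}=\bigcap_{i\in I}S_i\cap\bigcup_{j\in J}S_j$. Write $m:=|J|$ and $J=\{j_1,\ldots,j_m\}$. There is a direct sum decomposition $$H_{n-|I|+1}(\mathbb{C}^{n+1},S^{I,J})\simeq\widetilde{H}_{n-|I|}(S^{I,J})\simeq\bigoplus_{\substack{K\subset J\\ K\neq\emptyset}}\widetilde{H}_{n-|I|-|K|+1}\Bigl(\bigcap_{i\in I\cup K}S_i\Bigr)\simeq\begin{cases}\mathbb{Z}^{2^{|J|}-1}&\text{if }N\leq n+1\\ \mathbb{Z}^{2^{|J|}-2}&\text{if }N=n+2\end{cases}$$ and $$H_{k+1}(\mathbb{C}^{n+1},S^{I,J})=\widetilde{H}_k(S^{I,J})=0\qquad\text{for all }k\in\mathbb{N},\ k\neq n-|I|.$$ Furthermore, the first isomorphism is the connecting (boundary) homomorphism $\partial_\ast$ of the pair $(\mathbb{C}^{n+1},S^{I,J})$, and the second isomorphism is given by a map $g_{I,J}$ which is recursively determined by $$g_{I,J}=(f_1,\;g_{I,J\setminus\{j_1\}}\circ f_2,\;g_{I\cup\{j_1\},J\setminus\{j_1\}}\circ\delta_{j_1}),\qquad g_{I,\emptyset}=\mathrm{id},$$ where the three components take values in the summand for $K=\{j_1\}$, in the summands for non-empty $K\subset J\setminus\{j_1\}$, and in the summands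 for $K\ni j_1$, $K\neq\{j_1\}$, respectively; here $\delta_{j_1}:\widetilde H_{n-|I|}(S^{I,J})\to\widetilde H_{n-|I|-1}(S^{I\cup\{j_1\},J\setminus\{j_1\}})$ is the Mayer-Vietoris homomorphism of the decomposition $S^{I,J}=S^{I,\{j_1\}}\cup S^{I,J\setminus\{j_1\}}$, and $$f_1:\widetilde{H}_{n-|I|}(S^{I,J})\to\widetilde{H}_{n-|I|}(S^{I,\{j_1\}}),\qquad f_2:\widetilde{H}_{n-|I|}(S^{I,J})\to\widetilde{H}_{n-|I|}(S^{I,J\setminus\{j_1\}})$$ are homomorphisms such that, with $k:S^{I,\{j_1\}}\hookrightarrow S^{I,J}$ and $l:S^{I,J\setminus\{j_1\}}\hookrightarrow S^{I,J}$ the natural inclusions, $$f_1\circ k_\ast=\mathrm{id},\quad f_1\circ l_\ast=0,\quad f_2\circ k_\ast=0,\quad f_2\circ l_\ast=\mathrm{id}.$$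
   Context: For $w\in\mathbb{C}^{n+1}$ write $w^2=\sum_k w_k^2$ and for $w,w'\in\mathbb{C}^{n+1}$ write $ww'=\sum_k w_kw'_k$ (bilinear, no conjugation). For $a\in\mathbb{C}^{n+1}$, $r\in\mathbb{C}^\times=\mathbb{C}\setminus\{0\}$, the complex $n$-sphere is $S^n_{\mathbb{C}}(a,r)=\{z\in\mathbb{C}^{n+1}\mid (z-a)^2=r^2\}$. Here $S_i=S^n_{\mathbb{C}}(a_i,r_i)$ for $i=1,\ldots,N$. "In general position" means that $S_1,\ldots,S_N$ are in general position as submanifolds of $\mathbb{C}^{n+1}$ (all intersections are transverse) and that $\det((a_i-a_1)(a_j-a_1))_{2\leq i,j\leq N}\neq0$ (this forces $N\leq n+2$). For $I\subset\{1,\ldots,N\}$ and $J\subset\{1,\ldots,N\}\setminus I$ set $S^{I,J}:=\bigcap_{i\in I}S_i\cap\bigcup_{j\in J}S_j$ (an empty intersection is $\mathbb{C}^{n+1}$, an empty union is $\emptyset$); thus $S^{I,\{j_1\}}\cap S^{I,J\setminus\{j_1\}}=S^{I\cup\{j_1\},J\setminus\{j_1\}}$. Homology is singular homology with $\mathbb{Z}$-coefficients, $\widetilde H$ is reduced homology, and $\mathbb{N}=\{0,1,2,\ldots\}$. The Mayer-Vietoris homomorphism of $X=A\cup B$ sends the class of $x=u+v$ ($u$ a chain in $A$, $v$ a chain in $B$, $\partial u=-\partial v$) to the class of $\partial u$ in $A\cap B$. In the decomposition, terms $\widetilde H_{-1}(\emptyset)$ (arising when $|I\cup K|=n+2$)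 are taken to be $0$.
   Formalization: The determinant condition is required of every nonempty subfamily of the spheres; the cases are split by |I∪J| instead of N, and for |I∪J|=n+2 the map g is only surjective with kernel Z: the homology is Z^(2^|J|-1), the direct sum Z^(2^|J|-2). *)

theory Defs
  imports "HOL-Homology.Homology" "HOL-Combinatorics.Permutations"
begin

section \<open>Complex spheres in general position\<close>

text \<open>Complex \<open>(n+1)\<close>-space is \<open>complex ^ 'd\<close> with \<open>CARD('d) = n + 1\<close>.\<close>

definition bil :: "complex ^ 'd \<Rightarrow> complex ^ 'd \<Rightarrow> complex" where
  "bil w w' = (\<Sum>k\<in>UNIV. w $ k * w' $ k)"

definition csphere :: "complex ^ 'd \<Rightarrow> complex \<Rightarrow> (complex ^ 'd) set" where
  "csphere a r = {z. bil (z - a) (z - a) = r\<^sup>2}"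

text \<open>The kernel of the differential \<open>v \<mapsto> 2 (z - a) v\<close> of the defining equation. For \<open>r \<noteq> 0\<close>
  it is a complex hyperplane at every point \<open>z\<close> of the sphere.\<close>

definition csphere_tangent :: "complex ^ 'd \<Rightarrow> complex ^ 'd \<Rightarrow> (complex ^ 'd) set" where
  "csphere_tangent a z = {v. bil (z - a) v = 0}"

text \<open>For disjoint \<open>L\<close> and \<open>M\<close>, the intersections of the spheres indexed by \<open>L\<close> and by \<open>M\<close> meet
  transversally. (Applying this to smaller index sets shows that the intersection over \<open>L\<close> is a
  submanifold whose tangent space is the intersection of the tangent spaces.)\<close>

definition transverse_spheres ::
    "(nat \<Rightarrow> complex ^ 'd) \<Rightarrow> (nat \<Rightarrow> complex) \<Rightarrow> nat \<Rightarrow> bool" where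
  "transverse_spheres a r N \<longleftrightarrow>
     (\<forall>L M z. L \<subseteq> {1..N} \<and> M \<subseteq> {1..N} \<and> L \<inter> M = {} \<and> (\<forall>i\<in>L \<union> M. z \<in> csphere (a i) (r i))
        \<longrightarrow> {v + w | v w. v \<in> (\<Inter>i\<in>L. csphere_tangent (a i) z)
                      \<and> w \<in> (\<Inter>i\<in>M. csphere_tangent (a i) z)} = UNIV)"

text \<open>The determinant of the matrix \<open>((a\<^sub>i - a\<^sub>p)(a\<^sub>j - a\<^sub>p))\<close> with \<open>i, j \<in> L - {p}\<close>, where
  \<open>p = Min L\<close>, given by the Leibniz formula since the size of the matrix is not a type.
  For \<open>L = {1..N}\<close> this is \<open>det ((a\<^sub>i - a\<^sub>1)(a\<^sub>j - a\<^sub>1))\<close> with \<open>2 \<le> i, j \<le> N\<close>.\<close>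

definition gram_det :: "(nat \<Rightarrow> complex ^ 'd) \<Rightarrow> nat set \<Rightarrow> complex" where
  "gram_det a L = (let p = Min L in
     \<Sum>\<pi> | \<pi> permutes (L - {p}).
       of_int (sign \<pi>) * (\<Prod>i\<in>L - {p}. bil (a i - a p) (a (\<pi> i) - a p)))"

text \<open>The determinant condition is required of every nonempty subfamily, as the determinant of
  the whole family does not control the smaller intersections. In complex 3-space (\<open>n = 2\<close>) take
  \<open>a\<^sub>1 = 0\<close>, \<open>a\<^sub>2 = (1, \<i>, 0)\<close>, \<open>a\<^sub>3 = (1, -\<i>, 0)\<close> and generic radii: the full determinant is \<open>-4\<close>,
  but \<open>(a\<^sub>2 - a\<^sub>1)\<^sup>2 = 0\<close>, the intersection of the first two spheres is a graph over a complex
  line, hence contractible, and their union has second homology of rank 2 instead of 3.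
  With \<open>r\<^sub>1 = r\<^sub>2\<close> that intersection consists of two disjoint complex lines, so the first
  homology of the union does not vanish.\<close>

definition spheres_in_general_position ::
    "(nat \<Rightarrow> complex ^ 'd) \<Rightarrow> (nat \<Rightarrow> complex) \<Rightarrow> nat \<Rightarrow> bool" where
  "spheres_in_general_position a r N \<longleftrightarrow>
     transverse_spheres a r N \<and> (\<forall>L. L \<subseteq> {1..N} \<and> L \<noteq> {} \<longrightarrow> gram_det a L \<noteq> 0)"

definition cap_cup :: "(nat \<Rightarrow> 'a set) \<Rightarrow> nat set \<Rightarrow> nat set \<Rightarrow> 'a set" where
  "cap_cup S I J = (\<Inter>i\<in>I. S i) \<inter> (\<Union>j\<in>J. S j)"


section \<open>Homology of subspaces\<close>

text \<open>Reduced homology in the library vanishes in all negative degrees, also for the empty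
  space, and it is trivial in all degrees for the empty space.\<close>

abbreviation Hred :: "int \<Rightarrow> 'a::topological_space set \<Rightarrow> 'a chain set monoid" where
  "Hred p A \<equiv> reduced_homology_group p (subtopology euclidean A)"

abbreviation incl_hom :: "int \<Rightarrow> 'a::topological_space set \<Rightarrow> 'a set \<Rightarrow> 'a chain set \<Rightarrow> 'a chain set" where
  "incl_hom p A B \<equiv> hom_induced p (subtopology euclidean A) {} (subtopology euclidean B) {} id"

abbreviation hclass :: "nat \<Rightarrow> 'a::topological_space set \<Rightarrow> 'a chain \<Rightarrow> 'a chain set" where
  "hclass p A c \<equiv> homologous_rel_set p (subtopology euclidean A) {} c"

text \<open>The homomorphism from degree \<open>p\<close> of \<open>A \<union> B\<close> to degree \<open>p - 1\<close> of \<open>A \<inter> B\<close>. The description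
  by \<open>THE\<close> is meaningful when \<open>A\<close> and \<open>B\<close> form an excisive couple: then every class splits as
  \<open>u + v\<close> and the result does not depend on the splitting. In degrees \<open>p \<le> 0\<close> the target is
  trivial.\<close>

definition mayer_vietoris ::
    "int \<Rightarrow> 'a::topological_space set \<Rightarrow> 'a set \<Rightarrow> 'a chain set \<Rightarrow> 'a chain set" where
  "mayer_vietoris p A B x =
     (if p \<le> 0 then \<one>\<^bsub>Hred (p - 1) (A \<inter> B)\<^esub>
      else THE y. \<exists>u v. singular_chain (nat p) (subtopology euclidean A) u \<and>
                        singular_chain (nat p) (subtopology euclidean B) v \<and>
                        chain_boundary (nat p) u = - chain_boundary (nat p) v \<and>
                        x = hclass (nat p) (A \<union> B) (u + v) \<and>
                        y = hclass (nat p - 1) (A \<inter> B) (chain_boundary (nat p) u))"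


section \<open>The decomposition\<close>

abbreviation mid_degree :: "nat \<Rightarrow> nat set \<Rightarrow> int" where
  "mid_degree n I \<equiv> int n - int (card I)"

definition decomposition_group ::
    "nat \<Rightarrow> (nat \<Rightarrow> 'a::topological_space set) \<Rightarrow> nat set \<Rightarrow> nat set
       \<Rightarrow> (nat set \<Rightarrow> 'a chain set) monoid" where
  "decomposition_group n S I J =
     sum_group {K. K \<subseteq> J \<and> K \<noteq> {}}
       (\<lambda>K. Hred (int n - int (card I) - int (card K) + 1) (\<Inter>i\<in>I \<union> K. S i))"

text \<open>\<open>f\<^sub>1\<close> and \<open>f\<^sub>2\<close> split off the classes coming from the two members of the covering of
  \<open>cap_cup S I J\<close> by \<open>cap_cup S I {j}\<close> and \<open>cap_cup S I (J - {j})\<close>. They are not unique.\<close>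

definition splitting_homs ::
    "nat \<Rightarrow> (nat \<Rightarrow> 'a::topological_space set) \<Rightarrow> nat set \<Rightarrow> nat \<Rightarrow> nat set
       \<Rightarrow> ('a chain set \<Rightarrow> 'a chain set) \<Rightarrow> ('a chain set \<Rightarrow> 'a chain set) \<Rightarrow> bool" where
  "splitting_homs n S I j J f\<^sub>1 f\<^sub>2 \<longleftrightarrow>
     (let p = mid_degree n I; X = cap_cup S I J; A = cap_cup S I {j}; B = cap_cup S I (J - {j});
          k = incl_hom p A X; l = incl_hom p B X
      in f\<^sub>1 \<in> hom (Hred p X) (Hred p A) \<and> f\<^sub>2 \<in> hom (Hred p X) (Hred p B) \<and>
         (\<forall>x\<in>carrier (Hred p A). f\<^sub>1 (k x) = x \<and> f\<^sub>2 (k x) = \<one>\<^bsub>Hred p B\<^esub>) \<and>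
         (\<forall>x\<in>carrier (Hred p B). f\<^sub>1 (l x) = \<one>\<^bsub>Hred p A\<^esub> \<and> f\<^sub>2 (l x) = x))"

text \<open>\<open>decomposition_map n S I js g\<close>: the map \<open>g\<close> arises from the recursion for \<open>g\<^sub>I\<^sub>,\<^sub>J\<close>, where \<open>js\<close>
  enumerates \<open>J\<close>, for some choice of the splitting homomorphisms at each step. For empty \<open>J\<close>
  the map is the unique one between trivial groups. The summand for \<open>K \<ni> j\<close>, \<open>K \<noteq> {j}\<close>, in the
  decomposition for \<open>(I, J)\<close> is the one for \<open>K - {j}\<close> in the decomposition for
  \<open>(I \<union> {j}, J - {j})\<close>.

  For \<open>|I| < n\<close> the map \<open>g\<close> is an isomorphism onto \<open>decomposition_group n S I J\<close> as long as
  \<open>|I \<union> J| \<le> n + 1\<close>, in particular if there are \<open>N \<le> n + 1\<close> spheres. If \<open>|I \<union> J| = n + 2\<close>, so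
  that \<open>I \<union> J = {1..N}\<close>, the summand for \<open>K = J\<close> is the reduced homology of the empty set in degree
  \<open>-1\<close>. As this group is \<open>0\<close> here and not \<open>\<int>\<close>, the sum has rank \<open>2 ^ |J| - 2\<close> only, while the
  homology of the union has rank \<open>2 ^ |J| - 1\<close>, and \<open>g\<close> is surjective with infinite cyclic kernel.
  Example: for \<open>n = 1\<close>, \<open>I = {}\<close>, \<open>J = {1, 2, 3}\<close> there are three complex circles (homotopy
  circles, Euler characteristic 0), any two of which meet in two points, without a common point.
  Their union is connected with Euler characteristic \<open>-6\<close>, so its first Betti number is 7.\<close>

primrec decomposition_map ::
    "nat \<Rightarrow> (nat \<Rightarrow> 'a::topological_space set) \<Rightarrow> nat set \<Rightarrow> nat list
       \<Rightarrow> ('a chain set \<Rightarrow> nat set \<Rightarrow> 'a chain set) \<Rightarrow> bool" where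
  "decomposition_map n S I [] g \<longleftrightarrow>
     (\<forall>x\<in>carrier (Hred (mid_degree n I) (cap_cup S I {})). g x = \<one>\<^bsub>decomposition_group n S I {}\<^esub>)"
| "decomposition_map n S I (j # js) g \<longleftrightarrow>
     (\<exists>f\<^sub>1 f\<^sub>2 g\<^sub>2 g\<^sub>3.
        splitting_homs n S I j (set (j # js)) f\<^sub>1 f\<^sub>2 \<and>
        decomposition_map n S I js g\<^sub>2 \<and>
        decomposition_map n S (insert j I) js g\<^sub>3 \<and>
        (\<forall>x\<in>carrier (Hred (mid_degree n I) (cap_cup S I (set (j # js)))).
           g x = (\<lambda>K\<in>{K. K \<subseteq> set (j # js) \<and> K \<noteq> {}}.
             if K = {j} then f\<^sub>1 x
             else if j \<notin> K then g\<^sub>2 (f\<^sub>2 x) K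
             else g\<^sub>3 (mayer_vietoris (mid_degree n I) (cap_cup S I {j}) (cap_cup S I (set js)) x)
                    (K - {j}))))"

definition int_power :: "nat \<Rightarrow> (nat \<Rightarrow> int) monoid" where
  "int_power m = sum_group {..<m} (\<lambda>_. integer_group)"

end

theory Submission
  imports Defs "HOL-Analysis.Analysis"
begin

text \<open>An intersection of \<open>m\<close> spheres in general position is a complex quadric \<open>w\<^sup>2 = s\<^sup>2\<close>, \<open>s \<noteq> 0\<close>, in
  an affine space of dimension \<open>n + 2 - m\<close>: by the determinant condition the bilinear form is
  nondegenerate on the span of the differences of the centres, whose orthogonal complement is the
  direction of the affine space, and transversality excludes \<open>s = 0\<close>. Such a quadric is a
  neighbourhood retract and homotopy equivalent to a real sphere of dimension \<open>n + 1 - m\<close>.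

  A union of two closed neighbourhood retracts that meet in a neighbourhood retract is again one,
  and the two members form an excisive couple: a homotopy of the union that preserves both members
  moves a neighbourhood of one of them into it. So the Mayer-Vietoris sequence of
  \<open>S(I, J) = S(I, {j}) \<union> S(I, J - {j})\<close>, with intersection \<open>S(I \<union> {j}, J - {j})\<close>, is exact. By induction
  on \<open>J\<close> the reduced homology is free and concentrated in degree \<open>n - |I|\<close>, hence the sequence reduces
  to a split extension of the homology of the intersection by the sum of the homologies of the
  members. When \<open>|I| = n\<close> the members are disjoint, and the augmentation of the part of a chain
  in one of them takes the place of the connecting homomorphism.\<close>

section \<open>Orthonormal bases for the complex bilinear form\<close>

text \<open>Each connecting homomorphism adds an index to \<open>I\<close>, so the induction must
  reach \<open>|I| = n\<close> although the theorem has \<open>|I| < n\<close>. There the next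
  degree is -1, where reduced homology is zero, and \<open>mayer_vietoris\<close> loses the copy of
  the integers that two disjoint nonempty members contribute. This happens exactly when
  \<open>|I \<union> J| = n + 2\<close>, which is why \<open>g\<close> then has an infinite cyclic
  kernel. The algebra is therefore stated for an extension with an arbitrary quotient
  \<open>C\<close> followed by a surjection \<open>\<gamma>\<close>: \<open>C\<close> is the
  homology of the intersection if \<open>|I| < n\<close>, and a power of the integers that records
  the augmentation if \<open>|I| = n\<close>. The second component of the recursion is always an
  isomorphism, because \<open>I \<union> (J - {j})\<close> omits \<open>j\<close> and has at most
  \<open>n + 1\<close> elements. So the kernel of \<open>g\<close> comes from the third component
  alone, and the one lost copy of the integers passes unchanged from level to level. The pair
  \<open>f\<^sub>1\<close>, \<open>f\<^sub>2\<close> is chosen anew at every level; only its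
  defining equations and exactness are used, so every choice is covered.\<close>

lemma bil_commute: "bil v w = bil w v"
  by (simp add: bil_def mult.commute)

lemma bil_add_left: "bil (u + v) w = bil u w + bil v w"
  by (simp add: bil_def sum.distrib algebra_simps)

lemma bil_add_right: "bil w (u + v) = bil w u + bil w v"
  by (simp add: bil_def sum.distrib algebra_simps)

lemma bil_diff_left: "bil (u - v) w = bil u w - bil v w"
  by (simp add: bil_def sum_subtractf algebra_simps)

lemma bil_diff_right: "bil w (u - v) = bil w u - bil w v"
  by (simp add: bil_def sum_subtractf algebra_simps)

lemma bil_scale_left: "bil (c *s v) w = c * bil v w"
  by (simp add: bil_def sum_distrib_left algebra_simps)

lemma bil_scale_right: "bil w (c *s v) = c * bil w v"
  by (simp add: bil_def sum_distrib_left algebra_simps)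

lemma bil_zero_left [simp]: "bil 0 w = 0"
  by (simp add: bil_def)

lemma bil_zero_right [simp]: "bil w 0 = 0"
  by (simp add: bil_def)

lemma bil_sum_left: "bil (\<Sum>i\<in>A. f i) w = (\<Sum>i\<in>A. bil (f i) w)"
  by (induction A rule: infinite_finite_induct) (auto simp: bil_add_left)

lemma bil_sum_right: "bil w (\<Sum>i\<in>A. f i) = (\<Sum>i\<in>A. bil w (f i))"
  by (induction A rule: infinite_finite_induct) (auto simp: bil_add_right)

lemmas bil_linear = bil_add_left bil_add_right bil_diff_left bil_diff_right
  bil_scale_left bil_scale_right bil_sum_left bil_sum_right

lemma bil_axis: "bil v (axis k 1) = v $ k"
  by (simp add: bil_def axis_def if_distrib cong: if_cong)

lemma bil_nondegenerate:
  assumes "\<And>w. bil v w = 0"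
  shows "v = 0"
  using assms[of "axis _ 1"] by (simp add: bil_axis vec_eq_iff)

section \<open>Leibniz sums with dependent rows\<close>

text \<open>Composing with the transposition of \<open>i\<close> and \<open>j\<close> permutes the
  index permutations and changes every sign, while each product is unchanged because the two rows
  agree. Hence the sum equals its own negative.\<close>

lemma leibniz_sum_equal_rows:
  fixes B :: "nat \<Rightarrow> nat \<Rightarrow> complex"
  assumes "finite P" "i \<in> P" "j \<in> P" "i \<noteq> j" "B i = B j"
  shows "(\<Sum>\<pi> | \<pi> permutes P. of_int (sign \<pi>) * (\<Prod>k\<in>P. B k (\<pi> k))) = 0"
proof -
  let ?\<tau> = "Transposition.transpose i j"
  have \<tau>: "?\<tau> permutes P"
    using assms by (simp add: permutes_swap_id)
  have B\<tau>: "B (?\<tau> k) = B k" for k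
    using assms by (auto simp: Transposition.transpose_def)
  have "(\<Sum>\<pi> | \<pi> permutes P. of_int (sign \<pi>) * (\<Prod>k\<in>P. B k (\<pi> k)))
      = (\<Sum>\<pi> | \<pi> permutes P. of_int (sign (\<pi> \<circ> ?\<tau>)) * (\<Prod>k\<in>P. B k ((\<pi> \<circ> ?\<tau>) k)))"
    by (rule sum_permutations_compose_right [OF \<tau>])
  also have "\<dots> = (\<Sum>\<pi> | \<pi> permutes P. - (of_int (sign \<pi>) * (\<Prod>k\<in>P. B k (\<pi> k))))"
  proof (rule sum.cong [OF refl])
    fix \<pi> assume "\<pi> \<in> {\<pi>. \<pi> permutes P}"
    then have "permutation \<pi>"
      using assms(1) permutation_permutes by blast
    moreover have "permutation ?\<tau>"
      using assms(1) \<tau> permutation_permutes by blast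
    ultimately have "sign (\<pi> \<circ> ?\<tau>) = - sign \<pi>"
      using assms(4) by (simp add: sign_compose sign_swap_id)
    moreover have "(\<Prod>k\<in>P. B k ((\<pi> \<circ> ?\<tau>) k)) = (\<Prod>k\<in>P. B k (\<pi> k))"
    proof -
      have "(\<Prod>k\<in>P. B k (\<pi> k)) = (\<Prod>k\<in>P. B (?\<tau> k) (\<pi> (?\<tau> k)))"
        using prod.permute [OF \<tau>, of "\<lambda>k. B k (\<pi> k)"] by (simp add: o_def)
      then show ?thesis
        by (simp add: B\<tau>)
    qed
    ultimately show "of_int (sign (\<pi> \<circ> ?\<tau>)) * (\<Prod>k\<in>P. B k ((\<pi> \<circ> ?\<tau>) k))
        = - (of_int (sign \<pi>) * (\<Prod>k\<in>P. B k (\<pi> k)))"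
      by simp
  qed
  finally show ?thesis
    by (simp add: sum_negf)
qed

text \<open>The Leibniz sum is linear in row \<open>i\<close>. Replacing that row by the vanishing
  combination of all rows gives zero; the terms with \<open>l \<noteq> i\<close> vanish by equality
  of two rows, and what is left is \<open>c i\<close> times the original sum.\<close>

lemma leibniz_sum_dependent_rows:
  fixes A :: "nat \<Rightarrow> nat \<Rightarrow> complex"
  assumes P: "finite P" "i \<in> P" and c: "c i \<noteq> 0"
    and dep: "\<And>j. j \<in> P \<Longrightarrow> (\<Sum>k\<in>P. c k * A k j) = 0"
  shows "(\<Sum>\<pi> | \<pi> permutes P. of_int (sign \<pi>) * (\<Prod>k\<in>P. A k (\<pi> k))) = 0"
proof -
  define D :: "(nat \<Rightarrow> nat \<Rightarrow> complex) \<Rightarrow> complex"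
    where "D B = (\<Sum>\<pi> | \<pi> permutes P. of_int (sign \<pi>) * (\<Prod>k\<in>P. B k (\<pi> k)))" for B
  have expand: "D (A(i := A l)) = (\<Sum>\<pi> | \<pi> permutes P. of_int (sign \<pi>) * (\<Prod>k\<in>P - {i}. A k (\<pi> k)) * A l (\<pi> i))" for l
    unfolding D_def
  proof (rule sum.cong [OF refl])
    fix \<pi>
    have "(\<Prod>k\<in>P. (A(i := A l)) k (\<pi> k)) = A l (\<pi> i) * (\<Prod>k\<in>P - {i}. A k (\<pi> k))"
      using P by (simp add: prod.remove)
    then show "of_int (sign \<pi>) * (\<Prod>k\<in>P. (A(i := A l)) k (\<pi> k))
        = of_int (sign \<pi>) * (\<Prod>k\<in>P - {i}. A k (\<pi> k)) * A l (\<pi> i)"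
      by (simp add: algebra_simps)
  qed
  have "(\<Sum>l\<in>P. c l * D (A(i := A l)))
      = (\<Sum>\<pi> | \<pi> permutes P. of_int (sign \<pi>) * (\<Prod>k\<in>P - {i}. A k (\<pi> k)) * (\<Sum>l\<in>P. c l * A l (\<pi> i)))"
    unfolding expand sum_distrib_left
    by (subst sum.swap) (intro sum.cong refl, simp add: algebra_simps)
  also have "\<dots> = 0"
    using dep P by (intro sum.neutral) (auto simp: permutes_in_image)
  finally have "(\<Sum>l\<in>P. c l * D (A(i := A l))) = 0" .
  moreover have "D (A(i := A l)) = 0" if "l \<in> P - {i}" for l
    unfolding D_def by (rule leibniz_sum_equal_rows [of P i l]) (use P that in auto)
  ultimately have "c i * D (A(i := A i)) = 0"
    using P by (simp add: sum.remove [of P i])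
  then show ?thesis
    using c by (simp add: D_def)
qed

section \<open>Orthonormal families for the form without conjugation\<close>

definition bil_orthonormal :: "nat \<Rightarrow> (nat \<Rightarrow> complex ^ 'd) \<Rightarrow> bool" where
  "bil_orthonormal m e \<longleftrightarrow> (\<forall>k<m. \<forall>l<m. bil (e k) (e l) = (if k = l then 1 else 0))"

lemma bil_orthonormal_coeff:
  assumes "bil_orthonormal m e" "k < m"
  shows "bil (\<Sum>l<m. c l *s e l) (e k) = c k"
proof -
  have "bil (\<Sum>l<m. c l *s e l) (e k) = (\<Sum>l<m. c l * (if l = k then 1 else 0))"
    using assms by (simp add: bil_linear bil_orthonormal_def)
  also have "\<dots> = (\<Sum>l<m. if l = k then c l else 0)"
    by (intro sum.cong) auto
  finally show ?thesis
    using assms by simp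
qed

lemma bil_orthonormal_square:
  assumes "bil_orthonormal m e"
  shows "bil (\<Sum>l<m. c l *s e l) (\<Sum>l<m. c l *s e l) = (\<Sum>l<m. (c l)\<^sup>2)"
proof -
  have "bil (\<Sum>l<m. c l *s e l) (\<Sum>l<m. c l *s e l)
      = (\<Sum>k<m. c k * bil (\<Sum>l<m. c l *s e l) (e k))"
    by (subst bil_sum_right) (simp add: bil_scale_right)
  also have "\<dots> = (\<Sum>k<m. (c k)\<^sup>2)"
    using assms by (intro sum.cong refl) (simp add: bil_orthonormal_coeff power2_eq_square)
  finally show ?thesis .
qed

text \<open>The induction for the existence of a basis produces a family of unspecified length, and
  its length is identified with the dimension here. The same count later gives the dimension of an
  orthogonal complement.\<close>

lemma bil_orthonormal_card:
  assumes e: "bil_orthonormal m e" and V: "vec.subspace V" "\<And>k. k < m \<Longrightarrow> e k \<in> V"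
    and span: "\<And>v. v \<in> V \<Longrightarrow> v = (\<Sum>k<m. bil v (e k) *s e k)"
  shows "vec.dim V = m"
proof -
  have inj: "inj_on e {..<m}"
    using e by (auto simp: inj_on_def bil_orthonormal_def) (metis zero_neq_one)
  have ind: "vec.independent (e ` {..<m})"
  proof (rule vec.independent_if_scalars_zero)
    fix f x
    assume 0: "(\<Sum>x\<in>e ` {..<m}. f x *s x) = 0" and "x \<in> e ` {..<m}"
    then obtain k where k: "k < m" "x = e k" by auto
    have "(\<Sum>k<m. f (e k) *s e k) = 0"
      using 0 inj by (simp add: sum.reindex)
    then show "f x = 0"
      using bil_orthonormal_coeff [OF e k(1), of "\<lambda>k. f (e k)"] k by simp
  qed auto
  have "vec.dim V = card (e ` {..<m})"
  proof (rule vec.dim_unique [OF _ _ ind refl])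
    show "V \<subseteq> vec.span (e ` {..<m})"
    proof
      fix v assume "v \<in> V"
      show "v \<in> vec.span (e ` {..<m})"
        by (subst span [OF \<open>v \<in> V\<close>]) (intro vec.span_sum vec.span_scale vec.span_base, auto)
    qed
  qed (use V in auto)
  then show ?thesis
    using inj by (simp add: card_image)
qed

text \<open>Gram-Schmidt can stall at a vector whose square is zero. Nondegeneracy supplies a vector
  with nonzero square, a complex square root normalises it, and its orthogonal complement in
  \<open>V\<close> is again nondegenerate and of smaller dimension.\<close>

lemma bil_orthonormal_basis_exists:
  fixes V :: "(complex ^ 'd) set"
  assumes "vec.subspace V" and "\<And>v. v \<in> V \<Longrightarrow> (\<And>w. w \<in> V \<Longrightarrow> bil v w = 0) \<Longrightarrow> v = 0"
  obtains e where "bil_orthonormal (vec.dim V) e" "\<And>k. k < vec.dim V \<Longrightarrow> e k \<in> V"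
    "\<And>v. v \<in> V \<Longrightarrow> v = (\<Sum>k<vec.dim V. bil v (e k) *s e k)"
proof -
  have "\<exists>e m. bil_orthonormal m e \<and> (\<forall>k<m. e k \<in> V) \<and> (\<forall>v\<in>V. v = (\<Sum>k<m. bil v (e k) *s e k))"
    using assms
  proof (induction "vec.dim V" arbitrary: V rule: less_induct)
    case less
    show ?case
    proof (cases "V \<subseteq> {0}")
      case True
      then show ?thesis
        by (intro exI [of _ "\<lambda>_. 0"] exI [of _ 0]) (auto simp: bil_orthonormal_def)
    next
      case False
      then obtain v where v: "v \<in> V" "v \<noteq> 0" by auto
      then obtain w where w: "w \<in> V" "bil v w \<noteq> 0"
        using less.prems(2) by blast
      \<comment> \<open>Polarisation: if \<open>v\<close> and \<open>w\<close> are both isotropic,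
        then \<open>v + w\<close> has square \<open>2 * bil v w\<close>, which is nonzero.\<close>
      have "bil (v + w) (v + w) = bil v v + bil w w + 2 * bil v w"
        by (simp add: bil_linear bil_commute [of w v])
      then have "bil v v \<noteq> 0 \<or> bil w w \<noteq> 0 \<or> bil (v + w) (v + w) \<noteq> 0"
        using w by auto
      moreover have "v + w \<in> V"
        using less.prems(1) v w by (simp add: vec.subspace_add)
      ultimately obtain u where u: "u \<in> V" "bil u u \<noteq> 0"
        using v w by blast
      define e0 where "e0 = (1 / csqrt (bil u u)) *s u"
      have e0V: "e0 \<in> V"
        using less.prems(1) u by (simp add: e0_def vec.subspace_scale)
      have "csqrt (bil u u) * csqrt (bil u u) = bil u u"
        by (metis power2_csqrt power2_eq_square)
      then have e0: "bil e0 e0 = 1"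
        using u by (simp add: e0_def bil_linear)
      define V' where "V' = {v \<in> V. bil v e0 = 0}"
      have V': "vec.subspace V'"
        using less.prems(1) unfolding V'_def vec.subspace_def by (auto simp: bil_linear)
      have proj: "v - bil v e0 *s e0 \<in> V'" if "v \<in> V" for v
        using that e0V less.prems(1)
        by (auto simp: V'_def bil_linear e0 vec.subspace_diff vec.subspace_scale)
      \<comment> \<open>Subtracting the component along \<open>e0\<close> moves any \<open>w\<close>
        of \<open>V\<close> into \<open>V'\<close> and does not change its product with
        \<open>v\<close>.\<close>
      have nd: "v = 0" if "v \<in> V'" "\<And>w. w \<in> V' \<Longrightarrow> bil v w = 0" for v
      proof (rule less.prems(2))
        show "v \<in> V" using that by (simp add: V'_def)
        fix w assume "w \<in> V"
        have "bil v (w - bil w e0 *s e0) = 0"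
          using that(2) proj \<open>w \<in> V\<close> by blast
        then show "bil v w = 0"
          using that(1) by (simp add: bil_linear V'_def)
      qed
      have "V' \<subset> V"
        using e0V e0 unfolding V'_def by (metis (mono_tags, lifting) mem_Collect_eq psubsetI subsetI zero_neq_one)
      then have "vec.dim V' < vec.dim V"
        using V' less.prems(1) by (metis vec.dim_psubset vec.span_eq_iff)
      then obtain e m where e: "bil_orthonormal m e" "\<And>k. k < m \<Longrightarrow> e k \<in> V'"
        "\<And>v. v \<in> V' \<Longrightarrow> v = (\<Sum>k<m. bil v (e k) *s e k)"
        using less.hyps [OF _ V' nd] by blast
      have orth: "bil (e k) e0 = 0" "bil e0 (e k) = 0" if "k < m" for k
        using e(2) [OF that] by (auto simp: V'_def bil_commute)
      show ?thesis
      proof (intro exI [of _ "e(m := e0)"] exI [of _ "Suc m"] conjI allI ballI impI)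
        show "bil_orthonormal (Suc m) (e(m := e0))"
          using e(1) orth e0 by (auto simp: bil_orthonormal_def less_Suc_eq)
        show "(e(m := e0)) k \<in> V" if "k < Suc m" for k
          using that e(2) e0V by (auto simp: less_Suc_eq V'_def)
        fix v assume "v \<in> V"
        have "v - bil v e0 *s e0 = (\<Sum>k<m. bil (v - bil v e0 *s e0) (e k) *s e k)"
          using e(3) proj \<open>v \<in> V\<close> by blast
        also have "\<dots> = (\<Sum>k<m. bil v (e k) *s e k)"
          using orth by (intro sum.cong refl) (simp add: bil_linear)
        finally have "v = (\<Sum>k<m. bil v (e k) *s e k) + bil v e0 *s e0"
          by (simp add: algebra_simps)
        moreover have "(\<Sum>k<Suc m. bil v ((e(m := e0)) k) *s (e(m := e0)) k)
            = (\<Sum>k<m. bil v (e k) *s e k) + bil v e0 *s e0"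
          by simp
        ultimately show "v = (\<Sum>k<Suc m. bil v ((e(m := e0)) k) *s (e(m := e0)) k)"
          by simp
      qed
    qed
  qed
  then obtain e m where em: "bil_orthonormal m e" "\<forall>k<m. e k \<in> V" "\<forall>v\<in>V. v = (\<Sum>k<m. bil v (e k) *s e k)"
    by blast
  then have "vec.dim V = m"
    using assms(1) by (intro bil_orthonormal_card) auto
  with em that show thesis by auto
qed

section \<open>Intersections of spheres in general position\<close>

lemma sum_lessThan_add:
  "(\<Sum>k<m + l. g k) = (\<Sum>k<m. g k) + (\<Sum>k<l::nat. g (m + k) :: 'a::comm_monoid_add)"
  by (induction l) (auto simp: algebra_simps)

lemma gram_det_independent:
  assumes L: "finite L" "L \<noteq> {}" and det: "gram_det a L \<noteq> 0"
    and c: "\<And>j. j \<in> L - {Min L} \<Longrightarrow>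
      (\<Sum>i\<in>L - {Min L}. c i * bil (a i - a (Min L)) (a j - a (Min L))) = 0"
    and i: "i \<in> L - {Min L}"
  shows "c i = 0"
proof (rule ccontr)
  assume "c i \<noteq> 0"
  then have "(\<Sum>\<pi> | \<pi> permutes (L - {Min L}). of_int (sign \<pi>) *
      (\<Prod>k\<in>L - {Min L}. bil (a k - a (Min L)) (a (\<pi> k) - a (Min L)))) = 0"
    using L i c by (intro leibniz_sum_dependent_rows [of _ i c]) auto
  then show False
    using det by (simp add: gram_det_def)
qed

text \<open>If \<open>c j\<close> were nonzero, every vector tangent to all the other spheres would
  be tangent to sphere \<open>j\<close>. Transversality of sphere \<open>j\<close> to the
  intersection of the others would then make its tangent hyperplane the whole space, so
  \<open>z = a j\<close>, against \<open>r j \<noteq> 0\<close>.\<close>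

lemma transverse_spheres_independent:
  fixes a :: "nat \<Rightarrow> complex ^ 'd"
  assumes tr: "transverse_spheres a r N" and r: "\<And>i. i \<in> {1..N} \<Longrightarrow> r i \<noteq> 0"
    and L: "L \<subseteq> {1..N}" and z: "\<And>i. i \<in> L \<Longrightarrow> z \<in> csphere (a i) (r i)"
    and dep: "(\<Sum>i\<in>L. c i *s (z - a i)) = 0" and j: "j \<in> L"
  shows "c j = 0"
proof (rule ccontr)
  assume cj: "c j \<noteq> 0"
  have fin: "finite L"
    using L finite_subset [of L "{1..N}"] by simp
  have sub: "(\<Inter>i\<in>L - {j}. csphere_tangent (a i) z) \<subseteq> csphere_tangent (a j) z"
  proof
    fix v assume v: "v \<in> (\<Inter>i\<in>L - {j}. csphere_tangent (a i) z)"
    have "0 = bil (\<Sum>i\<in>L. c i *s (z - a i)) v"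
      by (simp only: dep bil_zero_left)
    also have "\<dots> = (\<Sum>i\<in>L. c i * bil (z - a i) v)"
      by (simp only: bil_sum_left bil_scale_left)
    also have "\<dots> = c j * bil (z - a j) v + (\<Sum>i\<in>L - {j}. c i * bil (z - a i) v)"
      using fin j by (simp add: sum.remove)
    also have "(\<Sum>i\<in>L - {j}. c i * bil (z - a i) v) = 0"
      using v by (intro sum.neutral) (auto simp: csphere_tangent_def)
    finally show "v \<in> csphere_tangent (a j) z"
      using cj by (simp add: csphere_tangent_def)
  qed
  have "{v + w | v w. v \<in> (\<Inter>i\<in>L - {j}. csphere_tangent (a i) z)
      \<and> w \<in> (\<Inter>i\<in>{j}. csphere_tangent (a i) z)} = UNIV"
    using tr [unfolded transverse_spheres_def, rule_format, of "L - {j}" "{j}" z] L z j by blast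
  then have "x \<in> csphere_tangent (a j) z" for x
  proof -
    have "x \<in> {v + w | v w. v \<in> (\<Inter>i\<in>L - {j}. csphere_tangent (a i) z)
      \<and> w \<in> (\<Inter>i\<in>{j}. csphere_tangent (a i) z)}"
      using \<open>_ = UNIV\<close> by (metis UNIV_I)
    then obtain v w where "x = v + w" "v \<in> (\<Inter>i\<in>L - {j}. csphere_tangent (a i) z)" "w \<in> csphere_tangent (a j) z"
      by blast
    then show ?thesis
      using sub by (auto simp: csphere_tangent_def bil_linear)
  qed
  then have "z - a j = 0"
    by (intro bil_nondegenerate) (auto simp: csphere_tangent_def)
  then have "(r j)\<^sup>2 = 0"
    using z [OF j] by (simp add: csphere_def)
  then show False
    using r L j by auto
qed

text \<open>Subtracting the equation of sphere \<open>p\<close> from that of sphere \<open>i\<close>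
  leaves an affine linear equation for the product with \<open>b i\<close>. So the intersection is
  the part of sphere \<open>p\<close> in an affine space with direction \<open>W\<close>, and
  \<open>a p + v0\<close> is the foot of the perpendicular from \<open>a p\<close> to that
  space.\<close>

proposition sphere_intersection_chart:
  fixes a :: "nat \<Rightarrow> complex ^ 'd"
  assumes dim: "CARD('d) = n + 1" and r: "\<And>i. i \<in> {1..N} \<Longrightarrow> r i \<noteq> 0"
    and gp: "spheres_in_general_position a r N" and L: "L \<subseteq> {1..N}" "L \<noteq> {}"
  obtains z0 e s where "card L \<le> n + 2" "s \<noteq> 0" "bil_orthonormal (n + 2 - card L) e"
    "(\<Inter>i\<in>L. csphere (a i) (r i))
       = {z0 + (\<Sum>k<n + 2 - card L. c k *s e k) | c. (\<Sum>k<n + 2 - card L. (c k)\<^sup>2) = s\<^sup>2}"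
proof -
  have fin: "finite L"
    using L finite_subset [of L "{1..N}"] by simp
  define p where "p = Min L"
  define P where "P = L - {p}"
  define b where "b i = a i - a p" for i
  have p: "p \<in> L"
    using fin L by (simp add: p_def)
  have P: "finite P" "card P = card L - 1" "p \<notin> P" "L = insert p P"
    using fin p by (auto simp: P_def)
  have gram: "c i = 0" if "\<And>j. j \<in> P \<Longrightarrow> (\<Sum>i\<in>P. c i * bil (b i) (b j)) = 0" "i \<in> P" for c i
  proof (rule gram_det_independent [OF fin L(2)])
    show "gram_det a L \<noteq> 0"
      using gp L by (simp add: spheres_in_general_position_def)
  qed (use that in \<open>auto simp: P_def p_def b_def\<close>)
  have gram': "c i = 0" if "\<And>j. j \<in> P \<Longrightarrow> bil (\<Sum>i\<in>P. c i *s b i) (b j) = 0" "i \<in> P" for c i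
    by (rule gram [of c i]) (use that in \<open>simp_all add: bil_sum_left bil_scale_left\<close>)
  have inj: "inj_on b P"
  proof (rule inj_onI, rule ccontr)
    fix i j assume ij: "i \<in> P" "j \<in> P" "b i = b j" "i \<noteq> j"
    define c where "c k = (if k = i then 1 else if k = j then -1 else 0 :: complex)" for k
    have "(\<Sum>k\<in>P. c k *s b k) = (\<Sum>k\<in>P. (if k = i then b i else 0) - (if k = j then b j else 0))"
      using ij by (intro sum.cong) (auto simp: c_def)
    also have "\<dots> = 0"
      using P ij by (simp add: sum_subtractf)
    finally have "c i = 0"
      using ij by (auto intro: gram' [of c i])
    then show False by (simp add: c_def)
  qed
  have ind: "vec.independent (b ` P)"
  proof (rule vec.independent_if_scalars_zero)
    fix f x assume 0: "(\<Sum>x\<in>b ` P. f x *s x) = 0" and "x \<in> b ` P"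
    then obtain i where i: "i \<in> P" "x = b i" by auto
    have "(\<Sum>i\<in>P. f (b i) *s b i) = 0"
      using 0 inj by (simp add: sum.reindex)
    then have "f (b i) = 0"
      using i by (auto intro: gram' [of "\<lambda>i. f (b i)" i])
    then show "f x = 0" using i by simp
  qed (use P in auto)
  define V where "V = vec.span (b ` P)"
  have V: "vec.subspace V" "\<And>i. i \<in> P \<Longrightarrow> b i \<in> V"
    by (auto simp: V_def vec.subspace_span intro: vec.span_base)
  have Vcomb: "\<exists>c. v = (\<Sum>i\<in>P. c i *s b i)" if "v \<in> V" for v
  proof -
    obtain u where "v = (\<Sum>x\<in>b ` P. u x *s x)"
      using \<open>v \<in> V\<close> P by (auto simp: V_def vec.span_finite)
    then show ?thesis
      using inj by (intro exI [of _ "\<lambda>i. u (b i)"]) (simp add: sum.reindex)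
  qed
  have dimV: "vec.dim V = card L - 1"
    using ind inj P by (simp add: V_def vec.dim_span vec.dim_eq_card_independent card_image)
  have "vec.dim V \<le> n + 1"
    using vec.dim_subset_UNIV [of V] dim by (simp add: vec.dimension_def card_cart_basis)
  then have cardL: "card L \<le> n + 2"
    using dimV by linarith
  have Vnd: "v = 0" if v: "v \<in> V" and 0: "\<And>w. w \<in> V \<Longrightarrow> bil v w = 0" for v
  proof -
    obtain c where c: "v = (\<Sum>i\<in>P. c i *s b i)"
      using Vcomb v by blast
    have "c i = 0" if "i \<in> P" for i
      by (rule gram' [of c i]) (use 0 V that c in auto)
    then show ?thesis by (simp add: c)
  qed
  obtain f where f: "bil_orthonormal (vec.dim V) f" "\<And>k. k < vec.dim V \<Longrightarrow> f k \<in> V"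
    "\<And>v. v \<in> V \<Longrightarrow> v = (\<Sum>k<vec.dim V. bil v (f k) *s f k)"
    using bil_orthonormal_basis_exists [OF V(1) Vnd] by blast
  define W where "W = {w. \<forall>v\<in>V. bil w v = 0}"
  have W: "vec.subspace W"
    unfolding W_def vec.subspace_def by (auto simp: bil_linear)
  define pr where "pr z = (\<Sum>k<vec.dim V. bil z (f k) *s f k)" for z
  have prV: "pr z \<in> V" for z
    unfolding pr_def using f(2) V(1) by (intro vec.subspace_sum vec.subspace_scale) auto
  have prW: "z - pr z \<in> W" for z
    unfolding W_def
  proof (intro CollectI ballI)
    fix v assume "v \<in> V"
    have "bil (z - pr z) (f k) = 0" if "k < vec.dim V" for k
      using bil_orthonormal_coeff [OF f(1) that] by (simp add: bil_diff_left pr_def)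
    then have "bil (z - pr z) (\<Sum>k<vec.dim V. bil v (f k) *s f k) = 0"
      by (simp add: bil_sum_right bil_scale_right)
    then show "bil (z - pr z) v = 0"
      using f(3) [OF \<open>v \<in> V\<close>] by simp
  qed
  have Wnd: "w = 0" if "w \<in> W" "\<And>w'. w' \<in> W \<Longrightarrow> bil w w' = 0" for w
  proof (rule bil_nondegenerate)
    fix z
    have "bil w z = bil w (pr z) + bil w (z - pr z)"
      by (simp add: bil_linear)
    then show "bil w z = 0"
      using that prV prW by (simp add: W_def)
  qed
  obtain e where e: "bil_orthonormal (vec.dim W) e" "\<And>k. k < vec.dim W \<Longrightarrow> e k \<in> W"
    "\<And>v. v \<in> W \<Longrightarrow> v = (\<Sum>k<vec.dim W. bil v (e k) *s e k)"
    using bil_orthonormal_basis_exists [OF W Wnd] by blast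
  have orth: "bil (e k) (f l) = 0" "bil (f l) (e k) = 0" if "k < vec.dim W" "l < vec.dim V" for k l
    using e(2) [OF that(1)] f(2) [OF that(2)] by (auto simp: W_def bil_commute)
  \<comment> \<open>The bases of \<open>V\<close> and \<open>W\<close> together form an orthonormal
    basis of the whole space, since \<open>z = pr z + (z - pr z)\<close>. This gives
    \<open>dim W = n + 1 - (card L - 1)\<close>.\<close>
  have "vec.dim (UNIV :: (complex ^ 'd) set) = vec.dim V + vec.dim W"
  proof (rule bil_orthonormal_card)
    let ?g = "\<lambda>k. if k < vec.dim V then f k else e (k - vec.dim V)"
    show "bil_orthonormal (vec.dim V + vec.dim W) ?g"
      using e(1) f(1) orth by (auto simp: bil_orthonormal_def)
    fix z :: "complex ^ 'd"
    have "(\<Sum>k<vec.dim V + vec.dim W. bil z (?g k) *s ?g k)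
        = pr z + (\<Sum>k<vec.dim W. bil z (e k) *s e k)"
      unfolding pr_def sum_lessThan_add by simp
    also have "(\<Sum>k<vec.dim W. bil z (e k) *s e k) = (\<Sum>k<vec.dim W. bil (z - pr z) (e k) *s e k)"
      using orth by (intro sum.cong refl) (simp add: bil_linear pr_def)
    also have "\<dots> = z - pr z"
      using e(3) prW by metis
    finally show "z = (\<Sum>k<vec.dim V + vec.dim W. bil z (?g k) *s ?g k)"
      by simp
  qed auto
  then have dimW: "vec.dim W = n + 2 - card L"
    using dim dimV cardL L fin card_gt_0_iff [of L] by (simp add: vec.dim_UNIV vec.dimension_def card_cart_basis)
  \<comment> \<open>For \<open>x = z - a p\<close> with square \<open>(r p)^2\<close>, the equation
    of sphere \<open>i\<close> reads
    \<open>(r p)^2 - 2 * bil x (b i) + bil (b i) (b i) = (r i)^2\<close>; \<open>\<kappa> i\<close>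
    is the value of \<open>bil x (b i)\<close> that it forces.\<close>
  define \<kappa> where "\<kappa> i = ((r p)\<^sup>2 - (r i)\<^sup>2 + bil (b i) (b i)) / 2" for i
  obtain v0 where v0: "v0 \<in> V" "\<And>i. i \<in> P \<Longrightarrow> bil v0 (b i) = \<kappa> i"
  proof -
    \<comment> \<open>Independence of the \<open>b i\<close> gives a linear map with the prescribed
      values \<open>\<kappa> i\<close>, carried by one arbitrary coordinate \<open>k0\<close>
      because the map is vector-valued. Then \<open>v0\<close> is the vector of \<open>V\<close>
      that represents this functional, written in the orthonormal basis \<open>f\<close>.\<close>
    obtain k0 :: 'd where True by blast
    obtain g where g: "Vector_Spaces.linear (*s) (*s) g"
      "\<forall>x\<in>b ` P. g x = (\<kappa> (the_inv_into P b x) *s axis k0 1 :: complex ^ 'd)"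
      using vec.linear_independent_extend [OF ind, of "\<lambda>x. \<kappa> (the_inv_into P b x) *s axis k0 1"] by blast
    define v0 where "v0 = (\<Sum>k<vec.dim V. (g (f k) $ k0) *s f k)"
    have "v0 \<in> V"
      unfolding v0_def using f(2) V(1) by (intro vec.subspace_sum vec.subspace_scale) auto
    moreover have "bil v0 (b i) = \<kappa> i" if "i \<in> P" for i
    proof -
      have "\<kappa> i = g (b i) $ k0"
        using g(2) that inj by (simp add: the_inv_into_f_f axis_def)
      also have "b i = (\<Sum>k<vec.dim V. bil (b i) (f k) *s f k)"
        using f(3) V(2) that by blast
      also have "g \<dots> = (\<Sum>k<vec.dim V. bil (b i) (f k) *s g (f k))"
        using g(1) by (simp add: vec.linear_sum vec.linear_scale)
      finally show ?thesis
        by (simp add: v0_def bil_sum_left bil_scale_left bil_commute [of "b i"] mult.commute)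
    qed
    ultimately show thesis using that by blast
  qed
  \<comment> \<open>As \<open>v0\<close> is orthogonal to \<open>W\<close>, the square of
    \<open>v0 + w\<close> is \<open>bil v0 v0 + bil w w\<close>, and \<open>\<rho>\<close> is what
    sphere \<open>p\<close> leaves for \<open>bil w w\<close>.\<close>
  define \<rho> where "\<rho> = (r p)\<^sup>2 - bil v0 v0"
  have mem: "a p + v0 + w \<in> (\<Inter>i\<in>L. csphere (a i) (r i)) \<longleftrightarrow> bil w w = \<rho> \<and> w \<in> W"
    for w
  proof -
    have "a p + v0 + w \<in> csphere (a p) (r p) \<longleftrightarrow> bil (v0 + w) (v0 + w) = (r p)\<^sup>2"
      by (simp add: csphere_def algebra_simps)
    moreover have "a p + v0 + w \<in> csphere (a i) (r i) \<longleftrightarrow> bil w (b i) = 0"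
      if "i \<in> P" "bil (v0 + w) (v0 + w) = (r p)\<^sup>2" for i
    proof -
      have "a p + v0 + w - a i = (v0 + w) - b i"
        by (simp add: b_def)
      then have "bil (a p + v0 + w - a i) (a p + v0 + w - a i)
          = bil (v0 + w) (v0 + w) - 2 * bil (v0 + w) (b i) + bil (b i) (b i)"
        by (simp only: bil_diff_left bil_diff_right bil_commute [of "b i" "v0 + w"]) simp
      also have "\<dots> = (r i)\<^sup>2 - 2 * bil w (b i)"
        using that v0(2) [of i] by (simp add: bil_add_left [of v0 w "b i"] \<kappa>_def field_simps)
      finally show ?thesis
        by (simp add: csphere_def)
    qed
    moreover have "w \<in> W \<longleftrightarrow> (\<forall>i\<in>P. bil w (b i) = 0)"
    proof
      assume w: "\<forall>i\<in>P. bil w (b i) = 0"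
      show "w \<in> W"
        unfolding W_def
      proof (intro CollectI ballI)
        fix v assume "v \<in> V"
        then obtain c where "v = (\<Sum>i\<in>P. c i *s b i)"
          using Vcomb by blast
        then show "bil w v = 0"
          using w by (simp add: bil_sum_right bil_scale_right)
      qed
    next
      assume "w \<in> W"
      then show "\<forall>i\<in>P. bil w (b i) = 0"
        using V(2) by (simp add: W_def)
    qed
    moreover have "bil (v0 + w) (v0 + w) = bil v0 v0 + bil w w" if "w \<in> W"
      using that v0(1) by (simp add: W_def bil_linear bil_commute [of v0 w])
    moreover have "bil v0 v0 + bil w w = (r p)\<^sup>2 \<longleftrightarrow> bil w w = \<rho>"
      by (auto simp: \<rho>_def algebra_simps)
    ultimately show ?thesis
      unfolding P(4) INT_iff ball_simps insert_iff by metis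
  qed
  \<comment> \<open>If \<open>\<rho> = 0\<close>, then \<open>z = a p + v0\<close> lies on all spheres, and expanding \<open>v0\<close> in the \<open>b i\<close> gives a
    relation between the vectors \<open>z - a i\<close>, \<open>i \<in> L\<close>, whose coefficients have sum \<open>1\<close>.\<close>
  have "\<rho> \<noteq> 0"
  proof
    assume "\<rho> = 0"
    then have z0: "a p + v0 \<in> (\<Inter>i\<in>L. csphere (a i) (r i))"
      using mem [of 0] W by (simp add: vec.subspace_0)
    obtain c where c: "v0 = (\<Sum>i\<in>P. c i *s b i)"
      using Vcomb v0 by blast
    define c' where "c' i = (if i = p then 1 - (\<Sum>i\<in>P. c i) else c i)" for i
    have c'P: "sum c' P = sum c P" "(\<Sum>i\<in>P. c' i *s x i) = (\<Sum>i\<in>P. c i *s x i)" for x :: "nat \<Rightarrow> complex ^ 'd"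
      using P(3) by (auto intro!: sum.cong simp: c'_def)
    have "c' i = 0" if "i \<in> L" for i
    proof (rule transverse_spheres_independent [OF _ r L(1) _ _ that])
      show "transverse_spheres a r N"
        using gp by (simp add: spheres_in_general_position_def)
      show "a p + v0 \<in> csphere (a i) (r i)" if "i \<in> L" for i
        using z0 that by blast
      have "(\<Sum>i\<in>L. c' i *s (a p + v0 - a i)) = (\<Sum>i\<in>L. c' i *s (v0 - b i))"
        by (intro sum.cong) (auto simp: b_def algebra_simps)
      also have "\<dots> = c' p *s v0 + (\<Sum>i\<in>P. c' i *s v0 - c' i *s b i)"
        using P by (simp add: b_def vec.scale_right_diff_distrib)
      also have "\<dots> = c' p *s v0 + (sum c P *s v0 - v0)"
        using c c'P by (simp add: sum_subtractf vec.scale_sum_left [symmetric])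
      also have "\<dots> = 0"
        by (simp add: c'_def vec.scale_left_diff_distrib)
      finally show "(\<Sum>i\<in>L. c' i *s (a p + v0 - a i)) = 0" .
    qed
    then have "sum c' L = 0" by simp
    then show False
      using P c'P by (simp add: c'_def)
  qed
  have "(\<Inter>i\<in>L. csphere (a i) (r i))
      = {a p + v0 + (\<Sum>k<n + 2 - card L. c k *s e k) | c. (\<Sum>k<n + 2 - card L. (c k)\<^sup>2) = (csqrt \<rho>)\<^sup>2}"
    (is "?Q = ?R")
  proof (intro Set.set_eqI iffI)
    fix z assume "z \<in> ?Q"
    moreover define w where "w = z - a p - v0"
    ultimately have "bil w w = \<rho>" and wW: "w \<in> W"
      using mem [of w] by auto
    have w: "w = (\<Sum>k<n + 2 - card L. bil w (e k) *s e k)"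
      using e(3) [OF wW] by (simp only: dimW)
    have "(\<Sum>k<n + 2 - card L. (bil w (e k))\<^sup>2) = (csqrt \<rho>)\<^sup>2"
      using bil_orthonormal_square [of "n + 2 - card L" e "\<lambda>k. bil w (e k)"] e(1) w dimW
        \<open>bil w w = \<rho>\<close> by simp
    moreover have "z = a p + v0 + (\<Sum>k<n + 2 - card L. bil w (e k) *s e k)"
      using w by (simp add: w_def)
    ultimately show "z \<in> ?R"
      unfolding mem_Collect_eq by (intro exI [of _ "\<lambda>k. bil w (e k)"] conjI)
  next
    fix z assume "z \<in> ?R"
    then obtain c where c: "z = a p + v0 + (\<Sum>k<n + 2 - card L. c k *s e k)"
      "(\<Sum>k<n + 2 - card L. (c k)\<^sup>2) = \<rho>" by auto
    have "(\<Sum>k<n + 2 - card L. c k *s e k) \<in> W"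
      using e(2) W dimW by (intro vec.subspace_sum vec.subspace_scale) auto
    moreover have "bil (\<Sum>k<n + 2 - card L. c k *s e k) (\<Sum>k<n + 2 - card L. c k *s e k) = \<rho>"
      using bil_orthonormal_square [of "n + 2 - card L" e c] e(1) c(2) dimW by simp
    ultimately show "z \<in> ?Q"
      unfolding c(1) mem by blast
  qed
  then show thesis
    using that [OF cardL, of "csqrt \<rho>" e "a p + v0"] e(1) dimW \<open>\<rho> \<noteq> 0\<close> by simp
qed

section \<open>Topology of complex quadrics\<close>

definition bil_quadric :: "complex ^ 'd \<Rightarrow> (nat \<Rightarrow> complex ^ 'd) \<Rightarrow> complex \<Rightarrow> nat \<Rightarrow> (complex ^ 'd) set" where
  "bil_quadric z0 e s m = {z0 + (\<Sum>k<m. c k *s e k) | c. (\<Sum>k<m. (c k)\<^sup>2) = s\<^sup>2}"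

text \<open>Dividing by \<open>s\<close> gives every quadric the same equation, sum of squares equal
  to 1.\<close>

definition quadric_coord :: "complex ^ 'd \<Rightarrow> (nat \<Rightarrow> complex ^ 'd) \<Rightarrow> complex \<Rightarrow> complex ^ 'd \<Rightarrow> nat \<Rightarrow> complex" where
  "quadric_coord z0 e s z k = bil (z - z0) (e k) / s"

definition quadric_point :: "complex ^ 'd \<Rightarrow> (nat \<Rightarrow> complex ^ 'd) \<Rightarrow> complex \<Rightarrow> nat \<Rightarrow> (nat \<Rightarrow> complex) \<Rightarrow> complex ^ 'd" where
  "quadric_point z0 e s m c = z0 + (\<Sum>k<m. (s * c k) *s e k)"

lemma quadric_coord_point:
  assumes "bil_orthonormal m e" "s \<noteq> 0" "k < m"
  shows "quadric_coord z0 e s (quadric_point z0 e s m c) k = c k"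
  using bil_orthonormal_coeff [OF assms(1,3), of "\<lambda>k. s * c k"] assms(2)
  by (simp add: quadric_coord_def quadric_point_def)

lemma quadric_point_in:
  assumes "(\<Sum>k<m. (c k)\<^sup>2) = 1"
  shows "quadric_point z0 e s m c \<in> bil_quadric z0 e s m"
proof -
  have "(\<Sum>k<m. (s * c k)\<^sup>2) = s\<^sup>2"
    using assms by (simp add: power_mult_distrib flip: sum_distrib_left)
  then show ?thesis
    unfolding bil_quadric_def quadric_point_def mem_Collect_eq
    by (intro exI [of _ "\<lambda>k. s * c k"] conjI refl)
qed

lemma bil_quadricD:
  assumes "bil_orthonormal m e" "s \<noteq> 0" "z \<in> bil_quadric z0 e s m"
  shows "quadric_point z0 e s m (quadric_coord z0 e s z) = z"
    and "(\<Sum>k<m. (quadric_coord z0 e s z k)\<^sup>2) = 1"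
proof -
  obtain c where c: "z = z0 + (\<Sum>k<m. c k *s e k)" "(\<Sum>k<m. (c k)\<^sup>2) = s\<^sup>2"
    using assms(3) by (auto simp: bil_quadric_def)
  have co [simp]: "quadric_coord z0 e s z k = c k / s" if "k < m" for k
    using bil_orthonormal_coeff [OF assms(1) that] by (simp add: quadric_coord_def c)
  show "quadric_point z0 e s m (quadric_coord z0 e s z) = z"
    using assms(2) co c(1) by (simp add: quadric_point_def)
  have "(\<Sum>k<m. (quadric_coord z0 e s z k)\<^sup>2) = (\<Sum>k<m. (c k)\<^sup>2) / s\<^sup>2"
    by (simp add: power_divide sum_divide_distrib)
  then show "(\<Sum>k<m. (quadric_coord z0 e s z k)\<^sup>2) = 1"
    using assms(2) c by simp
qed

lemma continuous_on_bil [continuous_intros]: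
  "continuous_on S f \<Longrightarrow> continuous_on S g \<Longrightarrow> continuous_on S (\<lambda>x. bil (f x) (g x))"
  unfolding bil_def by (intro continuous_intros continuous_on_component)

lemma continuous_on_vec_scale [continuous_intros]:
  "continuous_on S f \<Longrightarrow> continuous_on S (\<lambda>x. f x *s (v :: complex ^ 'd))"
  unfolding vector_scalar_mult_def by (intro continuous_on_vec_lambda continuous_intros)

lemma closed_csphere: "closed (csphere a r)"
  unfolding csphere_def by (intro closed_Collect_eq continuous_intros)

lemma continuous_on_quadric_coord [continuous_intros]:
  "continuous_on S f \<Longrightarrow> s \<noteq> 0 \<Longrightarrow> continuous_on S (\<lambda>x. quadric_coord z0 e s (f x) k)"
  unfolding quadric_coord_def by (intro continuous_intros) auto

lemma continuous_on_quadric_point [continuous_intros]: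
  "(\<And>k. k < m \<Longrightarrow> continuous_on S (\<lambda>x. c x k)) \<Longrightarrow> continuous_on S (\<lambda>x. quadric_point z0 e s m (c x))"
  unfolding quadric_point_def by (intro continuous_intros) auto

text \<open>Where the sum of squares \<open>q\<close> of the coordinates avoids the nonpositive
  reals, its principal square root is continuous and nonzero, and dividing the coordinates by it
  retracts onto the quadric. Rebuilding the point by \<open>quadric_point\<close> discards the part
  orthogonal to the \<open>e k\<close>.\<close>

lemma ENR_bil_quadric:
  assumes e: "bil_orthonormal m e" and s: "s \<noteq> 0"
  shows "ENR (bil_quadric z0 e s m)"
proof -
  define q where "q z = (\<Sum>k<m. (quadric_coord z0 e s z k)\<^sup>2)" for z
  define U where "U = {z. q z \<notin> \<real>\<^sub>\<le>\<^sub>0}"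
  have q: "continuous_on S q" for S
    unfolding q_def using s by (intro continuous_intros)
  have "open U"
    using closed_Collect_eq open_Collect_neg closed_vimage [OF closed_nonpos_Reals_complex q [of UNIV]]
    by (simp add: U_def closed_def vimage_def Collect_neg_eq)
  moreover have "bil_quadric z0 e s m retract_of U"
    unfolding retract_of_def retraction_def
  proof (intro exI conjI ballI)
    let ?r = "\<lambda>z. quadric_point z0 e s m (\<lambda>k. quadric_coord z0 e s z k / csqrt (q z))"
    show "bil_quadric z0 e s m \<subseteq> U"
      using bil_quadricD(2) [OF e s] by (auto simp: U_def q_def)
    have "continuous_on U (\<lambda>z. csqrt (q z))"
      by (rule continuous_on_compose2 [OF _ q, of "q ` U"])
        (auto simp: U_def intro!: continuous_at_imp_continuous_on continuous_at_csqrt)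
    moreover have "csqrt (q z) \<noteq> 0" if "z \<in> U" for z
      using that by (auto simp: U_def)
    ultimately show "continuous_on U ?r"
      using s by (intro continuous_intros) auto
    show "?r \<in> U \<rightarrow> bil_quadric z0 e s m"
    proof
      fix z assume "z \<in> U"
      then have "q z \<noteq> 0" by (auto simp: U_def)
      have "(\<Sum>k<m. (quadric_coord z0 e s z k / csqrt (q z))\<^sup>2) = q z / (csqrt (q z))\<^sup>2"
        by (simp only: q_def power_divide sum_divide_distrib)
      then show "?r z \<in> bil_quadric z0 e s m"
        using \<open>q z \<noteq> 0\<close> by (intro quadric_point_in) simp
    qed
    fix z assume z: "z \<in> bil_quadric z0 e s m"
    then have "q z = 1"
      using bil_quadricD(2) [OF e s] by (simp add: q_def)
    then show "?r z = z"
      using bil_quadricD(1) [OF e s z] by simp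
  qed
  ultimately show ?thesis
    unfolding ENR_def by blast
qed

text \<open>For coordinates \<open>x + i y\<close> the equation says
  \<open>|x|^2 = 1 + |y|^2\<close> and \<open>x y = 0\<close>: the quadric is a copy of the tangent
  bundle of the real unit sphere, and contracting the fibres leaves the sphere. The map
  \<open>F\<close> is \<open>x / |x|\<close>, and \<open>G\<close> embeds the real points.\<close>

lemma bil_quadric_homotopy_equivalent_nsphere:
  fixes e :: "nat \<Rightarrow> complex ^ 'd"
  assumes e: "bil_orthonormal (Suc l) e" and s: "s \<noteq> 0"
  shows "top_of_set (bil_quadric z0 e s (Suc l)) homotopy_equivalent_space nsphere l"
proof -
  let ?m = "Suc l"
  define Q where "Q = bil_quadric z0 e s ?m"
  define x where "x z k = Re (quadric_coord z0 e s z k)" for z k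
  define y where "y z k = Im (quadric_coord z0 e s z k)" for z k
  define X where "X z = (\<Sum>k<?m. (x z k)\<^sup>2)" for z
  define Y where "Y z = (\<Sum>k<?m. (y z k)\<^sup>2)" for z
  have cxy: "quadric_coord z0 e s z k = Complex (x z k) (y z k)" for z k
    by (simp add: x_def y_def)
  have XY: "X z = 1 + Y z" "(\<Sum>k<?m. x z k * y z k) = 0" if "z \<in> Q" for z
  proof -
    have "(\<Sum>k<?m. (Complex (x z k) (y z k))\<^sup>2) = 1"
      using bil_quadricD(2) [OF e s] that by (simp add: Q_def flip: cxy)
    then have "Re (\<Sum>k<?m. (Complex (x z k) (y z k))\<^sup>2) = 1" "Im (\<Sum>k<?m. (Complex (x z k) (y z k))\<^sup>2) = 0"
      by (simp_all only: one_complex.sel)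
    then have "(\<Sum>k<?m. (x z k)\<^sup>2 - (y z k)\<^sup>2) = 1" "(\<Sum>k<?m. 2 * (x z k * y z k)) = 0"
      by (simp_all only: Re_sum Im_sum) (simp_all add: power2_eq_square algebra_simps)
    then show "X z = 1 + Y z" "(\<Sum>k<?m. x z k * y z k) = 0"
      unfolding sum_subtractf sum_distrib_left [symmetric] X_def Y_def by linarith+
  qed
  have Y0: "Y z \<ge> 0" for z
    by (simp add: Y_def sum_nonneg)
  have X1: "X z \<ge> 1" if "z \<in> Q" for z
    using XY(1) [OF that] Y0 [of z] by simp
  have cont: "continuous_on S (\<lambda>w. x (f w) k)" "continuous_on S (\<lambda>w. y (f w) k)"
    if "continuous_on S f" for S :: "'b::topological_space set" and f k
    using that s unfolding x_def y_def by (intro continuous_intros; simp)+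
  have contXY: "continuous_on S (\<lambda>w. X (f w))" "continuous_on S (\<lambda>w. Y (f w))"
    if "continuous_on S f" for S :: "'b::topological_space set" and f
    unfolding X_def Y_def by (intro continuous_intros cont that)+
  define F where "F z = (\<lambda>i. if i < ?m then x z i / sqrt (X z) else 0)" for z
  define G where "G u = quadric_point z0 e s ?m (\<lambda>k. complex_of_real (u k))" for u
  have "continuous_map (top_of_set Q) (nsphere l) F"
    unfolding nsphere_def continuous_map_in_subtopology
  proof
    show "continuous_map (top_of_set Q) (Euclidean_space ?m) F"
      unfolding F_def continuous_map_componentwise_Euclidean_space
      using X1 by (auto intro!: continuous_intros cont contXY) (smt (verit))
    show "F \<in> topspace (top_of_set Q) \<rightarrow> {x. (\<Sum>i\<le>l. (x i)\<^sup>2) = 1}"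
    proof
      fix z assume "z \<in> topspace (top_of_set Q)"
      then have "X z \<ge> 1" using X1 by simp
      have "(\<Sum>i\<le>l. (F z i)\<^sup>2) = (\<Sum>i<?m. (x z i)\<^sup>2 / X z)"
        unfolding lessThan_Suc_atMost [symmetric] using \<open>X z \<ge> 1\<close> by (intro sum.cong) (auto simp: F_def power_divide)
      also have "\<dots> = 1"
        using \<open>X z \<ge> 1\<close> by (simp add: X_def flip: sum_divide_distrib)
      finally show "F z \<in> {x. (\<Sum>i\<le>l. (x i)\<^sup>2) = 1}" by simp
    qed
  qed
  moreover have "continuous_map (nsphere l) (top_of_set Q) G"
    unfolding continuous_map_in_subtopology
  proof
    have "continuous_map (nsphere l) euclidean (\<lambda>u. (s * complex_of_real (u k)) *s e k)" for k
    proof -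
      have "continuous_on UNIV (\<lambda>t. (s * complex_of_real t) *s e k)"
        by (intro continuous_intros)
      then have "continuous_map euclideanreal euclidean (\<lambda>t. (s * complex_of_real t) *s e k)"
        by simp
      from continuous_map_compose [OF continuous_map_nsphere_projection [of l k] this]
      show ?thesis
        by (simp add: o_def)
    qed
    then show "continuous_map (nsphere l) euclidean G"
      unfolding G_def quadric_point_def by (intro continuous_map_add continuous_map_sum) auto
    show "G \<in> topspace (nsphere l) \<rightarrow> Q"
      unfolding G_def Q_def
      by (intro Pi_I quadric_point_in) (auto simp: nsphere simp flip: lessThan_Suc_atMost of_real_power of_real_sum)
  qed
  moreover have "homotopic_with (\<lambda>h. True) (nsphere l) (nsphere l) (F \<circ> G) id"
  proof (rule homotopic_with_equal)
    show "continuous_map (nsphere l) (nsphere l) (F \<circ> G)"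
      using calculation continuous_map_compose by blast
    fix u assume u: "u \<in> topspace (nsphere l)"
    have xu: "x (G u) k = u k" if "k < ?m" for k
      using quadric_coord_point [OF e s that] by (simp add: x_def G_def)
    have "X (G u) = 1"
      using u by (simp add: X_def xu nsphere lessThan_Suc_atMost del: sum.lessThan_Suc)
    then show "(F \<circ> G) u = id u"
      using u xu by (auto simp: F_def nsphere fun_eq_iff)
  qed auto
  moreover have "homotopic_with (\<lambda>h. True) (top_of_set Q) (top_of_set Q) (G \<circ> F) id"
  proof -
    \<comment> \<open>The imaginary part is scaled by \<open>t\<close>, and the real part is
      rescaled to the length \<open>sqrt (1 + t^2 * |y|^2)\<close> that the equation demands; the
      two stay orthogonal.\<close>
    define c where "c t z k = Complex (x z k * sqrt (1 + t\<^sup>2 * Y z) / sqrt (X z)) (t * y z k)" for t z k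
    let ?H = "\<lambda>w. quadric_point z0 e s ?m (c (fst w) (snd w))"
    have "continuous_on ({0..1} \<times> Q) ?H"
      unfolding c_def complex_eq
      using X1 by (intro continuous_intros cont contXY) (auto, smt (verit))
    moreover have "?H (t, z) \<in> Q" if "z \<in> Q" for t z
    proof -
      have "(1 + t\<^sup>2 * Y z) \<ge> 0"
        using Y0 by (simp add: add_nonneg_nonneg)
      then have "(c t z k)\<^sup>2 = Complex ((x z k)\<^sup>2 * ((1 + t\<^sup>2 * Y z) / X z) - t\<^sup>2 * (y z k)\<^sup>2)
            ((2 * t * sqrt (1 + t\<^sup>2 * Y z) / sqrt (X z)) * (x z k * y z k))" for k
        using X1 [OF that] by (simp add: c_def complex_eq_iff power2_eq_square)
      then have "(\<Sum>k<?m. (c t z k)\<^sup>2) = Complex (X z * ((1 + t\<^sup>2 * Y z) / X z) - t\<^sup>2 * Y z)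
            ((2 * t * sqrt (1 + t\<^sup>2 * Y z) / sqrt (X z)) * (\<Sum>k<?m. x z k * y z k))"
        by (simp only: complex_eq_iff Re_sum Im_sum complex.sel X_def Y_def sum_distrib_left sum_distrib_right sum_subtractf)
      then have "(\<Sum>k<?m. (c t z k)\<^sup>2) = 1"
        using XY [OF that] X1 [OF that] by (simp only:) (simp add: complex_eq_iff)
      then show ?thesis
        by (simp add: Q_def quadric_point_in del: sum.lessThan_Suc)
    qed
    moreover have "?H (0, z) = (G \<circ> F) z" for z
      by (auto simp: c_def G_def F_def quadric_point_def complex_eq complex_of_real_def intro!: sum.cong simp del: sum.lessThan_Suc)
    moreover have "?H (1, z) = id z" if "z \<in> Q" for z
    proof -
      have "c 1 z = quadric_coord z0 e s z"
        using XY(1) [OF that] X1 [OF that] by (simp add: c_def cxy fun_eq_iff)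
      then show ?thesis
        using bil_quadricD(1) [OF e s] that by (simp add: Q_def)
    qed
    ultimately show ?thesis
      by (subst homotopic_with) (auto simp: continuous_map_in_subtopology intro!: exI [of _ ?H])
  qed
  ultimately show ?thesis
    unfolding homotopy_equivalent_space_def Q_def [symmetric] by blast
qed

section \<open>Excisive couples of neighbourhood retracts\<close>

text \<open>The identity at time 0, the constant homotopy on \<open>C\<close> and a neighbourhood
  retraction \<open>r\<close> at time 1 fit together on a closed subset of
  \<open>{0..1} \<times> A\<close>, so they extend to a neighbourhood \<open>G\<close> since
  \<open>A\<close> is an ANR. A tube around \<open>C\<close> lies in \<open>G\<close>; away from it,
  a Urysohn function slows time down to 0, which makes the homotopy total.\<close>

lemma ANR_closed_pair_homotopy:
  fixes A C :: "'a::euclidean_space set"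
  assumes A: "ANR A" and C: "ANR C" and clo: "closedin (top_of_set A) C"
  obtains \<phi> U where "openin (top_of_set A) U" "C \<subseteq> U"
    "continuous_on ({0..1::real} \<times> A) \<phi>" "\<And>t x. t \<in> {0..1} \<Longrightarrow> x \<in> A \<Longrightarrow> \<phi> (t, x) \<in> A"
    "\<And>x. x \<in> A \<Longrightarrow> \<phi> (0, x) = x" "\<And>t x. t \<in> {0..1} \<Longrightarrow> x \<in> C \<Longrightarrow> \<phi> (t, x) = x"
    "\<And>x. x \<in> U \<Longrightarrow> \<phi> (1, x) \<in> C"
proof -
  \<comment> \<open>A closed \<open>W\<close> around the open \<open>V\<close> is taken so that the
    set on which the homotopy is prescribed is closed.\<close>
  obtain V W where VW: "openin (top_of_set A) V" "closedin (top_of_set A) W" "C \<subseteq> V" "V \<subseteq> W" "C retract_of W"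
    using ANR_imp_closed_neighbourhood_retract [OF C clo] by blast
  then obtain r where r: "continuous_on W r" "\<And>x. x \<in> W \<Longrightarrow> r x \<in> C" "\<And>x. x \<in> C \<Longrightarrow> r x = x"
    unfolding retract_of_def retraction_def by blast
  have sub: "C \<subseteq> A" "W \<subseteq> A" "V \<subseteq> A"
    using clo VW openin_imp_subset by (auto dest: closedin_imp_subset)
  define K1 where "K1 = {0::real} \<times> A \<union> {0..1} \<times> C"
  define K2 where "K2 = {1::real} \<times> W"
  define f where "f w = (if w \<in> K2 then r (snd w) else snd w)" for w
  have cl: "closedin (top_of_set ({0..1} \<times> A)) K1" "closedin (top_of_set ({0..1} \<times> A)) K2"
    unfolding K1_def K2_def using clo VW(2)
    by (intro closedin_Un closedin_Times; auto intro: closed_subset)+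
  have "K1 \<union> K2 \<subseteq> {0..1} \<times> A"
    using sub by (auto simp: K1_def K2_def)
  then have cl': "closedin (top_of_set (K2 \<union> K1)) K1" "closedin (top_of_set (K2 \<union> K1)) K2"
    using cl by (auto elim: closedin_subset_trans)
  have "continuous_on (K2 \<union> K1) f"
    unfolding f_def
  proof (rule continuous_on_cases_local [OF cl'(2,1)])
    show "continuous_on K2 (\<lambda>w. r (snd w))"
      by (rule continuous_on_compose2 [OF r(1)]) (auto intro: continuous_intros simp: K2_def)
    show "continuous_on K1 snd"
      by (intro continuous_intros)
  qed (use sub r in \<open>auto simp: K1_def K2_def\<close>)
  moreover have "f \<in> K2 \<union> K1 \<rightarrow> A"
    using sub r by (auto simp: f_def K1_def K2_def)
  moreover have "closedin (top_of_set ({0..1} \<times> A)) (K2 \<union> K1)"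
    using cl by blast
  ultimately obtain G g where g: "K2 \<union> K1 \<subseteq> G" "openin (top_of_set ({0..1} \<times> A)) G"
    "continuous_on G g" "g \<in> G \<rightarrow> A" "\<And>x. x \<in> K2 \<union> K1 \<Longrightarrow> g x = f x"
    using ANR_imp_absolute_neighbourhood_extensor [OF A] by metis
  have "{0..1} \<times> C \<subseteq> G"
    using g(1) by (auto simp: K1_def)
  then obtain T where T: "openin (top_of_set A) T" "C \<subseteq> T" "{0..1} \<times> T \<subseteq> G"
    using tube_lemma_gen [of "{0..1::real}" C A G] sub g(2) by auto
  have "openin (top_of_set A) (T \<inter> V)"
    using T VW by blast
  then have "closedin (top_of_set A) (A - T \<inter> V)"
    using closedin_diff [OF closedin_topspace] by fastforce
  then obtain u' where u': "continuous_on A u'" "\<And>x. x \<in> A \<Longrightarrow> u' x \<in> closed_segment (1::real) 0"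
    "\<And>x. x \<in> C \<Longrightarrow> u' x = 1" "\<And>x. x \<in> A - T \<inter> V \<Longrightarrow> u' x = 0"
    using Urysohn_local [OF clo, of "A - T \<inter> V" "1::real" 0] T(2) VW(3) by blast
  \<comment> \<open>Doubling and cutting off makes \<open>u\<close> equal to 1 on the whole
    neighbourhood where \<open>u' > 1/2\<close>; there the homotopy runs to time 1 and ends in
    \<open>C\<close>.\<close>
  define u where "u x = min 1 (2 * u' x)" for x
  have u01: "u x \<in> {0..1}" if "x \<in> A" for x
    using u'(2) [OF that] by (auto simp: u_def closed_segment_eq_real_ivl)
  have contu: "continuous_on A u"
    unfolding u_def by (intro continuous_intros u'(1))
  define \<phi> where "\<phi> w = g (fst w * u (snd w), snd w)" for w
  have inO: "(t * u x, x) \<in> G" if "t \<in> {0..1}" "x \<in> A" for t x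
  proof (cases "x \<in> T \<inter> V")
    case True
    have "t * u x \<in> {0..1}"
      using that u01 [OF that(2)] by (auto intro: mult_le_one)
    then show ?thesis
      using True T(3) by auto
  next
    case False
    then have "u x = 0" using u' that by (simp add: u_def)
    then show ?thesis
      using g(1) that by (auto simp: K1_def)
  qed
  show thesis
  proof
    show "openin (top_of_set A) {x \<in> A. u' x \<in> {1/2<..}}"
      by (rule continuous_openin_preimage_gen [OF u'(1), unfolded vimage_def Int_def, simplified]) auto
    show "C \<subseteq> {x \<in> A. u' x \<in> {1/2<..}}"
      using sub u' by auto
    show "continuous_on ({0..1} \<times> A) \<phi>"
      unfolding \<phi>_def
      by (intro continuous_on_compose2 [OF g(3)] continuous_intros continuous_on_compose2 [OF contu])
        (use inO in auto)
    show "\<phi> (t, x) \<in> A" if "t \<in> {0..1}" "x \<in> A" for t x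
      using inO [OF that] g(4) by (auto simp: \<phi>_def)
    show "\<phi> (0, x) = x" if "x \<in> A" for x
      using that g(5) [of "(0, x)"] by (simp add: \<phi>_def K1_def f_def K2_def)
    show "\<phi> (t, x) = x" if "t \<in> {0..1}" "x \<in> C" for t x
    proof -
      have "u x = 1" using u' that by (simp add: u_def)
      then show ?thesis
        using that g(5) [of "(t, x)"] r by (auto simp: \<phi>_def K1_def f_def)
    qed
    show "\<phi> (1, x) \<in> C" if "x \<in> {x \<in> A. u' x \<in> {1/2<..}}" for x
    proof -
      have "u x = 1" using that by (simp add: u_def)
      moreover have "x \<in> W"
        using that u'(4) [of x] VW by auto
      ultimately show ?thesis
        using g(5) [of "(1, x)"] r by (simp add: \<phi>_def f_def K2_def)
    qed
  qed
qed

text \<open>The homotopy of \<open>A\<close> fixes \<open>A \<inter> B\<close>, so the identity on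
  \<open>B\<close> continues it. The set \<open>U \<union> B\<close> is relatively open because its
  complement in \<open>A \<union> B\<close> is the closed set \<open>A - U\<close>, and at time 1 it
  is carried into \<open>B\<close>.\<close>

lemma ANR_triad_homotopy:
  fixes A B :: "'a::euclidean_space set"
  assumes A: "ANR A" "closed A" and B: "closed B" and AB: "ANR (A \<inter> B)"
  obtains f V where "openin (top_of_set (A \<union> B)) V" "B \<subseteq> V"
    "homotopic_with_canon (\<lambda>h. h \<in> A \<rightarrow> A \<and> h \<in> B \<rightarrow> B) (A \<union> B) (A \<union> B) f id"
    "f \<in> V \<rightarrow> B"
proof -
  have clo: "closedin (top_of_set A) (A \<inter> B)"
    using B by (simp add: closedin_closed_Int)
  obtain \<phi> U where \<phi>: "openin (top_of_set A) U" "A \<inter> B \<subseteq> U"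
    "continuous_on ({0..1::real} \<times> A) \<phi>" "\<And>t x. t \<in> {0..1} \<Longrightarrow> x \<in> A \<Longrightarrow> \<phi> (t, x) \<in> A"
    "\<And>x. x \<in> A \<Longrightarrow> \<phi> (0, x) = x" "\<And>t x. t \<in> {0..1} \<Longrightarrow> x \<in> A \<inter> B \<Longrightarrow> \<phi> (t, x) = x"
    "\<And>x. x \<in> U \<Longrightarrow> \<phi> (1, x) \<in> A \<inter> B"
    by (rule ANR_closed_pair_homotopy [OF A(1) AB clo]) (rule that)
  define \<Phi> where "\<Phi> w = (if snd w \<in> A then \<phi> w else snd w)" for w
  have UA: "U \<subseteq> A"
    using \<phi>(1) openin_imp_subset by blast
  show thesis
  proof
    have "closedin (top_of_set A) (A - U)"
      using closedin_diff [OF closedin_topspace \<phi>(1)] by simp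
    then have "closed (A - U)"
      using A(2) closedin_closed_eq by blast
    then have "openin (top_of_set (A \<union> B)) ((A \<union> B) \<inter> - (A - U))"
      by (intro openin_open_Int open_Compl)
    then have "openin (top_of_set (A \<union> B)) ((A \<union> B) - (A - U))"
      by (simp only: Diff_eq)
    moreover have "(A \<union> B) - (A - U) = U \<union> B"
      using \<phi>(2) UA by auto
    ultimately show "openin (top_of_set (A \<union> B)) (U \<union> B)" by simp
    have "continuous_on ({0..1} \<times> A \<union> {0..1} \<times> B) \<Phi>"
      unfolding \<Phi>_def
    proof (rule continuous_on_cases_local)
      show "closedin (top_of_set ({0..1::real} \<times> A \<union> {0..1} \<times> B)) ({0..1} \<times> A)"
        "closedin (top_of_set ({0..1::real} \<times> A \<union> {0..1} \<times> B)) ({0..1} \<times> B)"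
        using A B by (auto intro!: closed_subset closed_Times)
      show "continuous_on ({0..1} \<times> B) snd"
        by (intro continuous_intros)
    qed (use \<phi> in auto)
    then have "continuous_on ({0..1} \<times> (A \<union> B)) \<Phi>"
      by (simp only: Sigma_Un_distrib2)
    moreover have "\<Phi> (t, x) \<in> A" if "t \<in> {0..1}" "x \<in> A" for t x
      using \<phi>(4) that by (simp add: \<Phi>_def)
    moreover have "\<Phi> (t, x) \<in> B" if "t \<in> {0..1}" "x \<in> B" for t x
      using \<phi>(6) that by (cases "x \<in> A") (simp_all add: \<Phi>_def)
    moreover have "\<Phi> (0, x) = x" for x
      using \<phi>(5) by (simp add: \<Phi>_def)
    ultimately have "homotopic_with_canon (\<lambda>h. h \<in> A \<rightarrow> A \<and> h \<in> B \<rightarrow> B) (A \<union> B) (A \<union> B) id (\<lambda>x. \<Phi> (1, x))"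
      unfolding homotopic_with_def
      by (intro exI [of _ \<Phi>]) (auto simp: continuous_map_in_subtopology)
    then show "homotopic_with_canon (\<lambda>h. h \<in> A \<rightarrow> A \<and> h \<in> B \<rightarrow> B) (A \<union> B) (A \<union> B) (\<lambda>x. \<Phi> (1, x)) id"
      by (simp add: homotopic_with_sym)
    show "(\<lambda>x. \<Phi> (1, x)) \<in> U \<union> B \<rightarrow> B"
    proof (rule Pi_I)
      fix x assume x: "x \<in> U \<union> B"
      show "\<Phi> (1, x) \<in> B"
        using x \<phi>(6) [of 1 x] \<phi>(7) [of x] UA by (cases "x \<in> A") (auto simp: \<Phi>_def)
    qed
  qed auto
qed

text \<open>Surjectivity of this map lets cycles of the union be split over the two members, and
  injectivity does the same for boundaries. This takes the place of subdividing simplices.\<close>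

definition excisive_couple :: "'a::topological_space set \<Rightarrow> 'a set \<Rightarrow> bool" where
  "excisive_couple A B \<longleftrightarrow>
     (\<forall>p. hom_induced p (top_of_set A) (A \<inter> B) (top_of_set (A \<union> B)) B id
        \<in> iso (relative_homology_group p (top_of_set A) (A \<inter> B))
              (relative_homology_group p (top_of_set (A \<union> B)) B))"

text \<open>The homotopy makes the excision homomorphism \<open>e\<close> for \<open>B\<close> a retract of the one \<open>e'\<close> for a
  neighbourhood \<open>V\<close> of \<open>B\<close>, which is bijective by the excision axiom.\<close>

proposition ANR_excisive_couple:
  fixes A B :: "'a::euclidean_space set"
  assumes A: "ANR A" "closed A" and B: "closed B" and AB: "ANR (A \<inter> B)"
  shows "excisive_couple A B"
  unfolding excisive_couple_def
proof
  fix p :: int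
  obtain f V where V: "openin (top_of_set (A \<union> B)) V" "B \<subseteq> V"
    and hom: "homotopic_with_canon (\<lambda>h. h \<in> A \<rightarrow> A \<and> h \<in> B \<rightarrow> B) (A \<union> B) (A \<union> B) f id"
    and f: "f \<in> V \<rightarrow> B"
    by (rule ANR_triad_homotopy [OF assms])
  let ?A = "top_of_set A" and ?X = "top_of_set (A \<union> B)"
  define e where "e = hom_induced p ?A (A \<inter> B) ?X B id"
  define e' where "e' = hom_induced p ?A (V \<inter> A) ?X V id"
  define j where "j = hom_induced p ?A (A \<inter> B) ?A (V \<inter> A) id"
  define j' where "j' = hom_induced p ?X B ?X V id"
  define fA where "fA = hom_induced p ?A (V \<inter> A) ?A (A \<inter> B) f"
  define fX where "fX = hom_induced p ?X V ?X B f"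
  have VX: "V \<subseteq> A \<union> B"
    using V openin_imp_subset by blast
  have fcont: "continuous_map ?X ?X f" and fA': "f \<in> A \<rightarrow> A"
    using hom homotopic_with_imp_continuous_maps homotopic_with_imp_property by blast+
  have fAcont: "continuous_map ?A ?A f"
    using fcont fA' by (auto simp: continuous_map_in_subtopology elim: continuous_on_subset)
  have homA: "homotopic_with (\<lambda>h. h \<in> A \<inter> B \<rightarrow> A \<inter> B) ?A ?A f id"
  proof -
    obtain h where h: "continuous_map (prod_topology (top_of_set {0..1::real}) ?X) ?X h"
      "\<forall>x. h (0, x) = f x" "\<forall>x. h (1, x) = id x"
      "\<forall>t\<in>{0..1}. (\<lambda>x. h (t, x)) \<in> A \<rightarrow> A \<and> (\<lambda>x. h (t, x)) \<in> B \<rightarrow> B"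
      using hom unfolding homotopic_with_def by (elim exE conjE) (rule that)
    have "continuous_on ({0..1::real} \<times> (A \<union> B)) h"
      using h(1) by (simp add: continuous_map_in_subtopology)
    then have "continuous_on ({0..1::real} \<times> A) h"
      by (rule continuous_on_subset) blast
    moreover have "h \<in> {0..1} \<times> A \<rightarrow> A"
      using h(4) by blast
    ultimately have "continuous_map (prod_topology (top_of_set {0..1::real}) ?A) ?A h"
      by (simp add: continuous_map_in_subtopology)
    moreover have "\<forall>t\<in>{0..1}. (\<lambda>x. h (t, x)) \<in> A \<inter> B \<rightarrow> A \<inter> B"
      using h(4) by blast
    ultimately show ?thesis
      unfolding homotopic_with_def using h(2,3) by blast
  qed
  have homX: "homotopic_with (\<lambda>h. h \<in> B \<rightarrow> B) ?X ?X f id"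
    using hom by (rule homotopic_with_mono) auto
  have inc: "continuous_map ?A ?X id"
    by (simp add: continuous_map_in_subtopology image_subset_iff)
  have 1: "e' \<circ> j = j' \<circ> e"
    unfolding e_def e'_def j_def j'_def using V inc
    by (subst (1 2) hom_induced_compose [symmetric]) auto
  have 2: "fX \<circ> e' = e \<circ> fA"
  proof -
    have "fX \<circ> e' = hom_induced p ?A (V \<inter> A) ?X B (f \<circ> id)"
      unfolding fX_def e'_def using inc fcont f by (subst hom_induced_compose) auto
    also have "\<dots> = hom_induced p ?A (V \<inter> A) ?X B (id \<circ> f)"
      by simp
    also have "\<dots> = e \<circ> fA"
      unfolding e_def fA_def using inc fAcont f fA' by (intro hom_induced_compose) auto
    finally show ?thesis .
  qed
  have 3: "fA (j x) = x" if "x \<in> carrier (relative_homology_group p ?A (A \<inter> B))" for x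
  proof -
    have "fA \<circ> j = hom_induced p ?A (A \<inter> B) ?A (A \<inter> B) (f \<circ> id)"
      unfolding fA_def j_def using V f fA' fAcont by (intro hom_induced_compose [symmetric]) auto
    also have "\<dots> = hom_induced p ?A (A \<inter> B) ?A (A \<inter> B) id"
      using homology_homotopy_axiom [OF homA] by simp
    finally show ?thesis
      using hom_induced_id [OF that] by (metis comp_apply)
  qed
  have 4: "fX (j' x) = x" if "x \<in> carrier (relative_homology_group p ?X B)" for x
  proof -
    have "fX \<circ> j' = hom_induced p ?X B ?X B (f \<circ> id)"
      unfolding fX_def j'_def using V f fcont by (intro hom_induced_compose [symmetric]) auto
    also have "\<dots> = hom_induced p ?X B ?X B id"
      using homology_homotopy_axiom [OF homX] by simp
    finally show ?thesis
      using hom_induced_id [OF that] by (metis comp_apply)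
  qed
  have iso: "e' \<in> iso (relative_homology_group p ?A (V \<inter> A)) (relative_homology_group p ?X V)"
  proof -
    \<comment> \<open>Excising \<open>B - A\<close> leaves the pair
      \<open>(A, V \<inter> A)\<close>; the closure of \<open>B - A\<close> lies in the closed set
      \<open>B\<close>, hence in the interior of \<open>V\<close>.\<close>
    have "?X closure_of (B - A) \<subseteq> ?X closure_of B"
      by (intro closure_of_mono) auto
    also have "\<dots> = B"
      using B by (simp add: closure_of_eq closed_subset)
    also have "\<dots> \<subseteq> ?X interior_of V"
      using V by (simp add: interior_of_openin)
    finally have "hom_induced p (subtopology ?X (A \<union> B - (B - A))) (V - (B - A)) (subtopology ?X (A \<union> B)) V id
      \<in> iso (relative_homology_group p (subtopology ?X (A \<union> B - (B - A))) (V - (B - A)))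
          (relative_homology_group p (subtopology ?X (A \<union> B)) V)"
      using VX by (intro homology_excision_axiom)
    moreover have "subtopology ?X (A \<union> B - (B - A)) = ?A" "V - (B - A) = V \<inter> A" "subtopology ?X (A \<union> B) = ?X"
      using VX by (auto simp: subtopology_subtopology intro!: arg_cong2 [of _ _ _ _ subtopology])
    ultimately show ?thesis
      unfolding e'_def by simp
  qed
  then have e'_bij: "inj_on e' (carrier (relative_homology_group p ?A (V \<inter> A)))"
    "e' ` carrier (relative_homology_group p ?A (V \<inter> A)) = carrier (relative_homology_group p ?X V)"
    by (simp_all add: iso_def bij_betw_def)
  have "e \<in> iso (relative_homology_group p ?A (A \<inter> B)) (relative_homology_group p ?X B)"
  proof (rule isoI)
    show e: "e \<in> hom (relative_homology_group p ?A (A \<inter> B)) (relative_homology_group p ?X B)"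
      by (simp add: e_def hom_induced_hom)
    show "bij_betw e (carrier (relative_homology_group p ?A (A \<inter> B))) (carrier (relative_homology_group p ?X B))"
      unfolding bij_betw_def
    proof (intro conjI inj_onI)
      fix x y
      assume xy: "x \<in> carrier (relative_homology_group p ?A (A \<inter> B))"
        "y \<in> carrier (relative_homology_group p ?A (A \<inter> B))" "e x = e y"
      have "e' (j x) = e' (j y)"
        using 1 xy(3) by (metis comp_apply)
      then have "j x = j y"
        by (rule inj_onD [OF e'_bij(1)]) (simp_all add: j_def hom_induced_carrier)
      then show "x = y"
        using 3 xy by metis
    next
      have "\<exists>x\<in>carrier (relative_homology_group p ?A (A \<inter> B)). e x = y"
        if y: "y \<in> carrier (relative_homology_group p ?X B)" for y
      proof -
      have "j' y \<in> carrier (relative_homology_group p ?X V)"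
        by (simp add: j'_def hom_induced_carrier)
      then have "j' y \<in> e' ` carrier (relative_homology_group p ?A (V \<inter> A))"
        by (simp only: e'_bij(2))
      then obtain z where z: "e' z = j' y"
        by (metis imageE)
      have "e (fA z) = fX (e' z)"
        using 2 by (metis comp_apply)
      then have "e (fA z) = y"
        using z 4 [OF y] by simp
      then show ?thesis
        by (metis fA_def hom_induced_carrier)
      qed
      then show "e ` carrier (relative_homology_group p ?A (A \<inter> B)) = carrier (relative_homology_group p ?X B)"
        using e by (auto simp: hom_def)
    qed
  qed
  then show "hom_induced p ?A (A \<inter> B) ?X B id
      \<in> iso (relative_homology_group p ?A (A \<inter> B)) (relative_homology_group p ?X B)"
    by (simp only: e_def)
qed

section \<open>Splitting chains over an excisive couple\<close>

abbreviation chain_in :: "nat \<Rightarrow> 'a::topological_space set \<Rightarrow> 'a chain \<Rightarrow> bool" where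
  "chain_in p A \<equiv> singular_chain p (top_of_set A)"

abbreviation cycle_in :: "nat \<Rightarrow> 'a::topological_space set \<Rightarrow> 'a chain \<Rightarrow> bool" where
  "cycle_in p A \<equiv> singular_relcycle p (top_of_set A) {}"

abbreviation boundary_in :: "nat \<Rightarrow> 'a::topological_space set \<Rightarrow> 'a chain \<Rightarrow> bool" where
  "boundary_in p A \<equiv> singular_relboundary p (top_of_set A) {}"

text \<open>By surjectivity of excision the class of \<open>c\<close> modulo \<open>B\<close> is
  represented by a chain \<open>u\<close> of \<open>A\<close>. The homology between \<open>c\<close>
  and \<open>u\<close> leaves over a chain of \<open>B\<close>, which is \<open>v\<close>.\<close>

lemma excisive_couple_split:
  assumes exc: "excisive_couple A B" and c: "singular_relcycle p (top_of_set (A \<union> B)) B c"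
  obtains u v d where "chain_in p A u" "chain_in p B v"
    "chain_in (Suc p) (A \<union> B) d" "c = u + v + chain_boundary (Suc p) d"
proof -
  let ?A = "top_of_set A" and ?X = "top_of_set (A \<union> B)"
  let ?e = "hom_induced (int p) ?A (A \<inter> B) ?X B id"
  have B: "subtopology ?X B = top_of_set B"
    by (simp add: subtopology_subtopology Int_commute Un_Int_eq)
  have inc: "continuous_map ?A ?X id"
    by (simp add: continuous_map_in_subtopology image_subset_iff)
  have "?e ` carrier (relative_homology_group (int p) ?A (A \<inter> B)) = carrier (relative_homology_group (int p) ?X B)"
    using exc by (simp add: excisive_couple_def iso_def bij_betw_def)
  moreover have "homologous_rel_set p ?X B c \<in> carrier (relative_homology_group (int p) ?X B)"
    using c by (auto simp: carrier_relative_homology_group)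
  ultimately have "homologous_rel_set p ?X B c \<in> ?e ` carrier (relative_homology_group (int p) ?A (A \<inter> B))"
    by (simp only:)
  then obtain y where y: "homologous_rel_set p ?X B c = ?e y"
    "y \<in> carrier (relative_homology_group (int p) ?A (A \<inter> B))"
    by (rule imageE)
  from y(2) obtain u where u: "singular_relcycle p ?A (A \<inter> B) u" "y = homologous_rel_set p ?A (A \<inter> B) u"
    by (auto simp: carrier_relative_homology_group)
  have uch: "singular_chain p ?A u"
    using u(1) by (simp add: singular_relcycle)
  have "?e y = homologous_rel_set p ?X B (chain_map p id u)"
    unfolding u(2) by (rule hom_induced_chain_map [OF inc _ u(1)]) auto
  also have "chain_map p id u = u"
    using uch by (rule chain_map_ident)
  finally have "homologous_rel p ?X B c u"
    using y(1) by (simp only: homologous_rel_set_eq)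
  then obtain d v where "singular_chain (Suc p) ?X d" "singular_chain p (subtopology ?X B) v"
    "chain_boundary (Suc p) d + v = c - u"
    by (auto simp: homologous_rel_def singular_relboundary)
  then show thesis
    using that [OF uch, of v d] by (simp add: B algebra_simps)
qed

lemma excisive_couple_cycle:
  assumes exc: "excisive_couple A B" and c: "cycle_in p (A \<union> B) c"
  obtains u v where "chain_in p A u" "chain_in p B v"
    "homologous_rel p (top_of_set (A \<union> B)) {} c (u + v)"
proof -
  have "chain_in p (A \<union> B) c" "chain_boundary p c = 0"
    using c by (simp_all add: singular_cycle)
  then have "singular_relcycle p (top_of_set (A \<union> B)) B c"
    by (simp add: singular_relcycle)
  then obtain u v d where uv: "chain_in p A u" "chain_in p B v"
    and d: "chain_in (Suc p) (A \<union> B) d" "c = u + v + chain_boundary (Suc p) d"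
    by (rule excisive_couple_split [OF exc])
  have "homologous_rel p (top_of_set (A \<union> B)) {} c (u + v)"
    using d by (auto simp: homologous_rel_def singular_boundary)
  with uv show thesis
    by (rule that)
qed

lemma singular_chain_inter:
  assumes "chain_in p A c" "chain_in p B c"
  shows "chain_in p (A \<inter> B) c"
  using assms by (simp add: singular_chain_subtopology)

lemma singular_chain_top_of_set_mono:
  "chain_in p A c \<Longrightarrow> A \<subseteq> B \<Longrightarrow> chain_in p B c"
  by (rule singular_chain_mono)

text \<open>Injectivity of excision writes \<open>u\<close> as a boundary in \<open>A\<close> plus a
  chain \<open>w\<close> of \<open>A \<inter> B\<close>. Then \<open>d - u1\<close> is a cycle
  modulo \<open>B\<close> with boundary \<open>w + v\<close>, and splitting it one degree higher
  distributes the boundary over both members. This is what makes the connecting homomorphism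
  independent of the splitting.\<close>

lemma excisive_couple_boundary:
  assumes exc: "excisive_couple A B"
    and u: "chain_in p A u" and v: "chain_in p B v"
    and bd: "boundary_in p (A \<union> B) (u + v)"
  obtains u' v' where "chain_in (Suc p) A u'" "chain_in (Suc p) B v'"
    "u + v = chain_boundary (Suc p) u' + chain_boundary (Suc p) v'"
proof -
  let ?A = "top_of_set A" and ?B = "top_of_set B" and ?X = "top_of_set (A \<union> B)"
  let ?e = "hom_induced (int p) ?A (A \<inter> B) ?X B id"
  have sub: "subtopology ?X B = ?B" "subtopology ?A (A \<inter> B) = top_of_set (A \<inter> B)"
    by (simp_all add: subtopology_subtopology Int_commute Un_Int_eq flip: Int_assoc)
  have inc: "continuous_map ?A ?X id"
    by (simp add: continuous_map_in_subtopology image_subset_iff)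
  obtain d where d: "singular_chain (Suc p) ?X d" "chain_boundary (Suc p) d = u + v"
    using bd by (auto simp: singular_boundary)
  then have "chain_boundary p u + chain_boundary p v = 0"
    using chain_boundary_boundary_alt [OF d(1)] by (simp add: chain_boundary_add)
  then have uv: "chain_boundary p u = - chain_boundary p v"
    by (simp add: eq_neg_iff_add_eq_0)
  have "singular_chain (p - 1) ?B (chain_boundary p u)"
    unfolding uv using v by (simp add: singular_chain_minus singular_chain_boundary)
  then have "chain_in (p - 1) (A \<inter> B) (chain_boundary p u)"
    using u by (intro singular_chain_inter) (simp_all add: singular_chain_boundary)
  then have urc: "singular_relcycle p ?A (A \<inter> B) u"
    using u by (simp add: singular_relcycle sub)
  have "singular_relboundary p ?X B u"
    unfolding singular_relboundary
    using d v by (intro exI [of _ d] exI [of _ "- v"]) (simp add: sub singular_chain_minus)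
  then have "homologous_rel_set p ?X B u = homologous_rel_set p ?X B 0"
    unfolding homologous_rel_set_eq by (simp add: homologous_rel_def)
  then have "?e (homologous_rel_set p ?A (A \<inter> B) u) = homologous_rel_set p ?X B 0"
    using hom_induced_chain_map [OF inc _ urc, of B] chain_map_ident [OF u] by simp
  also have "\<dots> = ?e (homologous_rel_set p ?A (A \<inter> B) 0)"
    using hom_induced_chain_map [OF inc, of "A \<inter> B" B p 0] by simp
  finally have "homologous_rel_set p ?A (A \<inter> B) u = homologous_rel_set p ?A (A \<inter> B) 0"
  proof (rule inj_onD [rotated])
    show "inj_on ?e (carrier (relative_homology_group (int p) ?A (A \<inter> B)))"
      using exc by (simp add: excisive_couple_def iso_def bij_betw_def)
  qed (use urc in \<open>auto simp: carrier_relative_homology_group intro!: imageI\<close>)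
  then have "singular_relboundary p ?A (A \<inter> B) u"
    unfolding homologous_rel_set_eq by (simp add: homologous_rel_def)
  then obtain u1 w where u1: "singular_chain (Suc p) ?A u1"
    and w: "chain_in p (A \<inter> B) w" "chain_boundary (Suc p) u1 + w = u"
    by (auto simp: singular_relboundary sub)
  have d': "chain_boundary (Suc p) (d - u1) = w + v"
    using d w by (simp add: chain_boundary_diff algebra_simps)
  have "singular_chain p ?B (w + v)"
    using v w singular_chain_top_of_set_mono [of p "A \<inter> B" w B] by (simp add: singular_chain_add)
  moreover have "singular_chain (Suc p) ?X (d - u1)"
    using d u1 singular_chain_top_of_set_mono [of "Suc p" A u1 "A \<union> B"] by (simp add: singular_chain_diff)
  ultimately have "singular_relcycle (Suc p) ?X B (d - u1)"
    by (simp add: singular_relcycle sub d')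
  then obtain u2 v2 x where u2: "singular_chain (Suc p) ?A u2" "singular_chain (Suc p) ?B v2"
    "singular_chain (Suc (Suc p)) ?X x" "d - u1 = u2 + v2 + chain_boundary (Suc (Suc p)) x"
    by (rule excisive_couple_split [OF exc])
  have "chain_boundary (Suc p) (d - u1) = chain_boundary (Suc p) u2 + chain_boundary (Suc p) v2"
    using chain_boundary_boundary [OF u2(3)] by (simp add: u2(4) chain_boundary_add)
  moreover have "u + v = chain_boundary (Suc p) u1 + chain_boundary (Suc p) (d - u1)"
    unfolding d' add.assoc [symmetric] w(2) ..
  ultimately have "u + v = chain_boundary (Suc p) (u1 + u2) + chain_boundary (Suc p) v2"
    by (simp only: chain_boundary_add add.assoc)
  then show thesis
    using that u1 u2 by (meson singular_chain_add)
qed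

section \<open>Reduced homology classes and representing cycles\<close>

lemma hclass_eq_iff: "hclass p A c = hclass p A d \<longleftrightarrow> boundary_in p A (c - d)"
  unfolding homologous_rel_set_eq by (simp only: homologous_rel_def)

lemma mult_Hred_hclass: "hclass p A c \<otimes>\<^bsub>Hred (int p) A\<^esub> hclass p A d = hclass p A (c + d)"
proof -
  have "(\<Union>r\<in>hclass p A c. \<Union>s\<in>hclass p A d. {r + s}) = hclass p A (c + d)"
  proof (intro equalityI subsetI)
    fix x assume "x \<in> hclass p A (c + d)"
    then have "x - c \<in> hclass p A d"
      by (simp add: homologous_rel_def algebra_simps)
    then show "x \<in> (\<Union>r\<in>hclass p A c. \<Union>s\<in>hclass p A d. {r + s})"
      by (intro UN_I [of c] UN_I [of "x - c"]) auto
  qed (auto intro: homologous_rel_add)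
  then show ?thesis
    by (simp add: reduced_homology_group_def subgroup_generated_def mult_relative_homology_group)
qed

lemma one_Hred_hclass: "\<one>\<^bsub>Hred (int p) A\<^esub> = hclass p A 0"
  using homologous_rel_set_eq_relboundary [of p "top_of_set A" "{}" 0]
  by (simp add: one_reduced_homology_group)

lemma Hred_hclassE:
  assumes "x \<in> carrier (Hred (int p) A)"
  obtains c where "cycle_in p A c" "x = hclass p A c"
  using subsetD [OF carrier_reduced_homology_group_subset assms]
  by (auto simp: carrier_relative_homology_group)

text \<open>Reduced homology is the kernel of the map induced by the map to a point, so membership
  turns into a condition on the image chain. In degree 0 this condition is the vanishing of the
  augmentation.\<close>

lemma hclass_in_Hred_iff:
  assumes c: "cycle_in p A c"
  shows "hclass p A c \<in> carrier (Hred (int p) A) \<longleftrightarrow>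
    singular_relboundary p (discrete_topology {()}) {} (chain_map p (\<lambda>_. ()) c)"
proof -
  have "hom_induced (int p) (top_of_set A) {} (discrete_topology {()}) {} (\<lambda>x. ()) (hclass p A c)
      = homologous_rel_set p (discrete_topology {()}) {} (chain_map p (\<lambda>_. ()) c)"
    using c by (intro hom_induced_chain_map) auto
  then show ?thesis
    using c by (auto simp: carrier_reduced_homology_group kernel_def carrier_relative_homology_group
        homologous_rel_set_eq_relboundary)
qed

lemma hclass_in_Hred_Suc:
  assumes "cycle_in (Suc q) A c"
  shows "hclass (Suc q) A c \<in> carrier (Hred (int (Suc q)) A)"
  using assms by (subst un_reduced_homology_group) (auto simp: carrier_relative_homology_group simp del: of_nat_Suc)

lemma incl_hom_hclass:
  assumes "A \<subseteq> B" "cycle_in p A c"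
  shows "incl_hom (int p) A B (hclass p A c) = hclass p B c"
proof -
  have "chain_in p A c"
    using assms by (simp add: singular_cycle)
  then have "chain_map p id c = c"
    by (rule chain_map_ident)
  then show ?thesis
    using assms by (subst hom_induced_chain_map) (auto simp: continuous_map_in_subtopology)
qed

lemma trivial_Hred_boundary:
  assumes "trivial_group (Hred (int p) A)" "hclass p A c \<in> carrier (Hred (int p) A)"
  shows "boundary_in p A c"
proof -
  have "hclass p A c = hclass p A 0"
    using assms by (auto simp: trivial_group_def one_Hred_hclass)
  then show ?thesis
    by (simp add: hclass_eq_iff)
qed

text \<open>Two splittings of one class differ, up to the boundaries of chains \<open>s\<close> and
  \<open>t\<close> of the members, by a chain \<open>w\<close> that lies in both \<open>A\<close>
  and \<open>B\<close>; its boundary is the difference of the two values. So exactly one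
  \<open>y\<close> meets the description in \<open>mayer_vietoris\<close>.\<close>

lemma mayer_vietoris_hclass:
  assumes exc: "excisive_couple A B"
    and u: "chain_in (Suc q) A u" and v: "chain_in (Suc q) B v"
    and bd: "chain_boundary (Suc q) u = - chain_boundary (Suc q) v"
  shows "mayer_vietoris (int (Suc q)) A B (hclass (Suc q) (A \<union> B) (u + v))
    = hclass q (A \<inter> B) (chain_boundary (Suc q) u)"
proof -
  let ?P = "\<lambda>y. \<exists>u' v'. chain_in (Suc q) A u' \<and> chain_in (Suc q) B v' \<and>
    chain_boundary (Suc q) u' = - chain_boundary (Suc q) v' \<and>
    hclass (Suc q) (A \<union> B) (u + v) = hclass (Suc q) (A \<union> B) (u' + v') \<and>
    y = hclass q (A \<inter> B) (chain_boundary (Suc q) u')"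
  have "(THE y. ?P y) = hclass q (A \<inter> B) (chain_boundary (Suc q) u)"
  proof (rule the_equality)
    show "?P (hclass q (A \<inter> B) (chain_boundary (Suc q) u))"
      using u v bd by blast
    fix y assume "?P y"
    then obtain u' v' where u': "chain_in (Suc q) A u'" "chain_in (Suc q) B v'"
      "hclass (Suc q) (A \<union> B) (u + v) = hclass (Suc q) (A \<union> B) (u' + v')"
      and y: "y = hclass q (A \<inter> B) (chain_boundary (Suc q) u')"
      by blast
    have "boundary_in (Suc q) (A \<union> B) ((u - u') + (v - v'))"
      using u'(3) by (simp add: hclass_eq_iff algebra_simps)
    then obtain s t where st: "chain_in (Suc (Suc q)) A s" "chain_in (Suc (Suc q)) B t"
      "(u - u') + (v - v') = chain_boundary (Suc (Suc q)) s + chain_boundary (Suc (Suc q)) t"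
      by (rule excisive_couple_boundary [OF exc singular_chain_diff [OF u u'(1)] singular_chain_diff [OF v u'(2)]])
    define w where "w = u - u' - chain_boundary (Suc (Suc q)) s"
    have wA: "chain_in (Suc q) A w"
      using u u' st by (simp add: w_def singular_chain_diff singular_chain_boundary_alt)
    have "w = - (v - v' - chain_boundary (Suc (Suc q)) t)"
      using st(3) by (simp add: w_def algebra_simps)
    moreover have "chain_in (Suc q) B (- (v - v' - chain_boundary (Suc (Suc q)) t))"
      using v u' st by (simp only: singular_chain_minus) (simp add: singular_chain_diff singular_chain_boundary_alt)
    ultimately have w: "chain_in (Suc q) (A \<inter> B) w"
      using singular_chain_inter wA by metis
    have "chain_boundary (Suc q) w = chain_boundary (Suc q) u - chain_boundary (Suc q) u'"
      using chain_boundary_boundary [OF st(1)] by (simp add: w_def chain_boundary_diff)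
    then have "boundary_in q (A \<inter> B) (chain_boundary (Suc q) u - chain_boundary (Suc q) u')"
      using w by (auto simp: singular_boundary)
    then show "y = hclass q (A \<inter> B) (chain_boundary (Suc q) u)"
      using y by (metis hclass_eq_iff)
  qed
  then show ?thesis
    by (simp add: mayer_vietoris_def nat_add_distrib)
qed

lemma excisive_couple_HredE:
  assumes exc: "excisive_couple A B" and x: "x \<in> carrier (Hred (int p) (A \<union> B))"
  obtains u v where "chain_in p A u" "chain_in p B v"
    "chain_boundary p u = - chain_boundary p v" "x = hclass p (A \<union> B) (u + v)"
proof -
  obtain c where c: "cycle_in p (A \<union> B) c" "x = hclass p (A \<union> B) c"
    using Hred_hclassE [OF x] .
  obtain u v where uv: "chain_in p A u" "chain_in p B v"
    "homologous_rel p (top_of_set (A \<union> B)) {} c (u + v)"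
    using excisive_couple_cycle [OF exc c(1)] .
  then have "cycle_in p (A \<union> B) (u + v)"
    using c(1) homologous_rel_singular_relcycle by blast
  then have "chain_boundary p u + chain_boundary p v = 0"
    by (simp add: singular_cycle chain_boundary_add)
  then have "chain_boundary p u = - chain_boundary p v"
    by (simp add: eq_neg_iff_add_eq_0)
  moreover have "x = hclass p (A \<union> B) (u + v)"
    using uv c by (simp add: homologous_rel_set_eq)
  ultimately show thesis
    using uv that by blast
qed

section \<open>The Mayer-Vietoris sequence\<close>

text \<open>This is exactness of \<open>0 -> A x B -> X -> C -> 0\<close>, where the first map sends
  \<open>(a, b)\<close> to the product of \<open>k a\<close> and \<open>l b\<close>; the product
  group itself is avoided.\<close>

definition short_exact_sum ::
    "('x, 'xm) monoid_scheme \<Rightarrow> ('a, 'am) monoid_scheme \<Rightarrow> ('b, 'bm) monoid_scheme \<Rightarrow> ('c, 'cm) monoid_scheme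
      \<Rightarrow> ('a \<Rightarrow> 'x) \<Rightarrow> ('b \<Rightarrow> 'x) \<Rightarrow> ('x \<Rightarrow> 'c) \<Rightarrow> bool" where
  "short_exact_sum X A B C k l \<delta> \<longleftrightarrow>
     k \<in> hom A X \<and> l \<in> hom B X \<and> \<delta> \<in> epi X C \<and>
     (\<forall>x\<in>carrier X. \<delta> x = \<one>\<^bsub>C\<^esub> \<longleftrightarrow> (\<exists>a\<in>carrier A. \<exists>b\<in>carrier B. x = k a \<otimes>\<^bsub>X\<^esub> l b)) \<and>
     (\<forall>a\<in>carrier A. \<forall>b\<in>carrier B. k a \<otimes>\<^bsub>X\<^esub> l b = \<one>\<^bsub>X\<^esub> \<longrightarrow> a = \<one>\<^bsub>A\<^esub> \<and> b = \<one>\<^bsub>B\<^esub>)"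

lemma chain_boundary_of_boundary:
  assumes "singular_chain (Suc p) X c" "chain_boundary (Suc p) c = d"
  shows "chain_boundary p d = 0"
  using chain_boundary_boundary_alt [OF assms(1)] assms(2) by simp

text \<open>The second claim matters for \<open>q = 0\<close>: mapped to a point, \<open>u\<close>
  becomes a chain bounding the image of its boundary, so that boundary has augmentation zero and its
  class is reduced.\<close>

lemma connecting_class:
  assumes u: "chain_in (Suc q) A u" and v: "chain_in (Suc q) B v"
    and bd: "chain_boundary (Suc q) u = - chain_boundary (Suc q) v"
  shows "cycle_in q (A \<inter> B) (chain_boundary (Suc q) u)"
    and "hclass q (A \<inter> B) (chain_boundary (Suc q) u) \<in> carrier (Hred (int q) (A \<inter> B))"
proof -
  have "chain_in q B (chain_boundary (Suc q) u)"
    unfolding bd using v by (simp add: singular_chain_minus singular_chain_boundary_alt)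
  then have "chain_in q (A \<inter> B) (chain_boundary (Suc q) u)"
    using u by (intro singular_chain_inter) (simp_all add: singular_chain_boundary_alt)
  then show cyc: "cycle_in q (A \<inter> B) (chain_boundary (Suc q) u)"
    using chain_boundary_of_boundary [OF u] by (simp add: singular_cycle)
  have "singular_chain (Suc q) (discrete_topology {()}) (chain_map (Suc q) (\<lambda>_. ()) u)"
    by (rule singular_chain_chain_map [OF u]) auto
  moreover have "chain_boundary (Suc q) (chain_map (Suc q) (\<lambda>_. ()) u) = chain_map q (\<lambda>_. ()) (chain_boundary (Suc q) u)"
    using chain_boundary_chain_map [OF u] by simp
  ultimately have "singular_relboundary q (discrete_topology {()}) {} (chain_map q (\<lambda>_. ()) (chain_boundary (Suc q) u))"
    by (auto simp: singular_boundary)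
  then show "hclass q (A \<inter> B) (chain_boundary (Suc q) u) \<in> carrier (Hred (int q) (A \<inter> B))"
    using hclass_in_Hred_iff [OF cyc] by blast
qed

lemma mayer_vietoris_hom:
  assumes exc: "excisive_couple A B"
  shows "mayer_vietoris (int (Suc q)) A B \<in> hom (Hred (int (Suc q)) (A \<union> B)) (Hred (int q) (A \<inter> B))"
proof (rule homI)
  fix x assume x: "x \<in> carrier (Hred (int (Suc q)) (A \<union> B))"
  obtain u v where uv: "chain_in (Suc q) A u" "chain_in (Suc q) B v"
    "chain_boundary (Suc q) u = - chain_boundary (Suc q) v" "x = hclass (Suc q) (A \<union> B) (u + v)"
    using x by (rule excisive_couple_HredE [OF exc])
  show "mayer_vietoris (int (Suc q)) A B x \<in> carrier (Hred (int q) (A \<inter> B))"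
    unfolding uv(4) mayer_vietoris_hclass [OF exc uv(1-3)] using uv(1-3) by (rule connecting_class(2))
next
  fix x y assume x: "x \<in> carrier (Hred (int (Suc q)) (A \<union> B))" and y: "y \<in> carrier (Hred (int (Suc q)) (A \<union> B))"
  obtain u v where uv: "chain_in (Suc q) A u" "chain_in (Suc q) B v"
    "chain_boundary (Suc q) u = - chain_boundary (Suc q) v" "x = hclass (Suc q) (A \<union> B) (u + v)"
    using x by (rule excisive_couple_HredE [OF exc])
  obtain u' v' where uv': "chain_in (Suc q) A u'" "chain_in (Suc q) B v'"
    "chain_boundary (Suc q) u' = - chain_boundary (Suc q) v'" "y = hclass (Suc q) (A \<union> B) (u' + v')"
    using y by (rule excisive_couple_HredE [OF exc])
  have "x \<otimes>\<^bsub>Hred (int (Suc q)) (A \<union> B)\<^esub> y = hclass (Suc q) (A \<union> B) ((u + u') + (v + v'))"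
    unfolding uv(4) uv'(4) mult_Hred_hclass by (simp add: algebra_simps)
  then have "mayer_vietoris (int (Suc q)) A B (x \<otimes>\<^bsub>Hred (int (Suc q)) (A \<union> B)\<^esub> y)
      = hclass q (A \<inter> B) (chain_boundary (Suc q) (u + u'))"
    using uv uv' by (simp only:) (rule mayer_vietoris_hclass [OF exc], auto simp: chain_boundary_add singular_chain_add)
  then show "mayer_vietoris (int (Suc q)) A B (x \<otimes>\<^bsub>Hred (int (Suc q)) (A \<union> B)\<^esub> y)
      = mayer_vietoris (int (Suc q)) A B x \<otimes>\<^bsub>Hred (int q) (A \<inter> B)\<^esub> mayer_vietoris (int (Suc q)) A B y"
    unfolding uv(4) uv'(4) mayer_vietoris_hclass [OF exc uv(1-3)] mayer_vietoris_hclass [OF exc uv'(1-3)]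
    by (simp only: mult_Hred_hclass chain_boundary_add)
qed

lemma mayer_vietoris_kernel:
  assumes exc: "excisive_couple A B" and x: "x \<in> carrier (Hred (int (Suc q)) (A \<union> B))"
  shows "mayer_vietoris (int (Suc q)) A B x = \<one>\<^bsub>Hred (int q) (A \<inter> B)\<^esub> \<longleftrightarrow>
    (\<exists>a\<in>carrier (Hred (int (Suc q)) A). \<exists>b\<in>carrier (Hred (int (Suc q)) B).
       x = incl_hom (int (Suc q)) A (A \<union> B) a \<otimes>\<^bsub>Hred (int (Suc q)) (A \<union> B)\<^esub> incl_hom (int (Suc q)) B (A \<union> B) b)"
    (is "?lhs \<longleftrightarrow> ?rhs")
proof
  assume L: ?lhs
  obtain u v where uv: "chain_in (Suc q) A u" "chain_in (Suc q) B v"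
    "chain_boundary (Suc q) u = - chain_boundary (Suc q) v" "x = hclass (Suc q) (A \<union> B) (u + v)"
    using x by (rule excisive_couple_HredE [OF exc])
  have "hclass q (A \<inter> B) (chain_boundary (Suc q) u) = hclass q (A \<inter> B) 0"
    using L unfolding uv(4) mayer_vietoris_hclass [OF exc uv(1-3)] one_Hred_hclass .
  then have "boundary_in q (A \<inter> B) (chain_boundary (Suc q) u)"
    unfolding hclass_eq_iff by simp
  then obtain w where w: "chain_in (Suc q) (A \<inter> B) w" "chain_boundary (Suc q) w = chain_boundary (Suc q) u"
    by (auto simp: singular_boundary)
  then have wAB: "chain_in (Suc q) A w" "chain_in (Suc q) B w"
    using singular_chain_top_of_set_mono by blast+
  \<comment> \<open>A chain \<open>w\<close> of the intersection with the same boundary as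
    \<open>u\<close> can be moved from one part to the other: \<open>u - w\<close> and
    \<open>v + w\<close> are cycles with sum \<open>u + v\<close>.\<close>
  have cA: "cycle_in (Suc q) A (u - w)"
    using uv w wAB by (simp add: singular_cycle singular_chain_diff chain_boundary_diff)
  have cB: "cycle_in (Suc q) B (v + w)"
    using uv w wAB by (simp add: singular_cycle singular_chain_add chain_boundary_add)
  have "x = incl_hom (int (Suc q)) A (A \<union> B) (hclass (Suc q) A (u - w)) \<otimes>\<^bsub>Hred (int (Suc q)) (A \<union> B)\<^esub>
      incl_hom (int (Suc q)) B (A \<union> B) (hclass (Suc q) B (v + w))"
    unfolding incl_hom_hclass [OF Un_upper1 cA] incl_hom_hclass [OF Un_upper2 cB] mult_Hred_hclass uv(4)
    by simp
  then show ?rhs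
    using hclass_in_Hred_Suc [OF cA] hclass_in_Hred_Suc [OF cB] by blast
next
  assume ?rhs
  then obtain a b where ab: "a \<in> carrier (Hred (int (Suc q)) A)" "b \<in> carrier (Hred (int (Suc q)) B)"
    "x = incl_hom (int (Suc q)) A (A \<union> B) a \<otimes>\<^bsub>Hred (int (Suc q)) (A \<union> B)\<^esub> incl_hom (int (Suc q)) B (A \<union> B) b"
    by blast
  obtain u where u: "cycle_in (Suc q) A u" "a = hclass (Suc q) A u"
    using Hred_hclassE [OF ab(1)] .
  obtain v where v: "cycle_in (Suc q) B v" "b = hclass (Suc q) B v"
    using Hred_hclassE [OF ab(2)] .
  have x: "x = hclass (Suc q) (A \<union> B) (u + v)"
    unfolding ab(3) u(2) v(2) incl_hom_hclass [OF Un_upper1 u(1)] incl_hom_hclass [OF Un_upper2 v(1)] mult_Hred_hclass ..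
  show ?lhs
    unfolding x one_Hred_hclass
    using u(1) v(1) mayer_vietoris_hclass [OF exc, of q u v] by (simp add: singular_cycle del: of_nat_Suc)
qed

text \<open>If \<open>u + v\<close> is the sum of the boundaries of \<open>s\<close> and
  \<open>t\<close>, then \<open>u\<close> minus the boundary of \<open>s\<close> is a cycle in both
  members. It bounds in the intersection by \<open>triv\<close>, so \<open>u\<close> and
  \<open>v\<close> bound separately.\<close>

lemma excisive_couple_incl_injective:
  assumes exc: "excisive_couple A B" and triv: "trivial_group (Hred (int (Suc q)) (A \<inter> B))"
    and a: "a \<in> carrier (Hred (int (Suc q)) A)" and b: "b \<in> carrier (Hred (int (Suc q)) B)"
    and 1: "incl_hom (int (Suc q)) A (A \<union> B) a \<otimes>\<^bsub>Hred (int (Suc q)) (A \<union> B)\<^esub> incl_hom (int (Suc q)) B (A \<union> B) b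
      = \<one>\<^bsub>Hred (int (Suc q)) (A \<union> B)\<^esub>"
  shows "a = \<one>\<^bsub>Hred (int (Suc q)) A\<^esub> \<and> b = \<one>\<^bsub>Hred (int (Suc q)) B\<^esub>"
proof -
  obtain u where u: "cycle_in (Suc q) A u" "a = hclass (Suc q) A u"
    using Hred_hclassE [OF a] .
  obtain v where v: "cycle_in (Suc q) B v" "b = hclass (Suc q) B v"
    using Hred_hclassE [OF b] .
  have uv: "chain_in (Suc q) A u" "chain_in (Suc q) B v"
    "chain_boundary (Suc q) u = 0" "chain_boundary (Suc q) v = 0"
    using u v by (simp_all add: singular_cycle)
  have "hclass (Suc q) (A \<union> B) (u + v) = hclass (Suc q) (A \<union> B) 0"
    using 1 unfolding u(2) v(2) incl_hom_hclass [OF Un_upper1 u(1)] incl_hom_hclass [OF Un_upper2 v(1)]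
      mult_Hred_hclass one_Hred_hclass .
  then have "boundary_in (Suc q) (A \<union> B) (u + v)"
    unfolding hclass_eq_iff by simp
  then obtain s t where st: "chain_in (Suc (Suc q)) A s" "chain_in (Suc (Suc q)) B t"
    "u + v = chain_boundary (Suc (Suc q)) s + chain_boundary (Suc (Suc q)) t"
    by (rule excisive_couple_boundary [OF exc uv(1,2)])
  define w where "w = u - chain_boundary (Suc (Suc q)) s"
  have w': "w = chain_boundary (Suc (Suc q)) t - v"
    using st(3) by (simp add: w_def algebra_simps)
  have "chain_in (Suc q) A w"
    using uv st by (simp add: w_def singular_chain_diff singular_chain_boundary_alt)
  moreover have "chain_in (Suc q) B w"
    using uv st by (simp add: w' singular_chain_diff singular_chain_boundary_alt)
  ultimately have "chain_in (Suc q) (A \<inter> B) w"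
    by (rule singular_chain_inter)
  moreover have "chain_boundary (Suc q) w = 0"
    using uv chain_boundary_boundary [OF st(1)] by (simp add: w_def chain_boundary_diff)
  ultimately have "cycle_in (Suc q) (A \<inter> B) w"
    by (simp add: singular_cycle)
  then have "boundary_in (Suc q) (A \<inter> B) w"
    using trivial_Hred_boundary [OF triv hclass_in_Hred_Suc] by blast
  then have bd: "boundary_in (Suc q) A w" "boundary_in (Suc q) B w"
    by (auto intro: singular_boundary_mono [rotated])
  have "w + chain_boundary (Suc (Suc q)) s = u" "chain_boundary (Suc (Suc q)) t - w = v"
    by (simp add: w_def) (simp add: w')
  have "boundary_in (Suc q) A (chain_boundary (Suc (Suc q)) s)"
    "boundary_in (Suc q) B (chain_boundary (Suc (Suc q)) t)"
    using st by (auto simp: singular_boundary)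
  then have "boundary_in (Suc q) A (w + chain_boundary (Suc (Suc q)) s)"
    "boundary_in (Suc q) B (chain_boundary (Suc (Suc q)) t - w)"
    using bd by (auto intro: singular_relboundary_add singular_relboundary_diff)
  then have "boundary_in (Suc q) A u" "boundary_in (Suc q) B v"
    by (simp_all only: \<open>w + _ = u\<close> \<open>_ - w = v\<close>)
  then show ?thesis
    unfolding u(2) v(2) one_Hred_hclass hclass_eq_iff by simp
qed

text \<open>A cycle of the intersection bounds in both members, and the two fillings, taken with
  opposite signs, glue to a cycle of the union.\<close>

lemma mayer_vietoris_surj:
  assumes exc: "excisive_couple A B"
    and triv: "trivial_group (Hred (int q) A)" "trivial_group (Hred (int q) B)"
    and y: "y \<in> carrier (Hred (int q) (A \<inter> B))"
  shows "\<exists>x\<in>carrier (Hred (int (Suc q)) (A \<union> B)). mayer_vietoris (int (Suc q)) A B x = y"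
proof -
  obtain c where c: "cycle_in q (A \<inter> B) c" "y = hclass q (A \<inter> B) c"
    using Hred_hclassE [OF y] .
  have "hclass q A c \<in> carrier (Hred (int q) A)" "hclass q B c \<in> carrier (Hred (int q) B)"
    using hom_induced_reduced [OF y, of "top_of_set A" id] hom_induced_reduced [OF y, of "top_of_set B" id]
    by (simp_all add: c(2) incl_hom_hclass [OF _ c(1)])
  then have "boundary_in q A c" "boundary_in q B c"
    using triv by (auto intro: trivial_Hred_boundary)
  then obtain u v where u: "chain_in (Suc q) A u" "chain_boundary (Suc q) u = c"
    and v: "chain_in (Suc q) B v" "chain_boundary (Suc q) v = c"
    by (auto simp: singular_boundary)
  have v': "chain_in (Suc q) B (- v)" "chain_boundary (Suc q) u = - chain_boundary (Suc q) (- v)"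
    using u v by (simp_all add: singular_chain_minus chain_boundary_minus)
  have "cycle_in (Suc q) (A \<union> B) (u + - v)"
    using u v v' singular_chain_top_of_set_mono [OF u(1), of "A \<union> B"] singular_chain_top_of_set_mono [OF v'(1), of "A \<union> B"]
    by (simp add: singular_cycle singular_chain_add chain_boundary_diff singular_chain_diff singular_chain_minus)
  then have "hclass (Suc q) (A \<union> B) (u + - v) \<in> carrier (Hred (int (Suc q)) (A \<union> B))"
    by (rule hclass_in_Hred_Suc)
  moreover have "mayer_vietoris (int (Suc q)) A B (hclass (Suc q) (A \<union> B) (u + - v)) = y"
    unfolding mayer_vietoris_hclass [OF exc u(1) v'] u(2) c(2) ..
  ultimately show ?thesis by blast
qed

text \<open>The vanishing of the members in degree \<open>q\<close> gives surjectivity of the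
  connecting homomorphism; the vanishing of the intersection in degree \<open>q + 1\<close> gives
  injectivity on the left.\<close>

proposition mayer_vietoris_short_exact_sum:
  assumes exc: "excisive_couple A B"
    and triv: "trivial_group (Hred (int q) A)" "trivial_group (Hred (int q) B)"
      "trivial_group (Hred (int (Suc q)) (A \<inter> B))"
  shows "short_exact_sum (Hred (int (Suc q)) (A \<union> B)) (Hred (int (Suc q)) A) (Hred (int (Suc q)) B) (Hred (int q) (A \<inter> B))
    (incl_hom (int (Suc q)) A (A \<union> B)) (incl_hom (int (Suc q)) B (A \<union> B)) (mayer_vietoris (int (Suc q)) A B)"
  unfolding short_exact_sum_def epi_def mem_Collect_eq
proof (intro conjI ballI impI)
  show "mayer_vietoris (int (Suc q)) A B ` carrier (Hred (int (Suc q)) (A \<union> B)) = carrier (Hred (int q) (A \<inter> B))"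
  proof (intro equalityI subsetI)
    fix y assume "y \<in> carrier (Hred (int q) (A \<inter> B))"
    then show "y \<in> mayer_vietoris (int (Suc q)) A B ` carrier (Hred (int (Suc q)) (A \<union> B))"
      using mayer_vietoris_surj [OF exc triv(1,2)] by (metis image_eqI)
  qed (use mayer_vietoris_hom [OF exc, of q] in \<open>auto simp: hom_def\<close>)
  show "mayer_vietoris (int (Suc q)) A B \<in> hom (Hred (int (Suc q)) (A \<union> B)) (Hred (int q) (A \<inter> B))"
    by (rule mayer_vietoris_hom [OF exc])
  show "incl_hom (int (Suc q)) A (A \<union> B) \<in> hom (Hred (int (Suc q)) A) (Hred (int (Suc q)) (A \<union> B))"
    "incl_hom (int (Suc q)) B (A \<union> B) \<in> hom (Hred (int (Suc q)) B) (Hred (int (Suc q)) (A \<union> B))"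
    by (rule hom_induced_reduced_hom)+
qed (rule mayer_vietoris_kernel [OF exc] excisive_couple_incl_injective [OF exc triv(3), THEN conjunct1]
      excisive_couple_incl_injective [OF exc triv(3), THEN conjunct2]; assumption)+

lemma trivial_Hred_Suc_union:
  assumes exc: "excisive_couple A B"
    and triv: "trivial_group (Hred (int (Suc q)) A)" "trivial_group (Hred (int (Suc q)) B)"
      "trivial_group (Hred (int q) (A \<inter> B))"
  shows "trivial_group (Hred (int (Suc q)) (A \<union> B))"
proof -
  let ?X = "Hred (int (Suc q)) (A \<union> B)"
  interpret X: group ?X
    by (rule group_reduced_homology_group)
  have "x = \<one>\<^bsub>?X\<^esub>" if x: "x \<in> carrier ?X" for x
  proof -
    have "mayer_vietoris (int (Suc q)) A B x \<in> carrier (Hred (int q) (A \<inter> B))"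
      using mayer_vietoris_hom [OF exc, of q] x by (auto simp: hom_def)
    then have "mayer_vietoris (int (Suc q)) A B x = \<one>\<^bsub>Hred (int q) (A \<inter> B)\<^esub>"
      using triv(3) by (auto simp: trivial_group_def)
    then obtain a b where ab: "a \<in> carrier (Hred (int (Suc q)) A)" "b \<in> carrier (Hred (int (Suc q)) B)"
      "x = incl_hom (int (Suc q)) A (A \<union> B) a \<otimes>\<^bsub>?X\<^esub> incl_hom (int (Suc q)) B (A \<union> B) b"
      using mayer_vietoris_kernel [OF exc x] by blast
    then have "a = \<one>\<^bsub>Hred (int (Suc q)) A\<^esub>" "b = \<one>\<^bsub>Hred (int (Suc q)) B\<^esub>"
      using triv by (auto simp: trivial_group_def)
    then have "incl_hom (int (Suc q)) A (A \<union> B) a = \<one>\<^bsub>?X\<^esub>" "incl_hom (int (Suc q)) B (A \<union> B) b = \<one>\<^bsub>?X\<^esub>"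
      by (simp_all only: hom_one [OF hom_induced_reduced_hom group_reduced_homology_group group_reduced_homology_group])
    then show ?thesis
      unfolding ab(3) by (simp only: X.l_one X.one_closed)
  qed
  then show ?thesis
    using X.trivial_group_alt by blast
qed

section \<open>Degree zero\<close>

text \<open>Relative to a common point \<open>a\<close> every 0-chain is a cycle, so the two parts
  of a split cycle bound relative to \<open>a\<close> in their own members. This replaces the
  Mayer-Vietoris argument, which starts in degree 1.\<close>

lemma trivial_Hred_0_union:
  assumes exc: "excisive_couple A B" and a: "a \<in> A \<inter> B"
    and triv: "trivial_group (Hred 0 A)" "trivial_group (Hred 0 B)"
  shows "trivial_group (Hred 0 (A \<union> B))"
proof -
  have rel: "singular_relboundary 0 (top_of_set T) {a} c"
    if "a \<in> T" "trivial_group (Hred 0 T)" "chain_in 0 T c" for T c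
  proof -
    have iso: "Hred 0 T \<cong> relative_homology_group 0 (top_of_set T) {a}"
      by (rule isomorphic_reduced_homology_by_singleton) (use that in simp)
    have "trivial_group (relative_homology_group (int 0) (top_of_set T) {a})"
      using that(2) isomorphic_group_triviality [OF iso] by simp
    moreover have "singular_relcycle 0 (top_of_set T) {a} c"
      using that(3) by (simp add: singular_relcycle chain_boundary_def)
    then have "homologous_rel_set 0 (top_of_set T) {a} c \<in> carrier (relative_homology_group (int 0) (top_of_set T) {a})"
      by (auto simp: carrier_relative_homology_group_0)
    ultimately have "homologous_rel_set 0 (top_of_set T) {a} c \<in> {singular_relboundary_set 0 (top_of_set T) {a}}"
      by (simp only: trivial_group_def one_relative_homology_group)
    then have "homologous_rel_set 0 (top_of_set T) {a} c = singular_relboundary_set 0 (top_of_set T) {a}"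
      by (rule singletonD)
    then show ?thesis
      by (simp only: homologous_rel_set_eq_relboundary)
  qed
  have mono: "singular_relboundary 0 (top_of_set (A \<union> B)) {a} c"
    if "singular_relboundary 0 (top_of_set T) {a} c" "T \<subseteq> A \<union> B" for T c
  proof -
    obtain d e where de: "chain_in (Suc 0) T d" "singular_chain 0 (subtopology (top_of_set T) {a}) e"
      "chain_boundary (Suc 0) d + e = c"
      using \<open>singular_relboundary 0 (top_of_set T) {a} c\<close> by (auto simp: singular_relboundary)
    have "singular_chain 0 (subtopology (top_of_set (A \<union> B)) {a}) e"
      using de(2) that(2) unfolding subtopology_subtopology by (elim singular_chain_mono) auto
    then show ?thesis
      using de singular_chain_top_of_set_mono [OF de(1) that(2)] by (auto simp: singular_relboundary)
  qed
  have iso: "Hred 0 (A \<union> B) \<cong> relative_homology_group 0 (top_of_set (A \<union> B)) {a}"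
    by (rule isomorphic_reduced_homology_by_singleton) (use a in simp)
  have "x = \<one>\<^bsub>relative_homology_group (int 0) (top_of_set (A \<union> B)) {a}\<^esub>"
    if x: "x \<in> carrier (relative_homology_group (int 0) (top_of_set (A \<union> B)) {a})" for x
  proof -
    obtain c where c: "chain_in 0 (A \<union> B) c" "x = homologous_rel_set 0 (top_of_set (A \<union> B)) {a} c"
      using x by (auto simp: carrier_relative_homology_group_0 singular_relcycle)
    have "cycle_in 0 (A \<union> B) c"
      using c by (simp add: singular_cycle chain_boundary_def)
    then obtain u v where uv: "chain_in 0 A u" "chain_in 0 B v"
      "homologous_rel 0 (top_of_set (A \<union> B)) {} c (u + v)"
      by (rule excisive_couple_cycle [OF exc])
    have "singular_relboundary 0 (top_of_set (A \<union> B)) {a} (u + v)"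
      using mono [OF rel [OF _ triv(1) uv(1)]] mono [OF rel [OF _ triv(2) uv(2)]] a
      by (auto intro: singular_relboundary_add)
    moreover have "singular_relboundary 0 (top_of_set (A \<union> B)) {a} (c - (u + v))"
    proof -
      obtain d where "chain_in (Suc 0) (A \<union> B) d" "chain_boundary (Suc 0) d = c - (u + v)"
        using uv(3) by (auto simp: homologous_rel_def singular_boundary)
      then show ?thesis
        unfolding singular_relboundary by (intro exI [of _ d] exI [of _ 0]) simp
    qed
    ultimately have "singular_relboundary 0 (top_of_set (A \<union> B)) {a} ((u + v) + (c - (u + v)))"
      by (rule singular_relboundary_add)
    then have "singular_relboundary 0 (top_of_set (A \<union> B)) {a} c"
      by simp
    then show ?thesis
      unfolding c(2) one_relative_homology_group by (simp only: homologous_rel_set_eq_relboundary)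
  qed
  then have "trivial_group (relative_homology_group 0 (top_of_set (A \<union> B)) {a})"
    using group.trivial_group_alt [OF group_relative_homology_group, of 0 "top_of_set (A \<union> B)" "{a}"] by auto
  then show ?thesis
    using isomorphic_group_triviality [OF iso] by simp
qed

section \<open>Disjoint members and the augmentation\<close>

abbreviation point_space :: "unit topology" where
  "point_space \<equiv> discrete_topology {()}"

text \<open>Encodes the augmentation of a 0-chain: the zeroth homology of a point is infinite
  cyclic, and the class records the sum of the coefficients.\<close>

abbreviation aug_class :: "'a chain \<Rightarrow> unit chain set" where
  "aug_class u \<equiv> homologous_rel_set 0 point_space {} (chain_map 0 (\<lambda>_. ()) u)"

abbreviation aug_boundary :: "'a chain \<Rightarrow> bool" where
  "aug_boundary u \<equiv> singular_relboundary 0 point_space {} (chain_map 0 (\<lambda>_. ()) u)"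

lemma singular_cycle_0: "singular_relcycle 0 X {} c \<longleftrightarrow> singular_chain 0 X c"
  by (simp add: singular_cycle chain_boundary_def)

lemma chain_map_point_boundary:
  assumes "singular_chain (Suc 0) X s"
  shows "aug_boundary (chain_boundary (Suc 0) s)"
proof -
  have "singular_chain (Suc 0) point_space (chain_map (Suc 0) (\<lambda>_. ()) s)"
    by (rule singular_chain_chain_map [OF assms]) auto
  moreover have "chain_boundary (Suc 0) (chain_map (Suc 0) (\<lambda>_. ()) s) = chain_map 0 (\<lambda>_. ()) (chain_boundary (Suc 0) s)"
    using chain_boundary_chain_map [OF assms] by simp
  ultimately show ?thesis
    by (auto simp: singular_boundary)
qed

text \<open>With empty intersection the overlap chain \<open>w\<close> of the general argument is
  zero, so \<open>u\<close> and \<open>v\<close> are themselves boundaries in their members, and the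
  augmentation of \<open>u\<close> vanishes.\<close>

lemma disjoint_couple_boundary:
  assumes exc: "excisive_couple A B" and disj: "A \<inter> B = {}"
    and u: "chain_in 0 A u" and v: "chain_in 0 B v"
    and bd: "boundary_in 0 (A \<union> B) (u + v)"
  shows "boundary_in 0 A u" "boundary_in 0 B v"
    "aug_boundary u"
proof -
  obtain s t where st: "chain_in (Suc 0) A s" "chain_in (Suc 0) B t"
    "u + v = chain_boundary (Suc 0) s + chain_boundary (Suc 0) t"
    using bd by (rule excisive_couple_boundary [OF exc u v])
  define w where "w = u - chain_boundary (Suc 0) s"
  have w': "w = chain_boundary (Suc 0) t - v"
    using st(3) by (simp add: w_def algebra_simps)
  have "chain_in 0 A w"
    using u st by (simp add: w_def singular_chain_diff singular_chain_boundary_alt)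
  moreover have "chain_in 0 B w"
    using v st by (simp add: w' singular_chain_diff singular_chain_boundary_alt)
  ultimately have "chain_in 0 (A \<inter> B) w"
    by (rule singular_chain_inter)
  then have "w = 0"
    unfolding disj by (simp add: singular_chain_empty)
  then have "u = chain_boundary (Suc 0) s" "v = chain_boundary (Suc 0) t"
    using w' by (auto simp: w_def)
  then show "boundary_in 0 A u" "boundary_in 0 B v"
    "aug_boundary u"
    using st chain_map_point_boundary by (auto simp: singular_boundary)
qed

lemma one_Hred_0: "\<one>\<^bsub>Hred 0 A\<^esub> = hclass 0 A 0"
  using one_Hred_hclass [of 0 A] by simp

lemma mult_Hred_0: "hclass 0 A c \<otimes>\<^bsub>Hred 0 A\<^esub> hclass 0 A d = hclass 0 A (c + d)"
  using mult_Hred_hclass [of 0 A c d] by simp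

lemma mult_aug_class: "aug_class u \<otimes>\<^bsub>homology_group 0 point_space\<^esub> aug_class v = aug_class (u + v)"
proof -
  have "(\<Union>r\<in>aug_class u. \<Union>s\<in>aug_class v. {r + s}) = aug_class (u + v)"
  proof (intro equalityI subsetI)
    fix x assume "x \<in> aug_class (u + v)"
    then have "x - chain_map 0 (\<lambda>_. ()) u \<in> aug_class v"
      by (simp add: homologous_rel_def chain_map_add algebra_simps)
    then show "x \<in> (\<Union>r\<in>aug_class u. \<Union>s\<in>aug_class v. {r + s})"
      by (intro UN_I [of "chain_map 0 (\<lambda>_. ()) u"] UN_I [of "x - chain_map 0 (\<lambda>_. ()) u"]) auto
  qed (auto intro: homologous_rel_add simp: chain_map_add)
  then show ?thesis
    using mult_relative_homology_group [of 0 point_space "{}"] by simp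
qed

text \<open>A reduced 0-class of the union splits into parts of opposite augmentation, and the
  augmentation of the part in \<open>A\<close> measures how far these parts are from being reduced
  classes. It plays the role of a connecting map into degree -1.\<close>

proposition disjoint_short_exact_sum:
  fixes A B :: "'a::topological_space set"
  assumes exc: "excisive_couple A B" and disj: "A \<inter> B = {}" and ne: "A \<noteq> {}" "B \<noteq> {}"
  shows "\<exists>\<delta>. short_exact_sum (Hred 0 (A \<union> B)) (Hred 0 A) (Hred 0 B) (homology_group 0 point_space)
    (incl_hom 0 A (A \<union> B)) (incl_hom 0 B (A \<union> B)) \<delta>"
proof -
  let ?X = "Hred 0 (A \<union> B)"
  \<comment> \<open>\<open>SOME\<close> picks a splitting; the next fact shows that the value does
    not depend on it.\<close>
  define \<delta> where "\<delta> x = (SOME y. \<exists>u v. chain_in 0 A u \<and> chain_in 0 B v \<and>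
    x = hclass 0 (A \<union> B) (u + v) \<and> y = aug_class u)" for x
  have \<delta>: "\<delta> (hclass 0 (A \<union> B) (u + v)) = aug_class u"
    if uv: "chain_in 0 A u" "chain_in 0 B v" for u v
  proof -
    have "\<exists>u' v'. chain_in 0 A u' \<and> chain_in 0 B v' \<and>
      hclass 0 (A \<union> B) (u + v) = hclass 0 (A \<union> B) (u' + v') \<and> \<delta> (hclass 0 (A \<union> B) (u + v)) = aug_class u'"
      unfolding \<delta>_def by (rule someI_ex) (use uv in blast)
    then obtain u' v' where u': "chain_in 0 A u'" "chain_in 0 B v'"
      "hclass 0 (A \<union> B) (u + v) = hclass 0 (A \<union> B) (u' + v')" "\<delta> (hclass 0 (A \<union> B) (u + v)) = aug_class u'"
      by blast
    have "(u + v) - (u' + v') = (u - u') + (v - v')"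
      by (simp add: algebra_simps)
    then have "boundary_in 0 (A \<union> B) ((u - u') + (v - v'))"
      using u'(3) unfolding hclass_eq_iff by (simp only:)
    then have "aug_boundary (u - u')"
      using disjoint_couple_boundary(3) [OF exc disj singular_chain_diff [OF uv(1) u'(1)] singular_chain_diff [OF uv(2) u'(2)]]
      by blast
    then have "aug_class u = aug_class u'"
      unfolding homologous_rel_set_eq by (simp add: homologous_rel_def chain_map_diff)
    then show ?thesis
      using u'(4) by simp
  qed
  have splitX: thesis if "x \<in> carrier ?X"
    and "\<And>u v. chain_in 0 A u \<Longrightarrow> chain_in 0 B v \<Longrightarrow>
      x = hclass 0 (A \<union> B) (u + v) \<Longrightarrow> aug_boundary (u + v) \<Longrightarrow> thesis"
    for x thesis
  proof -
    have "x \<in> carrier (Hred (int 0) (A \<union> B))"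
      using that(1) by simp
    then obtain u v where uv: "chain_in 0 A u" "chain_in 0 B v"
      "x = hclass 0 (A \<union> B) (u + v)"
      by (rule excisive_couple_HredE [OF exc])
    have "cycle_in 0 (A \<union> B) (u + v)"
      unfolding singular_cycle_0 using uv singular_chain_top_of_set_mono [of 0 A u "A \<union> B"] singular_chain_top_of_set_mono [of 0 B v "A \<union> B"]
      by (simp add: singular_chain_add)
    then have "aug_boundary (u + v)"
      using hclass_in_Hred_iff \<open>x \<in> carrier (Hred (int 0) (A \<union> B))\<close> uv(3) by blast
    then show thesis
      using that(2) uv by blast
  qed
  have aug_carrier: "aug_class u \<in> carrier (homology_group 0 point_space)"
    if "chain_in 0 T u" for u and T :: "'a set"
  proof -
    have "singular_chain 0 point_space (chain_map 0 (\<lambda>_. ()) u)"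
      by (rule singular_chain_chain_map [OF that]) auto
    then show ?thesis
      by (simp add: carrier_relative_homology_group_0 singular_cycle_0)
  qed
  have aug_one: "aug_class u = \<one>\<^bsub>homology_group 0 point_space\<^esub> \<longleftrightarrow> aug_boundary u"
    for u :: "'a chain"
    using one_relative_homology_group [of 0 point_space "{}"] homologous_rel_set_eq_relboundary [of 0 point_space "{}"]
    by simp
  have incl: "incl_hom 0 T (A \<union> B) (hclass 0 T c) = hclass 0 (A \<union> B) c"
    if "T \<subseteq> A \<union> B" "chain_in 0 T c" for T c
    using incl_hom_hclass [of T "A \<union> B" 0 c] that by (simp add: singular_cycle_0)
  have red: "hclass 0 T c \<in> carrier (Hred 0 T) \<longleftrightarrow> aug_boundary c"
    if "chain_in 0 T c" for c and T :: "'a set"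
    using hclass_in_Hred_iff [of 0 T c] that by (simp add: singular_cycle_0)
  have repr: thesis if "x \<in> carrier (Hred 0 T)"
    "\<And>c. chain_in 0 T c \<Longrightarrow> x = hclass 0 T c \<Longrightarrow>
       aug_boundary c \<Longrightarrow> thesis"
    for x thesis and T :: "'a set"
  proof -
    have "x \<in> carrier (Hred (int 0) T)"
      using that(1) by simp
    then obtain c where "cycle_in 0 T c" "x = hclass 0 T c"
      by (rule Hred_hclassE)
    then show thesis
      using that red singular_cycle_0 by blast
  qed
  have \<delta>hom: "\<delta> \<in> hom ?X (homology_group 0 point_space)"
  proof (rule homI)
    fix x assume "x \<in> carrier ?X"
    then show "\<delta> x \<in> carrier (homology_group 0 point_space)"
      by (rule splitX) (simp add: \<delta> aug_carrier)
  next
    fix x y assume x: "x \<in> carrier ?X" and y: "y \<in> carrier ?X"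
    obtain u v where uv: "chain_in 0 A u" "chain_in 0 B v" "x = hclass 0 (A \<union> B) (u + v)"
      using x by (rule splitX)
    obtain u' v' where uv': "chain_in 0 A u'" "chain_in 0 B v'" "y = hclass 0 (A \<union> B) (u' + v')"
      using y by (rule splitX)
    have "x \<otimes>\<^bsub>?X\<^esub> y = hclass 0 (A \<union> B) ((u + u') + (v + v'))"
      unfolding uv(3) uv'(3) mult_Hred_0 by (simp add: algebra_simps)
    then have "\<delta> (x \<otimes>\<^bsub>?X\<^esub> y) = aug_class (u + u')"
      using \<delta> uv uv' by (simp add: singular_chain_add)
    then show "\<delta> (x \<otimes>\<^bsub>?X\<^esub> y) = \<delta> x \<otimes>\<^bsub>homology_group 0 point_space\<^esub> \<delta> y"
      unfolding uv(3) uv'(3) \<delta> [OF uv(1,2)] \<delta> [OF uv'(1,2)] mult_aug_class .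
  qed
  have "short_exact_sum ?X (Hred 0 A) (Hred 0 B) (homology_group 0 point_space)
    (incl_hom 0 A (A \<union> B)) (incl_hom 0 B (A \<union> B)) \<delta>"
    unfolding short_exact_sum_def epi_def mem_Collect_eq
  proof (intro conjI ballI impI)
    show "incl_hom 0 A (A \<union> B) \<in> hom (Hred 0 A) ?X" "incl_hom 0 B (A \<union> B) \<in> hom (Hred 0 B) ?X"
      by (rule hom_induced_reduced_hom)+
    show "\<delta> \<in> hom ?X (homology_group 0 point_space)"
      by (rule \<delta>hom)
    show "\<delta> ` carrier ?X = carrier (homology_group 0 point_space)"
    proof (intro equalityI subsetI)
      fix y assume "y \<in> carrier (homology_group 0 point_space)"
      then obtain z where z: "singular_chain 0 point_space z" "y = homologous_rel_set 0 point_space {} z"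
        by (auto simp: carrier_relative_homology_group_0 singular_cycle_0)
      then obtain m where m: "z = frag_cmul m (frag_of (restrict (\<lambda>x. ()) (standard_simplex 0)))"
        using singular_chain_singleton [of point_space "()" 0 z] by auto
      obtain a b where ab: "a \<in> A" "b \<in> B"
        using ne by blast
      \<comment> \<open>Weight \<open>m\<close> at \<open>a\<close> and \<open>-m\<close> at
        \<open>b\<close> give total augmentation zero, and the part in \<open>A\<close> has the
        prescribed one.\<close>
      define u where "u = frag_cmul m (frag_of (restrict (\<lambda>x. a) (standard_simplex 0)))"
      define v where "v = frag_cmul (- m) (frag_of (restrict (\<lambda>x. b) (standard_simplex 0)))"
      have uv: "chain_in 0 A u" "chain_in 0 B v"
        unfolding u_def v_def using ab by (intro singular_chain_cmul; simp add: singular_chain_of singular_simplex_def)+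
      have simp: "simplex_map 0 (\<lambda>_. ()) f = restrict (\<lambda>x. ()) (standard_simplex 0)" for f :: "(nat \<Rightarrow> real) \<Rightarrow> 'a"
        by (simp add: simplex_map_def o_def)
      have au: "chain_map 0 (\<lambda>_. ()) u = z" "chain_map 0 (\<lambda>_. ()) v = - z"
        by (simp_all add: u_def v_def m simp)
      have "hclass 0 (A \<union> B) (u + v) \<in> carrier ?X"
        using uv singular_chain_top_of_set_mono [of 0 A u "A \<union> B"] singular_chain_top_of_set_mono [of 0 B v "A \<union> B"]
        by (subst red) (simp_all add: singular_chain_add chain_map_add au)
      moreover have "\<delta> (hclass 0 (A \<union> B) (u + v)) = y"
        using \<delta> [OF uv] z au by simp
      ultimately show "y \<in> \<delta> ` carrier ?X"
        by (metis image_eqI)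
    qed (use \<delta>hom in \<open>auto simp: hom_def\<close>)
  next
    fix x assume x: "x \<in> carrier ?X"
    obtain u v where uv: "chain_in 0 A u" "chain_in 0 B v" "x = hclass 0 (A \<union> B) (u + v)"
      and aug: "aug_boundary (u + v)"
      using x by (rule splitX)
    show "\<delta> x = \<one>\<^bsub>homology_group 0 point_space\<^esub> \<longleftrightarrow> (\<exists>a\<in>carrier (Hred 0 A). \<exists>b\<in>carrier (Hred 0 B).
      x = incl_hom 0 A (A \<union> B) a \<otimes>\<^bsub>?X\<^esub> incl_hom 0 B (A \<union> B) b)" (is "?L \<longleftrightarrow> ?R")
    proof
      assume ?L
      then have u: "aug_boundary u"
        using \<delta> [OF uv(1,2)] uv(3) aug_one by simp
      then have "aug_boundary v"
        using singular_relboundary_diff [OF aug u] by (simp add: chain_map_add)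
      then have "hclass 0 A u \<in> carrier (Hred 0 A)" "hclass 0 B v \<in> carrier (Hred 0 B)"
        using u uv red by blast+
      moreover have "x = incl_hom 0 A (A \<union> B) (hclass 0 A u) \<otimes>\<^bsub>?X\<^esub> incl_hom 0 B (A \<union> B) (hclass 0 B v)"
        unfolding incl [OF Un_upper1 uv(1)] incl [OF Un_upper2 uv(2)] mult_Hred_0 uv(3) ..
      ultimately show ?R by blast
    next
      assume ?R
      then obtain a b where ab: "a \<in> carrier (Hred 0 A)" "b \<in> carrier (Hred 0 B)"
        "x = incl_hom 0 A (A \<union> B) a \<otimes>\<^bsub>?X\<^esub> incl_hom 0 B (A \<union> B) b"
        by blast
      obtain u where u: "chain_in 0 A u" "a = hclass 0 A u"
        "aug_boundary u"
        using ab(1) by (rule repr)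
      obtain v where v: "chain_in 0 B v" "b = hclass 0 B v"
        using ab(2) by (rule repr)
      have "x = hclass 0 (A \<union> B) (u + v)"
        unfolding ab(3) u(2) v(2) incl [OF Un_upper1 u(1)] incl [OF Un_upper2 v(1)] mult_Hred_0 ..
      then show ?L
        using \<delta> [OF u(1) v(1)] u(3) aug_one by simp
    qed
  next
    fix a b assume a: "a \<in> carrier (Hred 0 A)" and b: "b \<in> carrier (Hred 0 B)"
      and 1: "incl_hom 0 A (A \<union> B) a \<otimes>\<^bsub>?X\<^esub> incl_hom 0 B (A \<union> B) b = \<one>\<^bsub>?X\<^esub>"
    obtain u where u: "chain_in 0 A u" "a = hclass 0 A u"
      using a by (rule repr)
    obtain v where v: "chain_in 0 B v" "b = hclass 0 B v"
      using b by (rule repr)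
    have "hclass 0 (A \<union> B) (u + v) = hclass 0 (A \<union> B) 0"
      using 1 unfolding u(2) v(2) incl [OF Un_upper1 u(1)] incl [OF Un_upper2 v(1)] mult_Hred_0 one_Hred_0 .
    then have "boundary_in 0 (A \<union> B) (u + v)"
      unfolding hclass_eq_iff by simp
    then have "boundary_in 0 A u" "boundary_in 0 B v"
      using disjoint_couple_boundary [OF exc disj u(1) v(1)] by blast+
    then show "a = \<one>\<^bsub>Hred 0 A\<^esub>" "b = \<one>\<^bsub>Hred 0 B\<^esub>"
      unfolding u(2) v(2) one_Hred_0 hclass_eq_iff by simp_all
  qed
  then show ?thesis by blast
qed

section \<open>Split extensions with free quotient\<close>

lemma sum_group_cong:
  assumes "I = J" "\<And>i. i \<in> J \<Longrightarrow> G i = H i"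
  shows "sum_group I G = sum_group J H"
proof -
  have p: "product_group J G = product_group J H"
    using assms(2) by (simp add: product_group_def cong: PiE_cong restrict_cong)
  have c: "{x \<in> \<Pi>\<^sub>E i\<in>J. carrier (G i). finite {i \<in> J. x i \<noteq> \<one>\<^bsub>G i\<^esub>}}
      = {x \<in> \<Pi>\<^sub>E i\<in>J. carrier (H i). finite {i \<in> J. x i \<noteq> \<one>\<^bsub>H i\<^esub>}}"
    using assms(2) by (simp cong: PiE_cong conj_cong)
  show ?thesis
    unfolding sum_group_def assms(1) p c ..
qed

lemma carrier_sum_group_finite:
  assumes "finite I" "\<And>i. i \<in> I \<Longrightarrow> group (G i)"
  shows "carrier (sum_group I G) = (\<Pi>\<^sub>E i\<in>I. carrier (G i))"
  using assms by (auto simp: carrier_sum_group)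

lemma trivial_sum_group_empty: "trivial_group (sum_group {} G)"
proof -
  have "carrier (sum_group {} G) = (\<Pi>\<^sub>E i\<in>{}. carrier (G i))"
    by (rule carrier_sum_group_finite) auto
  moreover have "Group.group (sum_group {} G)"
    by (rule sum_group) simp
  ultimately show ?thesis
    by (simp add: trivial_group_def restrict_def)
qed

lemma group_int_power: "group (int_power m)"
  by (simp add: int_power_def)

lemma carrier_int_power: "carrier (int_power m) = ({..<m} \<rightarrow>\<^sub>E UNIV)"
  by (simp add: int_power_def carrier_sum_group_finite)

lemma mult_int_power: "x \<otimes>\<^bsub>int_power m\<^esub> y = (\<lambda>i\<in>{..<m}. x i + y i)"
  by (simp add: int_power_def integer_group_def)

lemma one_int_power: "\<one>\<^bsub>int_power m\<^esub> = (\<lambda>i\<in>{..<m}. 0)"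
  by (simp add: int_power_def integer_group_def)

lemma iso_eq_one_iff:
  assumes "f \<in> iso G H" "group G" "group H" "x \<in> carrier G"
  shows "f x = \<one>\<^bsub>H\<^esub> \<longleftrightarrow> x = \<one>\<^bsub>G\<^esub>"
proof -
  have "f \<in> hom G H" "inj_on f (carrier G)"
    using assms(1) by (auto simp: iso_def bij_betw_def)
  moreover have "f \<one>\<^bsub>G\<^esub> = \<one>\<^bsub>H\<^esub>" "\<one>\<^bsub>G\<^esub> \<in> carrier G"
    using calculation assms by (auto intro: hom_one monoid.one_closed group.is_monoid)
  ultimately show ?thesis
    using assms(4) by (metis inj_onD)
qed

lemma carrier_int_power_0: "carrier (int_power 0) = {\<one>\<^bsub>int_power 0\<^esub>}"
  by (auto simp: carrier_int_power one_int_power restrict_def)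

lemma trivial_groups_isoI:
  assumes "group G" "trivial_group G" "trivial_group H" "f \<in> hom G H"
  shows "f \<in> iso G H"
proof -
  have "f \<one>\<^bsub>G\<^esub> = \<one>\<^bsub>H\<^esub>"
    using assms hom_in_carrier [OF assms(4)] by (auto simp: trivial_group_def)
  then show ?thesis
    using assms by (simp add: iso_def bij_betw_def trivial_group_def)
qed

lemma trivial_group_isomorphic_int_power_0:
  assumes "group G" "trivial_group G"
  shows "G \<cong> int_power 0"
proof (rule is_isoI)
  show "(\<lambda>x. \<one>\<^bsub>int_power 0\<^esub>) \<in> iso G (int_power 0)"
    using assms group_int_power
    by (intro trivial_groups_isoI trivial_hom) (auto simp: trivial_group_def carrier_int_power one_int_power)
qed

lemma integer_group_isomorphic_int_power_1: "integer_group \<cong> int_power 1"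
proof (rule is_isoI)
  show "(\<lambda>z. \<lambda>i\<in>{..<1}. z) \<in> iso integer_group (int_power 1)"
  proof (rule isoI)
    show "(\<lambda>z. \<lambda>i\<in>{..<1}. z) \<in> hom integer_group (int_power 1)"
      by (rule homI) (auto simp: carrier_int_power mult_int_power integer_group_def)
    show "bij_betw (\<lambda>z. \<lambda>i\<in>{..<1}. z) (carrier integer_group) (carrier (int_power 1))"
      by (rule bij_betw_byWitness [where f' = "\<lambda>x. x 0"])
        (auto simp: carrier_int_power integer_group_def PiE_iff extensional_def fun_eq_iff split: if_splits)
  qed
qed

section \<open>Splitting an extension with free quotient\<close>

text \<open>Chosen preimages of a basis of \<open>C\<close> extend to a homomorphism, because the
  quotient is free abelian and \<open>X\<close> is commutative.\<close>

lemma hom_section_int_power: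
  assumes X: "comm_group X" and C: "group C" and \<delta>: "\<delta> \<in> epi X C" and free: "C \<cong> int_power r"
  obtains s where "s \<in> hom C X" "\<And>c. c \<in> carrier C \<Longrightarrow> \<delta> (s c) = c"
proof -
  interpret X: comm_group X by (rule X)
  interpret C: group C by (rule C)
  let ?F = "free_Abelian_group {..<r}"
  interpret F: group ?F by simp
  have "C \<cong> ?F"
    using free isomorphic_sum_integer_group [of "{..<r}"] unfolding int_power_def by (rule iso_trans)
  then obtain \<theta> where \<theta>: "\<theta> \<in> iso C ?F"
    by (auto simp: is_iso_def)
  define \<psi> where "\<psi> = inv_into (carrier C) \<theta>"
  have \<psi>: "\<psi> \<in> iso ?F C"
    unfolding \<psi>_def using C.iso_set_sym [OF \<theta>] .
  have \<psi>hom: "\<psi> \<in> hom ?F C" and \<theta>hom: "\<theta> \<in> hom C ?F" and \<delta>hom: "\<delta> \<in> hom X C"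
    using \<psi> \<theta> \<delta> by (auto simp: iso_def epi_def)
  have \<psi>\<theta>: "\<psi> (\<theta> c) = c" if "c \<in> carrier C" for c
    unfolding \<psi>_def using \<theta> that by (auto simp: iso_def bij_betw_def)
  have "\<exists>x. x \<in> carrier X \<and> \<delta> x = \<psi> (frag_of i)" if "i < r" for i
  proof -
    have "\<psi> (frag_of i) \<in> \<delta> ` carrier X"
      using \<delta> hom_in_carrier [OF \<psi>hom, of "frag_of i"] that by (auto simp: epi_def)
    then show ?thesis by auto
  qed
  then obtain x where x: "\<And>i. i < r \<Longrightarrow> x i \<in> carrier X" "\<And>i. i < r \<Longrightarrow> \<delta> (x i) = \<psi> (frag_of i)"
    by metis
  obtain h where h: "h \<in> hom ?F X" "\<And>i. i \<in> {..<r} \<Longrightarrow> h (frag_of i) = x i"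
    using X.free_Abelian_group_universal [of x "{..<r}"] x(1) by auto
  have \<delta>h: "\<delta> \<circ> h \<in> hom ?F C"
    using h(1) \<delta>hom by (rule hom_compose)
  \<comment> \<open>Agreement on the generators spreads to all formal sums; membership in the
    carrier is proved along with it, since the homomorphism laws hold only there.\<close>
  have eq: "z \<in> carrier ?F \<and> \<delta> (h z) = \<psi> z" if "Poly_Mapping.keys z \<subseteq> {..<r}" for z
    using that
  proof (induction z rule: frag_induction)
    case zero
    show ?case
      using hom_one [OF \<delta>h F.is_group C.is_group] hom_one [OF \<psi>hom F.is_group C.is_group] by simp
  next
    case (one i)
    then show ?case
      using h(2) x(2) by simp
  next
    case (diff a b)
    have ab: "a \<in> carrier ?F" "b \<in> carrier ?F" "a - b = a \<otimes>\<^bsub>?F\<^esub> inv\<^bsub>?F\<^esub> b"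
      using diff by auto
    interpret p: group_hom ?F C \<psi>
      by (simp add: group_hom_def group_hom_axioms_def \<psi>hom)
    interpret d: group_hom ?F C "\<delta> \<circ> h"
      by (simp only: group_hom_def group_hom_axioms_def \<delta>h F.is_group C.is_group)
    have "(\<delta> \<circ> h) a = \<psi> a" "(\<delta> \<circ> h) b = \<psi> b"
      using diff by simp_all
    then have "(\<delta> \<circ> h) (a - b) = \<psi> (a - b)"
      unfolding ab(3) using ab(1,2) by (simp only: d.hom_mult p.hom_mult d.hom_inv p.hom_inv F.inv_closed)
    moreover have "a - b \<in> carrier ?F"
      unfolding ab(3) using ab(1,2) by (intro F.m_closed F.inv_closed)
    ultimately show ?case by simp
  qed
  show thesis
  proof
    show "h \<circ> \<theta> \<in> hom C X"
      using \<theta>hom h(1) by (rule hom_compose)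
    show "\<delta> ((h \<circ> \<theta>) c) = c" if "c \<in> carrier C" for c
      using eq [of "\<theta> c"] hom_in_carrier [OF \<theta>hom that] \<psi>\<theta> [OF that] by simp
  qed
qed

locale short_exact_sum_groups =
  X: comm_group X + A: group A + B: group B + C: group C
  for X :: "('x, 'xm) monoid_scheme" and A :: "('a, 'am) monoid_scheme"
    and B :: "('b, 'bm) monoid_scheme" and C :: "('c, 'cm) monoid_scheme" +
  fixes k l \<delta>
  assumes ses: "short_exact_sum X A B C k l \<delta>"
begin

sublocale k: group_hom A X k
  using ses by unfold_locales (simp add: short_exact_sum_def)

sublocale l: group_hom B X l
  using ses by unfold_locales (simp add: short_exact_sum_def)

sublocale \<delta>: group_hom X C \<delta>
  using ses by unfold_locales (simp add: short_exact_sum_def epi_def)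

lemma epi: "\<delta> \<in> epi X C"
  using ses by (simp add: short_exact_sum_def)

lemma kernelD:
  assumes "x \<in> carrier X" "\<delta> x = \<one>\<^bsub>C\<^esub>"
  obtains a b where "a \<in> carrier A" "b \<in> carrier B" "x = k a \<otimes>\<^bsub>X\<^esub> l b"
  using assms ses unfolding short_exact_sum_def by blast

lemma \<delta>_incl: "a \<in> carrier A \<Longrightarrow> b \<in> carrier B \<Longrightarrow> \<delta> (k a \<otimes>\<^bsub>X\<^esub> l b) = \<one>\<^bsub>C\<^esub>"
  using ses unfolding short_exact_sum_def by (metis X.m_closed k.hom_closed l.hom_closed)

lemma incl_injective:
  assumes "a \<in> carrier A" "a' \<in> carrier A" "b \<in> carrier B" "b' \<in> carrier B"
    and "k a \<otimes>\<^bsub>X\<^esub> l b = k a' \<otimes>\<^bsub>X\<^esub> l b'"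
  shows "a = a'" "b = b'"
proof -
  have "k (a \<otimes>\<^bsub>A\<^esub> inv\<^bsub>A\<^esub> a') \<otimes>\<^bsub>X\<^esub> l (b \<otimes>\<^bsub>B\<^esub> inv\<^bsub>B\<^esub> b')
      = (k a \<otimes>\<^bsub>X\<^esub> l b) \<otimes>\<^bsub>X\<^esub> inv\<^bsub>X\<^esub> (k a' \<otimes>\<^bsub>X\<^esub> l b')"
    using assms(1-4) by (simp add: X.inv_mult X.m_ac)
  also have "\<dots> = \<one>\<^bsub>X\<^esub>"
    unfolding assms(5) using assms(2,4) by simp
  finally have "a \<otimes>\<^bsub>A\<^esub> inv\<^bsub>A\<^esub> a' = \<one>\<^bsub>A\<^esub> \<and> b \<otimes>\<^bsub>B\<^esub> inv\<^bsub>B\<^esub> b' = \<one>\<^bsub>B\<^esub>"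
    using ses assms(1-4) unfolding short_exact_sum_def by blast
  then show "a = a'" "b = b'"
    using assms(1-4) A.inv_unique' B.inv_unique' by (metis A.inv_closed A.inv_inv A.inv_equality B.inv_closed B.inv_inv B.inv_equality)+
qed

definition splitting where
  "splitting f\<^sub>1 f\<^sub>2 \<longleftrightarrow> f\<^sub>1 \<in> hom X A \<and> f\<^sub>2 \<in> hom X B \<and>
     (\<forall>a\<in>carrier A. f\<^sub>1 (k a) = a \<and> f\<^sub>2 (k a) = \<one>\<^bsub>B\<^esub>) \<and>
     (\<forall>b\<in>carrier B. f\<^sub>1 (l b) = \<one>\<^bsub>A\<^esub> \<and> f\<^sub>2 (l b) = b)"

text \<open>A section \<open>s\<close> of \<open>\<delta>\<close> writes each \<open>x\<close>
  uniquely as the product of \<open>k a\<close>, \<open>l b\<close> and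
  \<open>s (\<delta> x)\<close>. The factors \<open>a\<close> and \<open>b\<close> are the values of
  the two homomorphisms, and uniqueness yields all required equations.\<close>

lemma splitting_exists:
  assumes "C \<cong> int_power r"
  shows "\<exists>f\<^sub>1 f\<^sub>2. splitting f\<^sub>1 f\<^sub>2"
proof -
  obtain s where s: "s \<in> hom C X" "\<And>c. c \<in> carrier C \<Longrightarrow> \<delta> (s c) = c"
    using hom_section_int_power [OF X.comm_group_axioms C.is_group epi assms] by metis
  interpret s: group_hom C X s
    by unfold_locales (rule s(1))
  have "\<exists>a b. a \<in> carrier A \<and> b \<in> carrier B \<and> x = k a \<otimes>\<^bsub>X\<^esub> l b \<otimes>\<^bsub>X\<^esub> s (\<delta> x)" if x: "x \<in> carrier X" for x
  proof -
    have "\<delta> (x \<otimes>\<^bsub>X\<^esub> inv\<^bsub>X\<^esub> s (\<delta> x)) = \<one>\<^bsub>C\<^esub>"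
      using x s(2) by simp
    then obtain a b where ab: "a \<in> carrier A" "b \<in> carrier B" "x \<otimes>\<^bsub>X\<^esub> inv\<^bsub>X\<^esub> s (\<delta> x) = k a \<otimes>\<^bsub>X\<^esub> l b"
      using x by (elim kernelD [rotated]) auto
    have "x = x \<otimes>\<^bsub>X\<^esub> inv\<^bsub>X\<^esub> s (\<delta> x) \<otimes>\<^bsub>X\<^esub> s (\<delta> x)"
      using x by (simp add: X.m_assoc)
    then show ?thesis
      using ab by auto
  qed
  then obtain f1 f2 where f: "\<And>x. x \<in> carrier X \<Longrightarrow> f1 x \<in> carrier A" "\<And>x. x \<in> carrier X \<Longrightarrow> f2 x \<in> carrier B"
    "\<And>x. x \<in> carrier X \<Longrightarrow> x = k (f1 x) \<otimes>\<^bsub>X\<^esub> l (f2 x) \<otimes>\<^bsub>X\<^esub> s (\<delta> x)"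
    by metis
  have uniq: "f1 x = a \<and> f2 x = b" if x: "x = k a \<otimes>\<^bsub>X\<^esub> l b \<otimes>\<^bsub>X\<^esub> s c" and "a \<in> carrier A" "b \<in> carrier B" "c \<in> carrier C" for x a b c
  proof -
    have xX: "x \<in> carrier X"
      using that by simp
    have "\<delta> x = \<delta> (k a \<otimes>\<^bsub>X\<^esub> l b) \<otimes>\<^bsub>C\<^esub> \<delta> (s c)"
      unfolding x using that(2-4) by (intro \<delta>.hom_mult) auto
    then have \<delta>x: "\<delta> x = c"
      unfolding \<delta>_incl [OF that(2,3)] s(2) [OF that(4)] using that(4) by simp
    have "k (f1 x) \<otimes>\<^bsub>X\<^esub> l (f2 x) \<otimes>\<^bsub>X\<^esub> s (\<delta> x) = k a \<otimes>\<^bsub>X\<^esub> l b \<otimes>\<^bsub>X\<^esub> s c"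
      by (rule trans [OF sym [OF f(3) [OF xX]] x])
    then have "k (f1 x) \<otimes>\<^bsub>X\<^esub> l (f2 x) \<otimes>\<^bsub>X\<^esub> s c = k a \<otimes>\<^bsub>X\<^esub> l b \<otimes>\<^bsub>X\<^esub> s c"
      by (simp only: \<delta>x)
    then have "k (f1 x) \<otimes>\<^bsub>X\<^esub> l (f2 x) = k a \<otimes>\<^bsub>X\<^esub> l b"
      using f(1,2) [OF xX] that(2-4) by simp
    then show ?thesis
      using incl_injective [OF f(1) [OF xX] that(2) f(2) [OF xX] that(3)] by simp
  qed
  have "splitting f1 f2"
    unfolding splitting_def
  proof (intro conjI ballI homI)
    fix x y assume xy: "x \<in> carrier X" "y \<in> carrier X"
    have "x \<otimes>\<^bsub>X\<^esub> y = (k (f1 x) \<otimes>\<^bsub>X\<^esub> l (f2 x) \<otimes>\<^bsub>X\<^esub> s (\<delta> x)) \<otimes>\<^bsub>X\<^esub> (k (f1 y) \<otimes>\<^bsub>X\<^esub> l (f2 y) \<otimes>\<^bsub>X\<^esub> s (\<delta> y))"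
      by (rule arg_cong2 [of _ _ _ _ "(\<otimes>\<^bsub>X\<^esub>)", OF f(3) [OF xy(1)] f(3) [OF xy(2)]])
    also have "\<dots> = k (f1 x \<otimes>\<^bsub>A\<^esub> f1 y) \<otimes>\<^bsub>X\<^esub> l (f2 x \<otimes>\<^bsub>B\<^esub> f2 y) \<otimes>\<^bsub>X\<^esub> s (\<delta> x \<otimes>\<^bsub>C\<^esub> \<delta> y)"
      using xy f(1,2) by (simp add: X.m_ac)
    finally show "f1 (x \<otimes>\<^bsub>X\<^esub> y) = f1 x \<otimes>\<^bsub>A\<^esub> f1 y" "f2 (x \<otimes>\<^bsub>X\<^esub> y) = f2 x \<otimes>\<^bsub>B\<^esub> f2 y"
      using uniq xy f(1,2) by (metis A.m_closed B.m_closed C.m_closed \<delta>.hom_closed)+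
  next
    fix a assume a: "a \<in> carrier A"
    have "k a = k a \<otimes>\<^bsub>X\<^esub> l \<one>\<^bsub>B\<^esub> \<otimes>\<^bsub>X\<^esub> s \<one>\<^bsub>C\<^esub>"
      using a by simp
    then show "f1 (k a) = a" "f2 (k a) = \<one>\<^bsub>B\<^esub>"
      using uniq a by blast+
  next
    fix b assume b: "b \<in> carrier B"
    have "l b = k \<one>\<^bsub>A\<^esub> \<otimes>\<^bsub>X\<^esub> l b \<otimes>\<^bsub>X\<^esub> s \<one>\<^bsub>C\<^esub>"
      using b by simp
    then show "f1 (l b) = \<one>\<^bsub>A\<^esub>" "f2 (l b) = b"
      using uniq b by blast+
  qed (use f in auto)
  then show ?thesis by blast
qed

end

text \<open>Expresses that the three maps together are an isomorphism onto the product of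
  \<open>A\<close>, \<open>B\<close> and \<open>C\<close>, with injectivity stated as a trivial
  common kernel.\<close>

definition triple_iso where
  "triple_iso X A B C f\<^sub>1 f\<^sub>2 f\<^sub>3 \<longleftrightarrow> f\<^sub>1 \<in> hom X A \<and> f\<^sub>2 \<in> hom X B \<and> f\<^sub>3 \<in> hom X C \<and>
     (\<forall>a\<in>carrier A. \<forall>b\<in>carrier B. \<forall>c\<in>carrier C. \<exists>x\<in>carrier X. f\<^sub>1 x = a \<and> f\<^sub>2 x = b \<and> f\<^sub>3 x = c) \<and>
     (\<forall>x\<in>carrier X. f\<^sub>1 x = \<one>\<^bsub>A\<^esub> \<longrightarrow> f\<^sub>2 x = \<one>\<^bsub>B\<^esub> \<longrightarrow> f\<^sub>3 x = \<one>\<^bsub>C\<^esub> \<longrightarrow> x = \<one>\<^bsub>X\<^esub>)"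

text \<open>Multiplying a preimage of \<open>c\<close> by elements from the two members adjusts
  \<open>f\<^sub>1\<close> and \<open>f\<^sub>2\<close> at will and leaves \<open>\<delta>\<close>
  unchanged. Only the splitting equations and exactness enter, so this applies to whichever pair a
  recursion step has chosen.\<close>

lemma (in short_exact_sum_groups) splitting_triple_iso:
  assumes sp: "splitting f\<^sub>1 f\<^sub>2"
  shows "triple_iso X A B C f\<^sub>1 f\<^sub>2 \<delta>"
proof -
  interpret f1: group_hom X A f\<^sub>1
    using sp by unfold_locales (simp add: splitting_def)
  interpret f2: group_hom X B f\<^sub>2
    using sp by unfold_locales (simp add: splitting_def)
  have f: "f\<^sub>1 (k a) = a" "f\<^sub>2 (k a) = \<one>\<^bsub>B\<^esub>" if "a \<in> carrier A" for a
    using sp that by (auto simp: splitting_def)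
  have g: "f\<^sub>1 (l b) = \<one>\<^bsub>A\<^esub>" "f\<^sub>2 (l b) = b" if "b \<in> carrier B" for b
    using sp that by (auto simp: splitting_def)
  show ?thesis
    unfolding triple_iso_def
  proof (intro conjI ballI impI)
    fix a b c assume abc: "a \<in> carrier A" "b \<in> carrier B" "c \<in> carrier C"
    have "c \<in> \<delta> ` carrier X"
      using epi abc(3) by (simp add: epi_def)
    then obtain x where x: "x \<in> carrier X" "\<delta> x = c"
      by (metis imageE)
    \<comment> \<open>The corrections \<open>a'\<close> and \<open>b'\<close> are what is missing
      from \<open>f\<^sub>1 x\<close> to \<open>a\<close> and from \<open>f\<^sub>2 x\<close> to
      \<open>b\<close>.\<close>
    define a' where "a' = inv\<^bsub>A\<^esub> f\<^sub>1 x \<otimes>\<^bsub>A\<^esub> a"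
    define b' where "b' = inv\<^bsub>B\<^esub> f\<^sub>2 x \<otimes>\<^bsub>B\<^esub> b"
    have a'b': "a' \<in> carrier A" "b' \<in> carrier B"
      using x abc by (auto simp: a'_def b'_def)
    let ?y = "x \<otimes>\<^bsub>X\<^esub> (k a' \<otimes>\<^bsub>X\<^esub> l b')"
    have "?y \<in> carrier X"
      using x a'b' by simp
    moreover have "f\<^sub>1 ?y = a"
      using x a'b' abc by (simp add: f g) (simp add: a'_def A.m_assoc [symmetric])
    moreover have "f\<^sub>2 ?y = b"
      using x a'b' abc by (simp add: f g) (simp add: b'_def B.m_assoc [symmetric])
    moreover have "\<delta> ?y = c"
    proof -
      have "\<delta> ?y = \<delta> x \<otimes>\<^bsub>C\<^esub> \<delta> (k a' \<otimes>\<^bsub>X\<^esub> l b')"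
        using x a'b' by (intro \<delta>.hom_mult) auto
      then show ?thesis
        unfolding \<delta>_incl [OF a'b'] using x abc by simp
    qed
    ultimately show "\<exists>x\<in>carrier X. f\<^sub>1 x = a \<and> f\<^sub>2 x = b \<and> \<delta> x = c"
      by blast
  next
    fix x assume x: "x \<in> carrier X" "f\<^sub>1 x = \<one>\<^bsub>A\<^esub>" "f\<^sub>2 x = \<one>\<^bsub>B\<^esub>" "\<delta> x = \<one>\<^bsub>C\<^esub>"
    obtain a b where ab: "a \<in> carrier A" "b \<in> carrier B" "x = k a \<otimes>\<^bsub>X\<^esub> l b"
      using kernelD [OF x(1,4)] .
    have "a = \<one>\<^bsub>A\<^esub>" "b = \<one>\<^bsub>B\<^esub>"
      using x(2,3) ab by (simp_all add: f g)
    then show "x = \<one>\<^bsub>X\<^esub>"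
      using ab by simp
  qed (use sp in \<open>auto simp: splitting_def\<close>)
qed

lemma short_exact_sum_iso:
  assumes "short_exact_sum X A B C k l \<delta>" "\<phi> \<in> iso C D" "group C" "group D"
  shows "short_exact_sum X A B D k l (\<phi> \<circ> \<delta>)"
proof -
  have \<delta>: "\<delta> \<in> epi X C" and \<phi>: "\<phi> \<in> hom C D" "inj_on \<phi> (carrier C)" "\<phi> ` carrier C = carrier D"
    using assms by (auto simp: short_exact_sum_def iso_def bij_betw_def)
  have "\<phi> \<circ> \<delta> \<in> epi X D"
    using \<delta> \<phi>(1,3) hom_compose [of \<delta> X C \<phi> D] unfolding epi_def mem_Collect_eq image_comp [symmetric] by simp
  moreover have "(\<phi> \<circ> \<delta>) x = \<one>\<^bsub>D\<^esub> \<longleftrightarrow> \<delta> x = \<one>\<^bsub>C\<^esub>" if "x \<in> carrier X" for x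
  proof -
    have "\<delta> x \<in> carrier C"
      using \<delta> that by (auto simp: epi_def)
    moreover have "\<one>\<^bsub>C\<^esub> \<in> carrier C" "\<phi> \<one>\<^bsub>C\<^esub> = \<one>\<^bsub>D\<^esub>"
      using assms(3,4) \<phi>(1) by (auto intro: hom_one monoid.one_closed group.is_monoid)
    ultimately show ?thesis
      using \<phi>(2) by (metis comp_apply inj_onD)
  qed
  ultimately show ?thesis
    using assms(1) unfolding short_exact_sum_def by simp
qed

lemma triple_iso_int_power:
  assumes t: "triple_iso X A B C f\<^sub>1 f\<^sub>2 f\<^sub>3" and gr: "group X" "group A" "group B" "group C"
    and iso: "A \<cong> int_power p" "B \<cong> int_power q" "C \<cong> int_power r"
  shows "X \<cong> int_power (p + q + r)"
proof -
  interpret X: group X by (rule gr)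
  interpret A: group A by (rule gr)
  interpret B: group B by (rule gr)
  interpret C: group C by (rule gr)
  obtain \<alpha> \<beta> \<gamma> where \<alpha>: "\<alpha> \<in> iso A (int_power p)" and \<beta>: "\<beta> \<in> iso B (int_power q)" and \<gamma>: "\<gamma> \<in> iso C (int_power r)"
    using iso unfolding is_iso_def by blast
  have t1: "f\<^sub>1 \<in> hom X A" "f\<^sub>2 \<in> hom X B" "f\<^sub>3 \<in> hom X C"
    and surj: "\<And>a b c. a \<in> carrier A \<Longrightarrow> b \<in> carrier B \<Longrightarrow> c \<in> carrier C \<Longrightarrow> \<exists>x\<in>carrier X. f\<^sub>1 x = a \<and> f\<^sub>2 x = b \<and> f\<^sub>3 x = c"
    and inj: "\<And>x. x \<in> carrier X \<Longrightarrow> f\<^sub>1 x = \<one>\<^bsub>A\<^esub> \<Longrightarrow> f\<^sub>2 x = \<one>\<^bsub>B\<^esub> \<Longrightarrow> f\<^sub>3 x = \<one>\<^bsub>C\<^esub> \<Longrightarrow> x = \<one>\<^bsub>X\<^esub>"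
    using t unfolding triple_iso_def by blast+
  have \<alpha>hom: "\<alpha> \<circ> f\<^sub>1 \<in> hom X (int_power p)" "\<beta> \<circ> f\<^sub>2 \<in> hom X (int_power q)" "\<gamma> \<circ> f\<^sub>3 \<in> hom X (int_power r)"
    using t1 \<alpha> \<beta> \<gamma> by (auto simp: iso_def intro: hom_compose)
  interpret a: group_hom X "int_power p" "\<alpha> \<circ> f\<^sub>1"
    by (simp only: group_hom_def group_hom_axioms_def group_int_power \<alpha>hom gr)
  interpret b: group_hom X "int_power q" "\<beta> \<circ> f\<^sub>2"
    by (simp only: group_hom_def group_hom_axioms_def group_int_power \<alpha>hom gr)
  interpret c: group_hom X "int_power r" "\<gamma> \<circ> f\<^sub>3"
    by (simp only: group_hom_def group_hom_axioms_def group_int_power \<alpha>hom gr)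
  \<comment> \<open>The coordinates of the three factors are laid side by side, with offsets
    \<open>0\<close>, \<open>p\<close> and \<open>p + q\<close>.\<close>
  define F where "F x = (\<lambda>i\<in>{..<p + q + r}. if i < p then (\<alpha> \<circ> f\<^sub>1) x i else if i < p + q then (\<beta> \<circ> f\<^sub>2) x (i - p)
    else (\<gamma> \<circ> f\<^sub>3) x (i - p - q))" for x
  have Fhom: "F \<in> hom X (int_power (p + q + r))"
  proof (rule homI)
    fix x y assume "x \<in> carrier X" "y \<in> carrier X"
    then show "F (x \<otimes>\<^bsub>X\<^esub> y) = F x \<otimes>\<^bsub>int_power (p + q + r)\<^esub> F y"
      unfolding F_def by (simp only: a.hom_mult b.hom_mult c.hom_mult) (auto simp: mult_int_power fun_eq_iff)
  qed (auto simp: F_def carrier_int_power)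
  interpret F: group_hom X "int_power (p + q + r)" F
    by (simp only: group_hom_def group_hom_axioms_def group_int_power Fhom gr)
  have "x = \<one>\<^bsub>X\<^esub>" if x: "x \<in> carrier X" "F x = \<one>\<^bsub>int_power (p + q + r)\<^esub>" for x
  proof (rule inj [OF x(1)])
    have F0: "F x i = 0" if "i < p + q + r" for i
      using x(2) that by (simp add: one_int_power)
    have "(\<alpha> \<circ> f\<^sub>1) x i = 0" if "i < p" for i
      using F0 [of i] that by (simp add: F_def)
    then have "(\<alpha> \<circ> f\<^sub>1) x = \<one>\<^bsub>int_power p\<^esub>"
      using a.hom_closed [OF x(1)] by (auto simp: carrier_int_power one_int_power PiE_iff extensional_def fun_eq_iff)
    then show "f\<^sub>1 x = \<one>\<^bsub>A\<^esub>"
      using iso_eq_one_iff [OF \<alpha> gr(2) group_int_power hom_in_carrier [OF t1(1) x(1)]] by simp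
    have "(\<beta> \<circ> f\<^sub>2) x i = 0" if "i < q" for i
      using F0 [of "p + i"] that by (simp add: F_def)
    then have "(\<beta> \<circ> f\<^sub>2) x = \<one>\<^bsub>int_power q\<^esub>"
      using b.hom_closed [OF x(1)] by (auto simp: carrier_int_power one_int_power PiE_iff extensional_def fun_eq_iff)
    then show "f\<^sub>2 x = \<one>\<^bsub>B\<^esub>"
      using iso_eq_one_iff [OF \<beta> gr(3) group_int_power hom_in_carrier [OF t1(2) x(1)]] by simp
    have "(\<gamma> \<circ> f\<^sub>3) x i = 0" if "i < r" for i
      using F0 [of "p + q + i"] that by (simp add: F_def)
    then have "(\<gamma> \<circ> f\<^sub>3) x = \<one>\<^bsub>int_power r\<^esub>"
      using c.hom_closed [OF x(1)] by (auto simp: carrier_int_power one_int_power PiE_iff extensional_def fun_eq_iff)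
    then show "f\<^sub>3 x = \<one>\<^bsub>C\<^esub>"
      using iso_eq_one_iff [OF \<gamma> gr(4) group_int_power hom_in_carrier [OF t1(3) x(1)]] by simp
  qed
  moreover have "y \<in> F ` carrier X" if y: "y \<in> carrier (int_power (p + q + r))" for y
  proof -
    have mem: "(\<lambda>i\<in>{..<p}. y i) \<in> \<alpha> ` carrier A" "(\<lambda>i\<in>{..<q}. y (p + i)) \<in> \<beta> ` carrier B"
      "(\<lambda>i\<in>{..<r}. y (p + q + i)) \<in> \<gamma> ` carrier C"
      using \<alpha> \<beta> \<gamma> by (simp_all add: iso_def bij_betw_def carrier_int_power)
    obtain a where a: "(\<lambda>i\<in>{..<p}. y i) = \<alpha> a" "a \<in> carrier A"
      using mem(1) by (rule imageE)
    obtain b where b: "(\<lambda>i\<in>{..<q}. y (p + i)) = \<beta> b" "b \<in> carrier B"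
      using mem(2) by (rule imageE)
    obtain c where c: "(\<lambda>i\<in>{..<r}. y (p + q + i)) = \<gamma> c" "c \<in> carrier C"
      using mem(3) by (rule imageE)
    note abc = a(2) b(2) c(2) a(1) [symmetric] b(1) [symmetric] c(1) [symmetric]
    obtain x where x: "x \<in> carrier X" "f\<^sub>1 x = a" "f\<^sub>2 x = b" "f\<^sub>3 x = c"
      using surj [OF abc(1-3)] by blast
    have "F x = y"
    proof
      fix i show "F x i = y i"
        using y by (cases "i < p + q + r") (auto simp: F_def x abc carrier_int_power PiE_iff extensional_def)
    qed
    then show ?thesis
      using x by blast
  qed
  ultimately have "F \<in> iso X (int_power (p + q + r))"
    unfolding F.iso_iff by (auto intro: F.hom_closed)
  then show ?thesis
    by (rule is_isoI)
qed

text \<open>The summands outside \<open>T\<close> are trivial, so coordinates are read off on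
  \<open>T\<close> only, through chosen isomorphisms \<open>h\<close> and an enumeration
  \<open>b\<close> of \<open>T\<close>. For the decomposition, \<open>T\<close> leaves out a summand
  in degree -1.\<close>

lemma sum_group_isomorphic_int_power:
  assumes fin: "finite I" and T: "T \<subseteq> I" and gr: "\<And>i. i \<in> I \<Longrightarrow> group (G i)"
    and Z: "\<And>i. i \<in> T \<Longrightarrow> G i \<cong> integer_group" and triv: "\<And>i. i \<in> I - T \<Longrightarrow> trivial_group (G i)"
  shows "sum_group I G \<cong> int_power (card T)"
proof -
  have finT: "finite T"
    using fin T by (rule rev_finite_subset)
  obtain b where b: "bij_betw b {..<card T} T"
    using finT by (metis bij_betw_from_nat_into_finite)
  have bT: "b i \<in> T" if "i < card T" for i
    using b that by (auto simp: bij_betw_def)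
  define h where "h i = (SOME f. f \<in> iso (G i) integer_group)" for i
  have h: "h i \<in> iso (G i) integer_group" if "i \<in> T" for i
    using Z [OF that] by (simp add: is_iso_def h_def some_in_eq)
  have hhom: "h i \<in> hom (G i) integer_group" if "i \<in> T" for i
    using h [OF that] by (simp add: iso_def)
  interpret S: group "sum_group I G"
    using gr by (rule sum_group)
  have car: "carrier (sum_group I G) = (\<Pi>\<^sub>E i\<in>I. carrier (G i))"
    using fin gr by (rule carrier_sum_group_finite)
  define F where "F x = (\<lambda>i\<in>{..<card T}. h (b i) (x (b i)))" for x
  have Fhom: "F \<in> hom (sum_group I G) (int_power (card T))"
  proof (rule homI)
    fix x y assume xy: "x \<in> carrier (sum_group I G)" "y \<in> carrier (sum_group I G)"
    show "F (x \<otimes>\<^bsub>sum_group I G\<^esub> y) = F x \<otimes>\<^bsub>int_power (card T)\<^esub> F y"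
    proof
      fix i show "F (x \<otimes>\<^bsub>sum_group I G\<^esub> y) i = (F x \<otimes>\<^bsub>int_power (card T)\<^esub> F y) i"
      proof (cases "i < card T")
        case True
        have "b i \<in> I" "x (b i) \<in> carrier (G (b i))" "y (b i) \<in> carrier (G (b i))"
          using T bT [OF True] xy by (auto simp: car)
        then show ?thesis
          using True hom_mult [OF hhom [OF bT [OF True]]] by (simp add: F_def mult_int_power integer_group_def)
      qed (simp add: F_def mult_int_power)
    qed
  qed (auto simp: F_def carrier_int_power)
  interpret F: group_hom "sum_group I G" "int_power (card T)" F
    by (simp only: group_hom_def group_hom_axioms_def group_int_power Fhom S.is_group)
  have "x = \<one>\<^bsub>sum_group I G\<^esub>" if x: "x \<in> carrier (sum_group I G)" "F x = \<one>\<^bsub>int_power (card T)\<^esub>" for x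
  proof
    fix i
    have xi: "x i \<in> carrier (G i)" if "i \<in> I"
      using x(1) that by (auto simp: car)
    show "x i = \<one>\<^bsub>sum_group I G\<^esub> i"
    proof (cases "i \<in> T")
      case True
      then have "i \<in> b ` {..<card T}"
        using b by (simp add: bij_betw_def)
      then obtain j where j: "j < card T" "b j = i"
        by auto
      have "h i (x i) = F x j"
        using j by (simp add: F_def)
      also have "\<dots> = 0"
        unfolding x(2) using j by (simp add: one_int_power)
      finally have "h i (x i) = \<one>\<^bsub>integer_group\<^esub>"
        by (simp add: integer_group_def)
      then have "x i = \<one>\<^bsub>G i\<^esub>"
        using iso_eq_one_iff [OF h [OF True] gr group_integer_group xi] T True by blast
      then show ?thesis
        using True T by auto
    next
      case False
      then show ?thesis
        using triv [of i] xi x(1) by (cases "i \<in> I") (auto simp: trivial_group_def car PiE_iff extensional_def)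
    qed
  qed
  moreover have "y \<in> F ` carrier (sum_group I G)" if y: "y \<in> carrier (int_power (card T))" for y
  proof -
    define x where "x = (\<lambda>i\<in>I. if i \<in> T then inv_into (carrier (G i)) (h i) (y (inv_into {..<card T} b i)) else \<one>\<^bsub>G i\<^esub>)"
    have surj: "z \<in> h i ` carrier (G i)" if "i \<in> T" for i z
      using h [OF that] by (simp add: iso_def bij_betw_def integer_group_def)
    have "x \<in> carrier (sum_group I G)"
      unfolding car x_def using inv_into_into [OF surj] gr
      by (auto intro!: monoid.one_closed group.is_monoid)
    moreover have "F x = y"
    proof
      fix i show "F x i = y i"
      proof (cases "i < card T")
        case True
        then have "inv_into {..<card T} b (b i) = i"
          using b by (auto simp: bij_betw_def)
        then show ?thesis
          using True T bT [OF True] f_inv_into_f [OF surj [OF bT [OF True]]] by (auto simp: F_def x_def)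
      next
        case False
        then show ?thesis
          using y by (auto simp: F_def carrier_int_power PiE_iff extensional_def)
      qed
    qed
    ultimately show ?thesis by blast
  qed
  ultimately have "F \<in> iso (sum_group I G) (int_power (card T))"
    unfolding F.iso_iff by (auto intro: F.hom_closed)
  then show ?thesis
    by (rule is_isoI)
qed

lemma carrier_subgroup_generated_kernel:
  assumes "group_hom G H f"
  shows "carrier (subgroup_generated G (kernel G H f)) = kernel G H f"
proof -
  interpret group_hom G H f by (rule assms)
  show ?thesis
    using subgroup.carrier_subgroup_generated_subgroup [OF subgroup_kernel] .
qed

text \<open>The index sets \<open>K \<ni> j\<close>, \<open>K \<noteq> {j}\<close> of the decomposition are in bijection with the nonempty
  subsets of \<open>J\<close> via \<open>K \<mapsto> K - {j}\<close>.\<close>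

locale sum_group_recursion =
  fixes X :: "('x, 'xm) monoid_scheme" and B :: "('b, 'bm) monoid_scheme" and C :: "('c, 'cm) monoid_scheme"
    and G :: "nat set \<Rightarrow> ('g, 'gm) monoid_scheme" and f\<^sub>1 f\<^sub>2 f\<^sub>3 and g\<^sub>2 \<gamma> and g and J :: "nat set" and j :: nat
  assumes X: "group X" and B: "group B" and C: "group C"
    and G: "\<And>K. K \<subseteq> insert j J \<Longrightarrow> K \<noteq> {} \<Longrightarrow> group (G K)"
    and J: "finite J" "j \<notin> J"
    and t: "triple_iso X (G {j}) B C f\<^sub>1 f\<^sub>2 f\<^sub>3"
    and g\<^sub>2: "g\<^sub>2 \<in> iso B (sum_group {K. K \<subseteq> J \<and> K \<noteq> {}} G)"
    and \<gamma>: "\<gamma> \<in> epi C (sum_group {K. K \<subseteq> J \<and> K \<noteq> {}} (\<lambda>K. G (insert j K)))"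
    and g: "\<And>x. x \<in> carrier X \<Longrightarrow> g x = (\<lambda>K\<in>{K. K \<subseteq> insert j J \<and> K \<noteq> {}}.
      if K = {j} then f\<^sub>1 x else if j \<notin> K then g\<^sub>2 (f\<^sub>2 x) K else \<gamma> (f\<^sub>3 x) (K - {j}))"
begin

abbreviation "D \<equiv> sum_group {K. K \<subseteq> insert j J \<and> K \<noteq> {}} G"
abbreviation "D\<^sub>2 \<equiv> sum_group {K. K \<subseteq> J \<and> K \<noteq> {}} G"
abbreviation "D\<^sub>3 \<equiv> sum_group {K. K \<subseteq> J \<and> K \<noteq> {}} (\<lambda>K. G (insert j K))"

lemma fin: "finite {K. K \<subseteq> insert j J \<and> K \<noteq> {}}" "finite {K. K \<subseteq> J \<and> K \<noteq> {}}"
  using J by auto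

lemma G_insert: "K \<subseteq> J \<Longrightarrow> group (G (insert j K))"
  by (rule G) auto

lemma groups: "group D" "group D\<^sub>2" "group D\<^sub>3"
  using G G_insert by (auto intro!: sum_group)

lemma carriers:
  "carrier D = (\<Pi>\<^sub>E K\<in>{K. K \<subseteq> insert j J \<and> K \<noteq> {}}. carrier (G K))"
  "carrier D\<^sub>2 = (\<Pi>\<^sub>E K\<in>{K. K \<subseteq> J \<and> K \<noteq> {}}. carrier (G K))"
  "carrier D\<^sub>3 = (\<Pi>\<^sub>E K\<in>{K. K \<subseteq> J \<and> K \<noteq> {}}. carrier (G (insert j K)))"
  using G G_insert by (auto intro!: carrier_sum_group_finite fin)

lemma homs: "f\<^sub>1 \<in> hom X (G {j})" "f\<^sub>2 \<in> hom X B" "f\<^sub>3 \<in> hom X C" "g\<^sub>2 \<in> hom B D\<^sub>2" "\<gamma> \<in> hom C D\<^sub>3"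
  using t g\<^sub>2 \<gamma> by (simp_all add: triple_iso_def iso_def epi_def)

lemma triple_surj:
  assumes "a \<in> carrier (G {j})" "b \<in> carrier B" "c \<in> carrier C"
  obtains x where "x \<in> carrier X" "f\<^sub>1 x = a" "f\<^sub>2 x = b" "f\<^sub>3 x = c"
proof -
  have "\<exists>x\<in>carrier X. f\<^sub>1 x = a \<and> f\<^sub>2 x = b \<and> f\<^sub>3 x = c"
    using t assms unfolding triple_iso_def by blast
  then show thesis
    using that by blast
qed

lemma triple_inj:
  assumes "x \<in> carrier X" "f\<^sub>1 x = \<one>\<^bsub>G {j}\<^esub>" "f\<^sub>2 x = \<one>\<^bsub>B\<^esub>" "f\<^sub>3 x = \<one>\<^bsub>C\<^esub>"
  shows "x = \<one>\<^bsub>X\<^esub>"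
  using t assms unfolding triple_iso_def by blast

lemma cases_K:
  assumes "K \<subseteq> insert j J" "K \<noteq> {}"
  obtains "K = {j}" | "j \<notin> K" "K \<subseteq> J" | K' where "K = insert j K'" "j \<notin> K'" "K' \<subseteq> J" "K' \<noteq> {}"
proof -
  consider "K = {j}" | "j \<notin> K" | "j \<in> K" "K \<noteq> {j}" by blast
  then show thesis
  proof cases
    case 3
    then show thesis
      using assms by (intro that(3) [of "K - {j}"]) auto
  qed (use assms that in auto)
qed

lemma g_apply:
  assumes x: "x \<in> carrier X"
  shows "g x {j} = f\<^sub>1 x"
    and "K \<subseteq> J \<Longrightarrow> K \<noteq> {} \<Longrightarrow> g x K = g\<^sub>2 (f\<^sub>2 x) K"
    and "K \<subseteq> J \<Longrightarrow> K \<noteq> {} \<Longrightarrow> g x (insert j K) = \<gamma> (f\<^sub>3 x) K"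
proof -
  show "g x {j} = f\<^sub>1 x"
    by (simp add: g [OF x])
  assume K: "K \<subseteq> J" "K \<noteq> {}"
  have jK: "j \<notin> K"
    using K J by auto
  show "g x K = g\<^sub>2 (f\<^sub>2 x) K"
    using K jK by (auto simp: g [OF x])
  have "insert j K \<noteq> {j}" "insert j K - {j} = K" "insert j K \<subseteq> insert j J"
    using K jK by auto
  then show "g x (insert j K) = \<gamma> (f\<^sub>3 x) K"
    by (simp add: g [OF x])
qed

lemma g_extensional: "x \<in> carrier X \<Longrightarrow> \<not> (K \<subseteq> insert j J \<and> K \<noteq> {}) \<Longrightarrow> g x K = undefined"
  by (auto simp: g)

lemma eqI:
  assumes "y \<in> carrier D" "z \<in> carrier D" "y {j} = z {j}"
    and "\<And>K. K \<subseteq> J \<Longrightarrow> K \<noteq> {} \<Longrightarrow> y K = z K"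
    and "\<And>K. K \<subseteq> J \<Longrightarrow> K \<noteq> {} \<Longrightarrow> y (insert j K) = z (insert j K)"
  shows "y = z"
proof (rule PiE_ext [OF assms(1,2) [unfolded carriers]])
  fix K assume "K \<in> {K. K \<subseteq> insert j J \<and> K \<noteq> {}}"
  then have K: "K \<subseteq> insert j J" "K \<noteq> {}" by auto
  then show "y K = z K"
    by (cases rule: cases_K) (use assms K in auto)
qed

lemma g_closed:
  assumes x: "x \<in> carrier X"
  shows "g x \<in> carrier D"
  unfolding carriers
proof (rule PiE_I)
  fix K assume "K \<in> {K. K \<subseteq> insert j J \<and> K \<noteq> {}}"
  then have K: "K \<subseteq> insert j J" "K \<noteq> {}" by auto
  have c: "f\<^sub>1 x \<in> carrier (G {j})" "g\<^sub>2 (f\<^sub>2 x) \<in> carrier D\<^sub>2" "\<gamma> (f\<^sub>3 x) \<in> carrier D\<^sub>3"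
    using homs x by (meson hom_in_carrier)+
  show "g x K \<in> carrier (G K)"
    using K
  proof (cases rule: cases_K)
    case 1
    then show ?thesis
      using c g_apply(1) [OF x] by simp
  next
    case 2
    then show ?thesis
      using c g_apply(2) [OF x] K by (auto simp: carriers)
  next
    case (3 K')
    then show ?thesis
      using c g_apply(3) [OF x] by (auto simp: carriers)
  qed
qed (use g_extensional [OF x] in auto)

lemma g_hom: "g \<in> hom X D"
proof (rule homI)
  fix x y assume xy: "x \<in> carrier X" "y \<in> carrier X"
  have xy': "x \<otimes>\<^bsub>X\<^esub> y \<in> carrier X"
    using X xy by (simp add: monoid.m_closed group.is_monoid)
  have f: "f\<^sub>2 x \<in> carrier B" "f\<^sub>2 y \<in> carrier B" "f\<^sub>3 x \<in> carrier C" "f\<^sub>3 y \<in> carrier C"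
    using homs xy by (meson hom_in_carrier)+
  show "g (x \<otimes>\<^bsub>X\<^esub> y) = g x \<otimes>\<^bsub>D\<^esub> g y"
  proof (rule eqI)
    show "g (x \<otimes>\<^bsub>X\<^esub> y) \<in> carrier D" "g x \<otimes>\<^bsub>D\<^esub> g y \<in> carrier D"
      using g_closed xy xy' groups by (simp_all add: monoid.m_closed group.is_monoid del: mult_sum_group)
    show "g (x \<otimes>\<^bsub>X\<^esub> y) {j} = (g x \<otimes>\<^bsub>D\<^esub> g y) {j}"
      using g_apply(1) xy xy' hom_mult [OF homs(1)] by simp
    fix K assume K: "K \<subseteq> J" "K \<noteq> {}"
    have "g (x \<otimes>\<^bsub>X\<^esub> y) K = (g\<^sub>2 (f\<^sub>2 x) \<otimes>\<^bsub>D\<^sub>2\<^esub> g\<^sub>2 (f\<^sub>2 y)) K"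
      by (simp only: g_apply(2) [OF xy' K] hom_mult [OF homs(2) xy] hom_mult [OF homs(4) f(1,2)])
    then show "g (x \<otimes>\<^bsub>X\<^esub> y) K = (g x \<otimes>\<^bsub>D\<^esub> g y) K"
      using K g_apply(2) [OF xy(1) K] g_apply(2) [OF xy(2) K] by (simp add: subset_insertI2)
    have "g (x \<otimes>\<^bsub>X\<^esub> y) (insert j K) = (\<gamma> (f\<^sub>3 x) \<otimes>\<^bsub>D\<^sub>3\<^esub> \<gamma> (f\<^sub>3 y)) K"
      by (simp only: g_apply(3) [OF xy' K] hom_mult [OF homs(3) xy] hom_mult [OF homs(5) f(3,4)])
    then show "g (x \<otimes>\<^bsub>X\<^esub> y) (insert j K) = (g x \<otimes>\<^bsub>D\<^esub> g y) (insert j K)"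
      using K g_apply(3) [OF xy(1) K] g_apply(3) [OF xy(2) K] by (auto simp: subset_insertI2)
  qed
qed (rule g_closed)

text \<open>Prescribed components are lifted separately, through \<open>g\<^sub>2\<close> and
  \<open>\<gamma>\<close>, and \<open>triple_iso\<close> produces one \<open>x\<close> with the
  three lifts.\<close>

lemma g_epi: "g \<in> epi X D"
  unfolding epi_def mem_Collect_eq
proof (intro conjI g_hom equalityI subsetI)
  fix y assume y: "y \<in> carrier D"
  have yj: "y {j} \<in> carrier (G {j})"
    using y by (auto simp: carriers)
  have "(\<lambda>K\<in>{K. K \<subseteq> J \<and> K \<noteq> {}}. y K) \<in> g\<^sub>2 ` carrier B"
  proof -
    have "g\<^sub>2 ` carrier B = carrier D\<^sub>2"
      using g\<^sub>2 by (simp add: iso_def bij_betw_def)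
    then show ?thesis
      using y by (auto simp: carriers)
  qed
  then obtain b where b: "(\<lambda>K\<in>{K. K \<subseteq> J \<and> K \<noteq> {}}. y K) = g\<^sub>2 b" "b \<in> carrier B"
    by (rule imageE)
  have "(\<lambda>K\<in>{K. K \<subseteq> J \<and> K \<noteq> {}}. y (insert j K)) \<in> \<gamma> ` carrier C"
  proof -
    have "\<gamma> ` carrier C = carrier D\<^sub>3"
      using \<gamma> by (simp add: epi_def)
    then show ?thesis
      using y by (auto simp: carriers)
  qed
  then obtain c where c: "(\<lambda>K\<in>{K. K \<subseteq> J \<and> K \<noteq> {}}. y (insert j K)) = \<gamma> c" "c \<in> carrier C"
    by (rule imageE)
  obtain x where x: "x \<in> carrier X" "f\<^sub>1 x = y {j}" "f\<^sub>2 x = b" "f\<^sub>3 x = c"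
    by (rule triple_surj [OF yj b(2) c(2)])
  have "g x = y"
  proof (rule eqI [OF g_closed [OF x(1)] y])
    show "g x {j} = y {j}"
      using g_apply(1) [OF x(1)] x by simp
    fix K assume K: "K \<subseteq> J" "K \<noteq> {}"
    show "g x K = y K"
      using g_apply(2) [OF x(1) K] fun_cong [OF b(1), of K] K x by simp
    show "g x (insert j K) = y (insert j K)"
      using g_apply(3) [OF x(1) K] fun_cong [OF c(1), of K] K x by simp
  qed
  then show "y \<in> g ` carrier X"
    using x by blast
qed (use g_closed in blast)

text \<open>Since \<open>g\<^sub>2\<close> is injective, the second block of components vanishes
  only if \<open>f\<^sub>2 x\<close> does; the map \<open>\<gamma>\<close> is the only possible
  source of a kernel.\<close>

lemma g_kernel: "kernel X D g = {x \<in> carrier X. f\<^sub>1 x = \<one>\<^bsub>G {j}\<^esub> \<and> f\<^sub>2 x = \<one>\<^bsub>B\<^esub> \<and> \<gamma> (f\<^sub>3 x) = \<one>\<^bsub>D\<^sub>3\<^esub>}"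
proof -
  have "g x = \<one>\<^bsub>D\<^esub> \<longleftrightarrow> f\<^sub>1 x = \<one>\<^bsub>G {j}\<^esub> \<and> f\<^sub>2 x = \<one>\<^bsub>B\<^esub> \<and> \<gamma> (f\<^sub>3 x) = \<one>\<^bsub>D\<^sub>3\<^esub>"
    if x: "x \<in> carrier X" for x
  proof -
    have "g\<^sub>2 (f\<^sub>2 x) = \<one>\<^bsub>D\<^sub>2\<^esub> \<longleftrightarrow> f\<^sub>2 x = \<one>\<^bsub>B\<^esub>"
      by (rule iso_eq_one_iff [OF g\<^sub>2 B groups(2) hom_in_carrier [OF homs(2) x]])
    moreover have "g x = \<one>\<^bsub>D\<^esub> \<longleftrightarrow> f\<^sub>1 x = \<one>\<^bsub>G {j}\<^esub> \<and> g\<^sub>2 (f\<^sub>2 x) = \<one>\<^bsub>D\<^sub>2\<^esub> \<and> \<gamma> (f\<^sub>3 x) = \<one>\<^bsub>D\<^sub>3\<^esub>"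
    proof
      assume 1: "g x = \<one>\<^bsub>D\<^esub>"
      have c: "g\<^sub>2 (f\<^sub>2 x) \<in> carrier D\<^sub>2" "\<gamma> (f\<^sub>3 x) \<in> carrier D\<^sub>3"
        using homs x by (meson hom_in_carrier)+
      have "f\<^sub>1 x = \<one>\<^bsub>G {j}\<^esub>"
        using g_apply(1) [OF x] 1 by simp
      moreover have "g\<^sub>2 (f\<^sub>2 x) = \<one>\<^bsub>D\<^sub>2\<^esub>"
      proof (rule PiE_ext)
        show "g\<^sub>2 (f\<^sub>2 x) \<in> (\<Pi>\<^sub>E K\<in>{K. K \<subseteq> J \<and> K \<noteq> {}}. carrier (G K))"
          "\<one>\<^bsub>D\<^sub>2\<^esub> \<in> (\<Pi>\<^sub>E K\<in>{K. K \<subseteq> J \<and> K \<noteq> {}}. carrier (G K))"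
          using c(1) monoid.one_closed [OF group.is_monoid [OF groups(2)]] unfolding carriers by simp_all
        fix K assume K: "K \<in> {K. K \<subseteq> J \<and> K \<noteq> {}}"
        then show "g\<^sub>2 (f\<^sub>2 x) K = \<one>\<^bsub>D\<^sub>2\<^esub> K"
          using g_apply(2) [OF x, of K] 1 by (auto simp: subset_insertI2)
      qed
      moreover have "\<gamma> (f\<^sub>3 x) = \<one>\<^bsub>D\<^sub>3\<^esub>"
      proof (rule PiE_ext)
        show "\<gamma> (f\<^sub>3 x) \<in> (\<Pi>\<^sub>E K\<in>{K. K \<subseteq> J \<and> K \<noteq> {}}. carrier (G (insert j K)))"
          "\<one>\<^bsub>D\<^sub>3\<^esub> \<in> (\<Pi>\<^sub>E K\<in>{K. K \<subseteq> J \<and> K \<noteq> {}}. carrier (G (insert j K)))"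
          using c(2) monoid.one_closed [OF group.is_monoid [OF groups(3)]] unfolding carriers by simp_all
        fix K assume K: "K \<in> {K. K \<subseteq> J \<and> K \<noteq> {}}"
        then show "\<gamma> (f\<^sub>3 x) K = \<one>\<^bsub>D\<^sub>3\<^esub> K"
          using g_apply(3) [OF x, of K] 1 by (auto simp: subset_insertI2)
      qed
      ultimately show "f\<^sub>1 x = \<one>\<^bsub>G {j}\<^esub> \<and> g\<^sub>2 (f\<^sub>2 x) = \<one>\<^bsub>D\<^sub>2\<^esub> \<and> \<gamma> (f\<^sub>3 x) = \<one>\<^bsub>D\<^sub>3\<^esub>"
        by blast
    next
      assume 1: "f\<^sub>1 x = \<one>\<^bsub>G {j}\<^esub> \<and> g\<^sub>2 (f\<^sub>2 x) = \<one>\<^bsub>D\<^sub>2\<^esub> \<and> \<gamma> (f\<^sub>3 x) = \<one>\<^bsub>D\<^sub>3\<^esub>"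
      show "g x = \<one>\<^bsub>D\<^esub>"
      proof (rule eqI [OF g_closed [OF x] monoid.one_closed [OF group.is_monoid [OF groups(1)]]])
        show "g x {j} = \<one>\<^bsub>D\<^esub> {j}"
          using g_apply(1) [OF x] 1 by simp
        fix K assume K: "K \<subseteq> J" "K \<noteq> {}"
        show "g x K = \<one>\<^bsub>D\<^esub> K" "g x (insert j K) = \<one>\<^bsub>D\<^esub> (insert j K)"
          using g_apply(2,3) [OF x K] 1 K by (auto simp: subset_insertI2)
      qed
    qed
    ultimately show ?thesis by blast
  qed
  then show ?thesis
    unfolding kernel_def by blast
qed

lemma g_iso:
  assumes "\<gamma> \<in> iso C D\<^sub>3"
  shows "g \<in> iso X D"
proof -
  interpret g: group_hom X D g
    by (simp only: group_hom_def group_hom_axioms_def X groups g_hom)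
  have "x = \<one>\<^bsub>X\<^esub>" if "x \<in> carrier X" "g x = \<one>\<^bsub>D\<^esub>" for x
  proof -
    have "x \<in> kernel X D g"
      unfolding kernel_def using that by blast
    then have x: "f\<^sub>1 x = \<one>\<^bsub>G {j}\<^esub>" "f\<^sub>2 x = \<one>\<^bsub>B\<^esub>" "\<gamma> (f\<^sub>3 x) = \<one>\<^bsub>D\<^sub>3\<^esub>"
      unfolding g_kernel by blast+
    have "f\<^sub>3 x = \<one>\<^bsub>C\<^esub>"
      using iso_eq_one_iff [OF assms C groups(3) hom_in_carrier [OF homs(3) that(1)]] x(3) by blast
    then show ?thesis
      using triple_inj x(1,2) that(1) by blast
  qed
  moreover have "g ` carrier X = carrier D"
    using g_epi by (simp add: epi_def)
  ultimately show ?thesis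
    unfolding g.iso_iff by blast
qed

text \<open>Where \<open>f\<^sub>1\<close> and \<open>f\<^sub>2\<close> vanish,
  \<open>f\<^sub>3\<close> is a bijection onto \<open>C\<close> by \<open>triple_iso\<close>. Under
  it the kernel of \<open>g\<close> corresponds to that of \<open>\<gamma>\<close>, so an infinite
  cyclic kernel is inherited from one level of the recursion to the next.\<close>

lemma g_kernel_iso:
  assumes Z: "subgroup_generated C (kernel C D\<^sub>3 \<gamma>) \<cong> integer_group"
  shows "subgroup_generated X (kernel X D g) \<cong> integer_group"
proof -
  interpret g: group_hom X D g
    by (simp only: group_hom_def group_hom_axioms_def X groups g_hom)
  interpret c: group_hom C D\<^sub>3 \<gamma>
    by (simp only: group_hom_def group_hom_axioms_def C groups homs)
  let ?KX = "subgroup_generated X (kernel X D g)" and ?KC = "subgroup_generated C (kernel C D\<^sub>3 \<gamma>)"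
  have car: "carrier ?KX = kernel X D g" "carrier ?KC = kernel C D\<^sub>3 \<gamma>"
    by (rule carrier_subgroup_generated_kernel, unfold_locales)+
  interpret KX: group ?KX
    by (rule group.group_subgroup_generated [OF X])
  interpret KC: group ?KC
    by (rule group.group_subgroup_generated [OF C])
  have hom: "f\<^sub>3 \<in> hom ?KX ?KC"
  proof (rule homI)
    fix x assume "x \<in> carrier ?KX"
    then have x: "x \<in> carrier X" "\<gamma> (f\<^sub>3 x) = \<one>\<^bsub>D\<^sub>3\<^esub>"
      unfolding car unfolding g_kernel by blast+
    then show "f\<^sub>3 x \<in> carrier ?KC"
      unfolding car unfolding kernel_def using hom_in_carrier [OF homs(3) x(1)] by blast
  next
    fix x y assume "x \<in> carrier ?KX" "y \<in> carrier ?KX"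
    then have "x \<in> carrier X" "y \<in> carrier X"
      unfolding car unfolding kernel_def by auto
    then show "f\<^sub>3 (x \<otimes>\<^bsub>?KX\<^esub> y) = f\<^sub>3 x \<otimes>\<^bsub>?KC\<^esub> f\<^sub>3 y"
      using hom_mult [OF homs(3)] by simp
  qed
  interpret f: group_hom ?KX ?KC f\<^sub>3
    by (simp only: group_hom_def group_hom_axioms_def KX.is_group KC.is_group hom)
  have "f\<^sub>3 ` carrier ?KX = carrier ?KC"
  proof (intro equalityI subsetI)
    fix c assume "c \<in> carrier ?KC"
    then have c: "c \<in> carrier C" "\<gamma> c = \<one>\<^bsub>D\<^sub>3\<^esub>"
      unfolding car unfolding kernel_def by auto
    have ones: "\<one>\<^bsub>G {j}\<^esub> \<in> carrier (G {j})" "\<one>\<^bsub>B\<^esub> \<in> carrier B"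
      using B G [of "{j}"] by (auto intro: monoid.one_closed group.is_monoid)
    obtain x where "x \<in> carrier X" "f\<^sub>1 x = \<one>\<^bsub>G {j}\<^esub>" "f\<^sub>2 x = \<one>\<^bsub>B\<^esub>" "f\<^sub>3 x = c"
      by (rule triple_surj [OF ones c(1)])
    then show "c \<in> f\<^sub>3 ` carrier ?KX"
      unfolding car unfolding g_kernel using c(2) by blast
  qed (use f.hom_closed in blast)
  moreover have "x = \<one>\<^bsub>?KX\<^esub>" if "x \<in> carrier ?KX" "f\<^sub>3 x = \<one>\<^bsub>?KC\<^esub>" for x
    using that triple_inj [of x] unfolding car unfolding g_kernel by simp
  ultimately have "f\<^sub>3 \<in> iso ?KX ?KC"
    unfolding f.iso_iff by blast
  then show ?thesis
    using Z iso_trans is_isoI by blast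
qed

end

section \<open>Homology of the sets \<open>S\<^sup>I\<^sup>,\<^sup>J\<close>\<close>

lemma trivial_Hred_empty: "trivial_group (Hred p {})"
  by (rule trivial_reduced_homology_group_empty) simp

lemma cap_cup_insert: "cap_cup S I (insert j J) = cap_cup S I {j} \<union> cap_cup S I J"
  by (auto simp: cap_cup_def)

lemma cap_cup_Int: "cap_cup S I {j} \<inter> cap_cup S I J = cap_cup S (insert j I) J"
  by (auto simp: cap_cup_def)

lemma cap_cup_singleton: "cap_cup S I {j} = (\<Inter>i\<in>insert j I. S i)"
  by (auto simp: cap_cup_def)

lemma cap_cup_empty [simp]: "cap_cup S I {} = {}"
  by (simp add: cap_cup_def)

text \<open>Serves the stages of the recursion with \<open>|I| > n\<close>, where the middle degree
  is negative and the groups vanish.\<close>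

lemma trivial_homs_splitting:
  assumes "trivial_group (Hred (mid_degree n I) (cap_cup S I {j}))"
    and "trivial_group (Hred (mid_degree n I) (cap_cup S I (J - {j})))"
  shows "splitting_homs n S I j J (\<lambda>_. \<one>\<^bsub>Hred (mid_degree n I) (cap_cup S I {j})\<^esub>)
    (\<lambda>_. \<one>\<^bsub>Hred (mid_degree n I) (cap_cup S I (J - {j}))\<^esub>)"
  unfolding splitting_homs_def Let_def
proof (intro conjI ballI trivial_hom group_reduced_homology_group)
qed (use assms in \<open>auto simp: trivial_group_def\<close>)

section \<open>The induction for an abstract family of closed sets\<close>

text \<open>Collects what the induction takes from the geometry of the spheres. The degree
  \<open>n + 1 - |L|\<close> is the dimension of the real sphere to which an intersection of
  \<open>|L|\<close> spheres is homotopy equivalent: \<open>|L| = n + 1\<close> gives two points up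
  to homotopy, and \<open>|L| = n + 2\<close> the empty set.\<close>

locale sphere_arrangement =
  fixes S :: "nat \<Rightarrow> 'a::euclidean_space set" and n N :: nat
  assumes closed_S: "\<And>i. closed (S i)"
    and ANR_Inter: "\<And>L. L \<subseteq> {1..N} \<Longrightarrow> ANR (\<Inter>i\<in>L. S i)"
    and card_bound: "\<And>L. L \<subseteq> {1..N} \<Longrightarrow> card L \<le> n + 2"
    and Inter_empty: "\<And>L. L \<subseteq> {1..N} \<Longrightarrow> card L = n + 2 \<Longrightarrow> (\<Inter>i\<in>L. S i) = {}"
    and Inter_nonempty: "\<And>L. L \<subseteq> {1..N} \<Longrightarrow> card L \<le> n + 1 \<Longrightarrow> (\<Inter>i\<in>L. S i) \<noteq> {}"
    and Hred_Inter: "\<And>L. L \<subseteq> {1..N} \<Longrightarrow> L \<noteq> {} \<Longrightarrow> card L \<le> n + 1 \<Longrightarrow>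
      Hred (int n + 1 - int (card L)) (\<Inter>i\<in>L. S i) \<cong> integer_group"
    and trivial_Hred_Inter: "\<And>L p. L \<subseteq> {1..N} \<Longrightarrow> L \<noteq> {} \<Longrightarrow> p \<noteq> int n + 1 - int (card L) \<Longrightarrow>
      trivial_group (Hred p (\<Inter>i\<in>L. S i))"
begin

lemma finite_index: "L \<subseteq> {1..N} \<Longrightarrow> finite L"
  by (rule finite_subset) auto

abbreviation "HS I J \<equiv> Hred (mid_degree n I) (cap_cup S I J)"

abbreviation "HS_incl I J J' \<equiv> incl_hom (mid_degree n I) (cap_cup S I J) (cap_cup S I J')"

abbreviation "HS_extension I j J C \<delta> \<equiv>
  short_exact_sum_groups (HS I (insert j J)) (HS I {j}) (HS I J) C
    (HS_incl I {j} (insert j J)) (HS_incl I J (insert j J)) \<delta>"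

lemma closed_cap_cup: "finite J \<Longrightarrow> closed (cap_cup S I J)"
  unfolding cap_cup_def using closed_S by (intro closed_Int closed_INT closed_UN) auto

text \<open>\<open>I\<close> varies in the induction, because the two members meet in the set for
  \<open>insert j I\<close>, which must be an ANR as well.\<close>

lemma ANR_cap_cup:
  assumes "finite J" "I \<subseteq> {1..N}" "J \<subseteq> {1..N}"
  shows "ANR (cap_cup S I J)"
  using assms
proof (induction J arbitrary: I rule: finite_induct)
  case (insert j J)
  show ?case
    unfolding cap_cup_insert [of S I j J]
  proof (rule ANR_closed_Un)
    show "ANR (cap_cup S I {j})"
      unfolding cap_cup_singleton using insert by (intro ANR_Inter) auto
    show "ANR (cap_cup S I J)" "ANR (cap_cup S I {j} \<inter> cap_cup S I J)"
      unfolding cap_cup_Int using insert by auto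
  qed (use insert closed_cap_cup in auto)
qed auto

lemma excisive_cap_cup:
  assumes "I \<subseteq> {1..N}" "insert j J \<subseteq> {1..N}"
  shows "excisive_couple (cap_cup S I {j}) (cap_cup S I J)"
proof (rule ANR_excisive_couple)
  have J: "finite J"
    using assms finite_index by auto
  show "ANR (cap_cup S I {j})" "closed (cap_cup S I {j})" "closed (cap_cup S I J)"
    "ANR (cap_cup S I {j} \<inter> cap_cup S I J)"
    unfolding cap_cup_Int using assms J by (auto intro!: ANR_cap_cup closed_cap_cup)
qed

text \<open>One more sphere on top of \<open>n + 1\<close> makes \<open>n + 2\<close>, and so many
  have no common point.\<close>

lemma cap_cup_eq_empty:
  assumes "I \<subseteq> {1..N}" "J \<subseteq> {1..N}" "I \<inter> J = {}" "card I \<ge> n + 1"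
  shows "cap_cup S I J = {}"
proof (rule ccontr)
  assume "cap_cup S I J \<noteq> {}"
  then obtain x j where j: "j \<in> J" "x \<in> (\<Inter>i\<in>insert j I. S i)"
    by (auto simp: cap_cup_def)
  have L: "insert j I \<subseteq> {1..N}"
    using j assms by auto
  have "card (insert j I) = Suc (card I)"
    using j assms finite_index [OF assms(1)] by (subst card_insert_disjoint) auto
  then have "card (insert j I) = n + 2"
    using card_bound [OF L] assms(4) by simp
  then show False
    using Inter_empty [OF L] j by blast
qed

text \<open>Inserting \<open>j\<close> compares degree \<open>p\<close> for \<open>I\<close> with
  degree \<open>p - 1\<close> for \<open>insert j I\<close>, and the middle degree also drops by
  one, so the degree stays off the middle.\<close>

theorem trivial_Hred_cap_cup:
  assumes "finite J" "I \<subseteq> {1..N}" "J \<subseteq> {1..N}" "I \<inter> J = {}" "p \<noteq> mid_degree n I"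
  shows "trivial_group (Hred p (cap_cup S I J))"
  using assms
proof (induction J arbitrary: I p rule: finite_induct)
  case empty
  show ?case
    unfolding cap_cup_empty by (rule trivial_Hred_empty)
next
  case (insert j J)
  let ?A = "cap_cup S I {j}" and ?B = "cap_cup S I J"
  have finI: "finite I"
    using insert finite_index by blast
  have cI: "card (insert j I) = Suc (card I)"
    using insert finI by (subst card_insert_disjoint) auto
  have exc: "excisive_couple ?A ?B"
    using insert by (intro excisive_cap_cup) auto
  have trivA: "trivial_group (Hred p ?A)"
    unfolding cap_cup_singleton
  proof (rule trivial_Hred_Inter)
    show "p \<noteq> int n + 1 - int (card (insert j I))"
      unfolding cI using insert.prems by simp
  qed (use insert.prems in auto)
  have trivB: "trivial_group (Hred p ?B)"
    using insert by auto
  \<comment> \<open>Negative degrees always vanish, and \<open>|I| > n\<close> gives the empty set.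
    In degree 0 with \<open>|I| \<le> n\<close> the hypothesis on \<open>p\<close> forces
    \<open>|I| < n\<close>, so the two members share a point unless \<open>J\<close> is empty.
    Positive degrees use the Mayer-Vietoris sequence.\<close>
  consider "p < 0" | "card I \<ge> n + 1" | "p = 0" "card I \<le> n" | q where "p = int (Suc q)"
    by (metis Suc_eq_plus1 gr0_implies_Suc int_nat_eq linorder_neqE_linordered_idom nat_0_iff not_less_eq_eq of_nat_0 zero_less_iff_neq_zero zero_le_imp_eq_int less_imp_le not_gr_zero)
  then show ?case
  proof cases
    case 1
    then show ?thesis
      by (rule trivial_reduced_homology_group)
  next
    case 2
    then have "cap_cup S I (insert j J) = {}"
      using insert.prems by (intro cap_cup_eq_empty) auto
    then show ?thesis
      using trivial_Hred_empty by metis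
  next
    case 3
    show ?thesis
    proof (cases "J = {}")
      case True
      then show ?thesis
        using trivA by simp
    next
      case False
      then obtain j' where j': "j' \<in> J" by auto
      have sub: "insert j' (insert j I) \<subseteq> {1..N}"
        using j' insert.prems by auto
      have "card (insert j' (insert j I)) = Suc (Suc (card I))"
        using cI j' insert finI by (subst card_insert_disjoint) auto
      moreover have "card I < n"
        using 3 insert.prems by auto
      ultimately obtain x where "x \<in> (\<Inter>i\<in>insert j' (insert j I). S i)"
        using Inter_nonempty [OF sub] by auto
      then have "x \<in> ?A \<inter> ?B"
        using j' by (auto simp: cap_cup_def)
      then show ?thesis
        unfolding cap_cup_insert [of S I j J] 3(1)
        using trivA trivB 3(1) by (intro trivial_Hred_0_union [OF exc]) auto
    qed
  next
    case 4
    have "trivial_group (Hred (int q) (cap_cup S (insert j I) J))"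
    proof (rule insert.IH)
      show "int q \<noteq> mid_degree n (insert j I)"
        using 4 insert.prems cI by simp
    qed (use insert in auto)
    then show ?thesis
      unfolding cap_cup_insert [of S I j J] 4
      using trivA trivB 4 by (intro trivial_Hred_Suc_union [OF exc]) (simp_all only: cap_cup_Int)
  qed
qed

section \<open>Extensions in the middle degree and ranks\<close>

text \<open>The members have homology only in degree \<open>n - |I|\<close> and their intersection
  only in degree \<open>n - |I| - 1\<close>, which is the vanishing needed on both sides. As
  \<open>|I| < n\<close>, the lower degree is a natural number \<open>q\<close>.\<close>

lemma mayer_vietoris_ses:
  assumes I: "I \<subseteq> {1..N}" "card I < n" and J: "J \<subseteq> {1..N}" "j \<in> {1..N}" "I \<inter> J = {}" "j \<notin> I" "j \<notin> J"
  shows "short_exact_sum (HS I (insert j J))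
    (HS I {j}) (HS I J)
    (Hred (mid_degree n I - 1) (cap_cup S (insert j I) J))
    (HS_incl I {j} (insert j J))
    (HS_incl I J (insert j J))
    (mayer_vietoris (mid_degree n I) (cap_cup S I {j}) (cap_cup S I J))"
proof -
  let ?A = "cap_cup S I {j}" and ?B = "cap_cup S I J"
  define q where "q = n - card I - 1"
  have q: "mid_degree n I = int (Suc q)" "mid_degree n I - 1 = int q"
    using I by (auto simp: q_def)
  have fin: "finite I" "finite J"
    using I J finite_index by auto
  have cI: "card (insert j I) = Suc (card I)"
    using fin J by simp
  have "short_exact_sum (Hred (int (Suc q)) (?A \<union> ?B)) (Hred (int (Suc q)) ?A) (Hred (int (Suc q)) ?B)
    (Hred (int q) (?A \<inter> ?B)) (incl_hom (int (Suc q)) ?A (?A \<union> ?B)) (incl_hom (int (Suc q)) ?B (?A \<union> ?B))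
    (mayer_vietoris (int (Suc q)) ?A ?B)"
  proof (rule mayer_vietoris_short_exact_sum)
    show "excisive_couple ?A ?B"
      using I J by (intro excisive_cap_cup) auto
    show "trivial_group (Hred (int q) ?A)" "trivial_group (Hred (int q) ?B)"
      using I J fin q by (auto intro!: trivial_Hred_cap_cup)
    show "trivial_group (Hred (int (Suc q)) (?A \<inter> ?B))"
      unfolding cap_cup_Int using I J fin q cI by (intro trivial_Hred_cap_cup) auto
  qed
  then show ?thesis
    unfolding q(1) [symmetric] q(2) [symmetric] cap_cup_Int cap_cup_insert [of S I j J] .
qed

text \<open>With \<open>|I| = n\<close>, at most one sphere besides \<open>j\<close> remains. If
  there is none, the quotient is trivial; if there is one, the two members are disjoint and the
  quotient is the infinite cyclic target of the augmentation. Both fit the rank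
  \<open>2 ^ |J| - 1\<close> of the case \<open>|I| < n\<close>, so the cases can be treated
  together later.\<close>

lemma base_ses:
  assumes I: "I \<subseteq> {1..N}" "card I = n" and J: "J \<subseteq> {1..N}" "j \<in> {1..N}" "I \<inter> J = {}" "j \<notin> I" "j \<notin> J"
  shows "\<exists>\<delta>. short_exact_sum (Hred 0 (cap_cup S I (insert j J)))
    (Hred 0 (cap_cup S I {j})) (Hred 0 (cap_cup S I J)) (int_power (2 ^ card J - 1))
    (incl_hom 0 (cap_cup S I {j}) (cap_cup S I (insert j J)))
    (incl_hom 0 (cap_cup S I J) (cap_cup S I (insert j J))) \<delta>"
proof -
  let ?A = "cap_cup S I {j}" and ?B = "cap_cup S I J"
  have fin: "finite I" "finite J"
    using I J finite_index by auto
  have "card (insert j I \<union> J) \<le> n + 2"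
    using I J by (intro card_bound) auto
  moreover have "card (insert j I \<union> J) = Suc (card I) + card J"
    using fin J by (subst card_Un_disjoint) auto
  ultimately have "card J \<le> 1"
    using I by simp
  then consider "J = {}" | j' where "J = {j'}"
    using fin by (metis card_0_eq card_1_singletonE le_neq_implies_less less_one)
  then show ?thesis
  proof cases
    case 1
    have B: "trivial_group (Hred 0 {} :: 'a chain set monoid)"
      by (rule trivial_Hred_empty)
    interpret A: group "Hred 0 ?A" by (rule group_reduced_homology_group)
    let ?k = "incl_hom 0 ?A ?A" and ?l = "incl_hom 0 {} ?A"
    have k: "?k a = a" if "a \<in> carrier (Hred 0 ?A)" for a
      using hom_induced_id subsetD [OF carrier_reduced_homology_group_subset that] .
    have B1: "b \<in> carrier (Hred 0 {}) \<longleftrightarrow> b = \<one>\<^bsub>Hred 0 {}\<^esub>" for b :: "'a chain set"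
      using B by (auto simp: trivial_group_def)
    have l: "?l \<one>\<^bsub>Hred 0 {}\<^esub> = \<one>\<^bsub>Hred 0 ?A\<^esub>"
      by (rule hom_one [OF hom_induced_reduced_hom group_reduced_homology_group group_reduced_homology_group])
    have "short_exact_sum (Hred 0 ?A) (Hred 0 ?A) (Hred 0 {}) (int_power 0) ?k ?l (\<lambda>_. \<one>\<^bsub>int_power 0\<^esub>)"
      unfolding short_exact_sum_def
    proof (intro conjI ballI impI)
      show "(\<lambda>_. \<one>\<^bsub>int_power 0\<^esub>) \<in> epi (Hred 0 ?A) (int_power 0)"
        using A.one_closed trivial_hom [OF group_int_power [of 0], of "Hred 0 ?A"] carrier_int_power_0
        by (auto simp: epi_def)
      fix x assume x: "x \<in> carrier (Hred 0 ?A)"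
      have "x = ?k x \<otimes>\<^bsub>Hred 0 ?A\<^esub> ?l \<one>\<^bsub>Hred 0 {}\<^esub>"
        using x k l by simp
      then show "\<one>\<^bsub>int_power 0\<^esub> = \<one>\<^bsub>int_power 0\<^esub> \<longleftrightarrow>
        (\<exists>a\<in>carrier (Hred 0 ?A). \<exists>b\<in>carrier (Hred 0 {}). x = ?k a \<otimes>\<^bsub>Hred 0 ?A\<^esub> ?l b)"
        using x B1 by blast
    next
      fix a b assume ab: "a \<in> carrier (Hred 0 ?A)" "b \<in> carrier (Hred 0 {})"
        "?k a \<otimes>\<^bsub>Hred 0 ?A\<^esub> ?l b = \<one>\<^bsub>Hred 0 ?A\<^esub>"
      then show "b = \<one>\<^bsub>Hred 0 {}\<^esub>"
        by (simp only: B1)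
      then show "a = \<one>\<^bsub>Hred 0 ?A\<^esub>"
        using ab k l by simp
    qed (rule hom_induced_reduced_hom)+
    then show ?thesis
      using 1 by auto
  next
    case 2
    have c1: "card (insert j I) = n + 1" "card (insert j' I) = n + 1"
      using fin I J 2 by auto
    have ne: "?A \<noteq> {}" "?B \<noteq> {}"
      unfolding 2 cap_cup_singleton using I J 2 c1 Inter_nonempty [of "insert j I"] Inter_nonempty [of "insert j' I"]
      by simp_all
    have disj: "?A \<inter> ?B = {}"
      unfolding cap_cup_Int using I J c1 by (intro cap_cup_eq_empty) auto
    have "excisive_couple ?A ?B"
      using I J by (intro excisive_cap_cup) auto
    then obtain \<delta> where \<delta>: "short_exact_sum (Hred 0 (?A \<union> ?B)) (Hred 0 ?A) (Hred 0 ?B) (homology_group 0 point_space)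
      (incl_hom 0 ?A (?A \<union> ?B)) (incl_hom 0 ?B (?A \<union> ?B)) \<delta>"
      using disjoint_short_exact_sum [OF _ disj ne] by blast
    have "homology_group 0 point_space \<cong> integer_group"
      by (rule homology_coefficients) simp
    then have "homology_group 0 point_space \<cong> int_power 1"
      using integer_group_isomorphic_int_power_1 by (rule iso_trans)
    then obtain \<phi> where \<phi>: "\<phi> \<in> iso (homology_group 0 point_space) (int_power 1)"
      by (auto simp: is_iso_def)
    have "short_exact_sum (Hred 0 (?A \<union> ?B)) (Hred 0 ?A) (Hred 0 ?B) (int_power 1)
      (incl_hom 0 ?A (?A \<union> ?B)) (incl_hom 0 ?B (?A \<union> ?B)) (\<phi> \<circ> \<delta>)"
      by (rule short_exact_sum_iso [OF \<delta> \<phi> group_relative_homology_group group_int_power])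
    moreover have "2 ^ card J - 1 = (1::nat)"
      using 2 by simp
    ultimately show ?thesis
      unfolding cap_cup_insert [of S I j J] by metis
  qed
qed

lemma short_exact_sum_groupsI:
  assumes "short_exact_sum (Hred p X) (Hred p A) (Hred p B) C k l \<delta>" "group C"
  shows "short_exact_sum_groups (Hred p X) (Hred p A) (Hred p B) C k l \<delta>"
proof -
  have "comm_group (Hred p X)"
    unfolding reduced_homology_group_def by (intro group.abelian_subgroup_generated group_relative_homology_group abelian_relative_homology_group)
  then show ?thesis
    using assms by (simp add: short_exact_sum_groups_def short_exact_sum_groups_axioms_def)
qed


text \<open>One extension with free quotient for all \<open>|I| \<le> n\<close>. Freeness of the
  homology of the intersection is an assumption, as the lemma is applied inside the induction that
  proves it.\<close>

lemma ses_exists: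
  assumes I: "I \<subseteq> {1..N}" "card I \<le> n" and J: "J \<subseteq> {1..N}" "j \<in> {1..N}" "I \<inter> J = {}" "j \<notin> I" "j \<notin> J"
    and rank: "card I < n \<Longrightarrow> Hred (mid_degree n I - 1) (cap_cup S (insert j I) J) \<cong> int_power (2 ^ card J - 1)"
  shows "\<exists>\<delta>. HS_extension I j J (int_power (2 ^ card J - 1)) \<delta>"
proof (cases "card I < n")
  case True
  obtain \<phi> where \<phi>: "\<phi> \<in> iso (Hred (mid_degree n I - 1) (cap_cup S (insert j I) J)) (int_power (2 ^ card J - 1))"
    using rank [OF True] by (auto simp: is_iso_def)
  show ?thesis
    using short_exact_sum_iso [OF mayer_vietoris_ses [OF I(1) True J] \<phi> group_reduced_homology_group group_int_power]
    by (intro exI short_exact_sum_groupsI group_int_power)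
next
  case False
  then have "card I = n" "mid_degree n I = 0"
    using I by auto
  then obtain \<delta> where "short_exact_sum (Hred 0 (cap_cup S I (insert j J)))
    (Hred 0 (cap_cup S I {j})) (Hred 0 (cap_cup S I J)) (int_power (2 ^ card J - 1))
    (incl_hom 0 (cap_cup S I {j}) (cap_cup S I (insert j J)))
    (incl_hom 0 (cap_cup S I J) (cap_cup S I (insert j J))) \<delta>"
    using base_ses [OF I(1) _ J] by blast
  then show ?thesis
    unfolding \<open>mid_degree n I = 0\<close> by (intro exI short_exact_sum_groupsI group_int_power)
qed

lemma Hred_single:
  assumes "I \<subseteq> {1..N}" "j \<in> {1..N}" "j \<notin> I" "card I \<le> n"
  shows "HS I {j} \<cong> int_power 1"
proof -
  have c: "card (insert j I) = Suc (card I)"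
    using assms finite_index by simp
  have "Hred (int n + 1 - int (card (insert j I))) (\<Inter>i\<in>insert j I. S i) \<cong> integer_group"
    using assms c by (intro Hred_Inter) auto
  moreover have "int n + 1 - int (card (insert j I)) = mid_degree n I"
    using c by simp
  ultimately have "HS I {j} \<cong> integer_group"
    unfolding cap_cup_singleton by (simp only:)
  then show ?thesis
    using integer_group_isomorphic_int_power_1 by (rule iso_trans)
qed

text \<open>The extension splits because its quotient is free, so ranks add: with
  \<open>m = |J|\<close> before the insertion,
  \<open>1 + (2^m - 1) + (2^m - 1) = 2^(m+1) - 1\<close>.\<close>

theorem Hred_cap_cup:
  assumes "finite J" "I \<subseteq> {1..N}" "J \<subseteq> {1..N}" "I \<inter> J = {}" "card I \<le> n"
  shows "HS I J \<cong> int_power (2 ^ card J - 1)"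
  using assms
proof (induction J arbitrary: I rule: finite_induct)
  case empty
  show ?case
    using trivial_group_isomorphic_int_power_0 [OF group_reduced_homology_group trivial_Hred_empty] by simp
next
  case (insert j J)
  have finI: "finite I"
    using insert finite_index by blast
  have cI: "card (insert j I) = Suc (card I)"
    using insert finI by (subst card_insert_disjoint) auto
  have rank: "Hred (mid_degree n I - 1) (cap_cup S (insert j I) J) \<cong> int_power (2 ^ card J - 1)" if "card I < n"
  proof -
    have eq: "mid_degree n I - 1 = mid_degree n (insert j I)"
      using cI by simp
    show ?thesis
      unfolding eq by (rule insert.IH) (use insert.prems insert.hyps that cI in auto)
  qed
  obtain \<delta> where ses: "HS_extension I j J (int_power (2 ^ card J - 1)) \<delta>"
    using ses_exists [OF _ _ _ _ _ _ insert.hyps(2) rank] insert.prems by auto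
  obtain f1 f2 where sp: "short_exact_sum_groups.splitting (HS I (insert j J))
    (HS I {j}) (HS I J)
    (HS_incl I {j} (insert j J))
    (HS_incl I J (insert j J)) f1 f2"
    using short_exact_sum_groups.splitting_exists [OF ses iso_refl] by blast
  have "HS I (insert j J) \<cong> int_power (1 + (2 ^ card J - 1) + (2 ^ card J - 1))"
  proof (rule triple_iso_int_power [OF short_exact_sum_groups.splitting_triple_iso [OF ses sp]])
    show "HS I {j} \<cong> int_power 1"
      using insert.prems by (intro Hred_single) auto
    show "HS I J \<cong> int_power (2 ^ card J - 1)"
      using insert by auto
  qed (simp_all add: group_int_power iso_refl)
  moreover have "1 + (2 ^ card J - 1) + (2 ^ card J - 1) = (2 ^ card (insert j J) - 1 :: nat)"
    using insert.hyps by simp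
  ultimately show ?case
    by (simp only:)
qed

section \<open>Splitting homomorphisms and the recursive maps\<close>

lemma splitting_homs_iff:
  assumes ses: "HS_extension I j J C \<delta>"
    and j: "j \<notin> J"
  shows "splitting_homs n S I j (insert j J) f\<^sub>1 f\<^sub>2 \<longleftrightarrow>
    short_exact_sum_groups.splitting (HS I (insert j J))
    (HS I {j}) (HS I J)
    (HS_incl I {j} (insert j J))
    (HS_incl I J (insert j J)) f\<^sub>1 f\<^sub>2"
proof -
  have "insert j J - {j} = J"
    using j by auto
  then show ?thesis
    unfolding splitting_homs_def Let_def short_exact_sum_groups.splitting_def [OF ses] by simp
qed

text \<open>The size of \<open>I\<close> is left free, since the recursion keeps inserting indices
  into \<open>I\<close> until the list is exhausted. Beyond \<open>n\<close> the degree is negative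
  and trivial maps do.\<close>

lemma splitting_homs_exists:
  assumes I: "I \<subseteq> {1..N}" and J: "J \<subseteq> {1..N}" "j \<in> {1..N}" "I \<inter> J = {}" "j \<notin> I" "j \<notin> J"
  shows "\<exists>f\<^sub>1 f\<^sub>2. splitting_homs n S I j (insert j J) f\<^sub>1 f\<^sub>2"
proof (cases "card I \<le> n")
  case True
  have fin: "finite I" "finite J"
    using I J finite_index by auto
  have c: "card (insert j I) = Suc (card I)"
    using fin J by simp
  have rank: "Hred (mid_degree n I - 1) (cap_cup S (insert j I) J) \<cong> int_power (2 ^ card J - 1)" if "card I < n"
  proof -
    have eq: "mid_degree n I - 1 = mid_degree n (insert j I)"
      using c by simp
    show ?thesis
      unfolding eq by (rule Hred_cap_cup) (use fin I J c that in auto)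
  qed
  obtain \<delta> where ses: "HS_extension I j J (int_power (2 ^ card J - 1)) \<delta>"
    using ses_exists [OF I True J rank] by blast
  show ?thesis
    unfolding splitting_homs_iff [OF ses J(5)]
    using short_exact_sum_groups.splitting_exists [OF ses iso_refl] .
next
  case False
  then have "mid_degree n I < 0" by simp
  then show ?thesis
    using trivial_homs_splitting [OF trivial_reduced_homology_group trivial_reduced_homology_group] by blast
qed

lemma decomposition_map_exists:
  assumes "distinct js" "I \<subseteq> {1..N}" "set js \<subseteq> {1..N}" "I \<inter> set js = {}"
  shows "\<exists>g. decomposition_map n S I js g"
  using assms
proof (induction js arbitrary: I)
  case Nil
  show ?case
    by (intro exI [of _ "\<lambda>_. \<one>\<^bsub>decomposition_group n S I {}\<^esub>"]) simp
next
  case (Cons j js)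
  obtain f1 f2 where f: "splitting_homs n S I j (insert j (set js)) f1 f2"
    using splitting_homs_exists [of I "set js" j] Cons.prems by auto
  obtain g2 where g2: "decomposition_map n S I js g2"
    using Cons.IH [of I] Cons.prems by auto
  obtain g3 where g3: "decomposition_map n S (insert j I) js g3"
    using Cons.IH [of "insert j I"] Cons.prems by auto
  have "decomposition_map n S I (j # js) (\<lambda>x. (\<lambda>K\<in>{K. K \<subseteq> set (j # js) \<and> K \<noteq> {}}.
      if K = {j} then f1 x
      else if j \<notin> K then g2 (f2 x) K
      else g3 (mayer_vietoris (mid_degree n I) (cap_cup S I {j}) (cap_cup S I (set js)) x) (K - {j})))"
    unfolding decomposition_map.simps
    by (intro exI [of _ f1] exI [of _ f2] exI [of _ g2] exI [of _ g3] conjI ballI refl) (use f g2 g3 in simp_all)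
  then show ?case
    by blast
qed


abbreviation "summand I K \<equiv> Hred (int n - int (card I) - int (card K) + 1) (\<Inter>i\<in>I \<union> K. S i)"

text \<open>The degree of a summand depends only on \<open>|I| + |K|\<close> and its space only on
  \<open>I \<union> K\<close>, so \<open>j\<close> may be counted on either side.\<close>

lemma decomposition_group_insert:
  assumes "finite I" "finite J" "j \<notin> I" "j \<notin> J"
  shows "decomposition_group n S (insert j I) J = sum_group {K. K \<subseteq> J \<and> K \<noteq> {}} (\<lambda>K. summand I (insert j K))"
  unfolding decomposition_group_def
proof (rule sum_group_cong [OF refl])
  fix K assume "K \<in> {K. K \<subseteq> J \<and> K \<noteq> {}}"
  then have "finite K" "j \<notin> K"
    using assms finite_subset by auto
  then have "int n - int (card (insert j I)) - int (card K) + 1 = int n - int (card I) - int (card (insert j K)) + 1"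
    using assms by simp
  moreover have "insert j I \<union> K = I \<union> insert j K"
    by auto
  ultimately show "summand (insert j I) K = summand I (insert j K)"
    by (simp only:)
qed

lemma summand_single: "summand I {j} = HS I {j}"
  by (simp add: cap_cup_singleton)

lemma trivial_summand:
  assumes "finite I" "finite K" "I \<inter> K = {}" "card I + card K \<ge> n + 2"
  shows "trivial_group (summand I K)"
  using assms by (intro trivial_reduced_homology_group) auto

text \<open>\<open>C\<close>, \<open>\<delta>\<close> and \<open>\<gamma>\<close> are kept general
  so that one step serves both the connecting homomorphism, for \<open>|I| < n\<close>, and the
  augmentation, for \<open>|I| = n\<close>.\<close>

lemma decomposition_map_step:
  assumes I: "I \<subseteq> {1..N}" "card I \<le> n" and J: "finite J" "J \<subseteq> {1..N}" "j \<in> {1..N}" "I \<inter> J = {}" "j \<notin> I" "j \<notin> J"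
    and ses: "HS_extension I j J C \<delta>"
    and f: "splitting_homs n S I j (insert j J) f\<^sub>1 f\<^sub>2"
    and g\<^sub>2: "g\<^sub>2 \<in> iso (HS I J) (decomposition_group n S I J)"
    and \<gamma>: "\<gamma> \<in> epi C (decomposition_group n S (insert j I) J)"
    and g: "\<And>x. x \<in> carrier (HS I (insert j J)) \<Longrightarrow>
      g x = (\<lambda>K\<in>{K. K \<subseteq> insert j J \<and> K \<noteq> {}}. if K = {j} then f\<^sub>1 x else if j \<notin> K then g\<^sub>2 (f\<^sub>2 x) K
        else \<gamma> (\<delta> x) (K - {j}))"
  shows "sum_group_recursion (HS I (insert j J)) (HS I J) C
    (summand I) f\<^sub>1 f\<^sub>2 \<delta> g\<^sub>2 \<gamma> g J j"
  unfolding sum_group_recursion_def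
proof (intro conjI allI impI)
  have finI: "finite I"
    using I finite_index by blast
  show "Group.group (HS I (insert j J))" "Group.group (HS I J)"
    by simp_all
  show "Group.group (summand I K)" for K
    by simp
  show "Group.group C"
    using ses by (simp add: short_exact_sum_groups_def)
  show "triple_iso (HS I (insert j J)) (summand I {j}) (HS I J) C f\<^sub>1 f\<^sub>2 \<delta>"
    unfolding summand_single
    using short_exact_sum_groups.splitting_triple_iso [OF ses] f splitting_homs_iff [OF ses J(6)] by blast
  show "g\<^sub>2 \<in> iso (HS I J) (sum_group {K. K \<subseteq> J \<and> K \<noteq> {}} (summand I))"
    using g\<^sub>2 unfolding decomposition_group_def .
  show "\<gamma> \<in> epi C (sum_group {K. K \<subseteq> J \<and> K \<noteq> {}} (\<lambda>K. summand I (insert j K)))"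
    using \<gamma> unfolding decomposition_group_insert [OF finI J(1,5,6)] .
qed (use J g in auto)

text \<open>The third map belongs to \<open>insert j I\<close> and \<open>js\<close>, whose union is
  that of the current level, so it falls under the same alternative; the second map belongs to a
  union without \<open>j\<close> and is always an isomorphism. The descent ends at
  \<open>|I| = n\<close>, where the kernel is computed directly.\<close>

theorem decomposition_map_iso:
  assumes "distinct js" "I \<subseteq> {1..N}" "set js \<subseteq> {1..N}" "I \<inter> set js = {}" "card I \<le> n" "decomposition_map n S I js g"
  shows "(card (I \<union> set js) \<le> n + 1 \<longrightarrow>
      g \<in> iso (HS I (set js)) (decomposition_group n S I (set js))) \<and>
    (card (I \<union> set js) = n + 2 \<longrightarrow>
      g \<in> epi (HS I (set js)) (decomposition_group n S I (set js)) \<and>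
      subgroup_generated (HS I (set js))
        (kernel (HS I (set js)) (decomposition_group n S I (set js)) g) \<cong> integer_group)"
  using assms
proof (induction js arbitrary: I g)
  case Nil
  have triv: "trivial_group (decomposition_group n S I {})"
    using trivial_sum_group_empty by (simp add: decomposition_group_def)
  have "g \<in> hom (HS I {}) (decomposition_group n S I {})"
  proof (rule homI)
    fix x y assume "x \<in> carrier (HS I {})" "y \<in> carrier (HS I {})"
    moreover have "x \<otimes>\<^bsub>HS I {}\<^esub> y \<in> carrier (HS I {})"
      by (rule monoid.m_closed [OF group.is_monoid [OF group_reduced_homology_group]]) fact+
    ultimately show "g (x \<otimes>\<^bsub>HS I {}\<^esub> y)
        = g x \<otimes>\<^bsub>decomposition_group n S I {}\<^esub> g y"
      using Nil.prems(6) triv monoid.l_one [OF group.is_monoid, of "decomposition_group n S I {}"]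
      by (simp add: trivial_group_def del: cap_cup_empty)
  qed (use Nil.prems(6) triv in \<open>simp add: trivial_group_def\<close>)
  then have "g \<in> iso (HS I {}) (decomposition_group n S I {})"
    using triv trivial_Hred_empty by (intro trivial_groups_isoI) auto
  then show ?case
    using Nil.prems by simp
next
  case (Cons j js)
  let ?J = "set js" and ?d = "mid_degree n I"
  have fin: "finite I" "finite ?J"
    using Cons.prems finite_index by auto
  have J: "finite ?J" "?J \<subseteq> {1..N}" "j \<in> {1..N}" "I \<inter> ?J = {}" "j \<notin> I" "j \<notin> ?J"
    using Cons.prems by auto
  have cI: "card (insert j I) = Suc (card I)"
    using fin J by simp
  have cU: "card (I \<union> set (j # js)) = Suc (card (I \<union> ?J))" "card (insert j I \<union> ?J) = card (I \<union> set (j # js))"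
    using fin J by simp_all
  have bound: "card (I \<union> set (j # js)) \<le> n + 2"
    using Cons.prems by (intro card_bound) auto
  obtain f1 f2 g2 g3 where f: "splitting_homs n S I j (insert j ?J) f1 f2"
    and g2: "decomposition_map n S I js g2" and g3: "decomposition_map n S (insert j I) js g3"
    and g: "\<And>x. x \<in> carrier (HS I (insert j ?J)) \<Longrightarrow>
      g x = (\<lambda>K\<in>{K. K \<subseteq> insert j ?J \<and> K \<noteq> {}}. if K = {j} then f1 x else if j \<notin> K then g2 (f2 x) K
        else g3 (mayer_vietoris ?d (cap_cup S I {j}) (cap_cup S I ?J) x) (K - {j}))"
    using Cons.prems(6) unfolding decomposition_map.simps list.set by blast
  \<comment> \<open>At most \<open>n + 2\<close> indices occur and \<open>j\<close> is missing here,
    so the isomorphism alternative of the induction hypothesis applies.\<close>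
  have g2iso: "g2 \<in> iso (HS I ?J) (decomposition_group n S I ?J)"
    using Cons.IH [OF _ _ _ _ _ g2] Cons.prems bound cU by auto
  let ?D3 = "decomposition_group n S (insert j I) ?J"
  have D: "decomposition_group n S I (insert j ?J) = sum_group {K. K \<subseteq> insert j ?J \<and> K \<noteq> {}} (summand I)"
    by (simp add: decomposition_group_def)
  have D3: "?D3 = sum_group {K. K \<subseteq> ?J \<and> K \<noteq> {}} (\<lambda>K. summand I (insert j K))"
    by (rule decomposition_group_insert [OF fin J(5,6)])
  have grD3: "Group.group ?D3"
    unfolding D3 by (rule sum_group) simp
  show ?case
  proof (cases "card I < n")
    case True
    let ?C = "Hred (?d - 1) (cap_cup S (insert j I) ?J)"
      and ?\<delta> = "mayer_vietoris ?d (cap_cup S I {j}) (cap_cup S I ?J)"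
    have ses: "HS_extension I j ?J ?C ?\<delta>"
      by (rule short_exact_sum_groupsI [OF mayer_vietoris_ses [OF Cons.prems(2) True J(2-6)] group_reduced_homology_group])
    have "mid_degree n (insert j I) = ?d - 1"
      using cI by simp
    then have dj: "?d - 1 = mid_degree n (insert j I)" by simp
    have IH3: "(card (I \<union> set (j # js)) \<le> n + 1 \<longrightarrow> g3 \<in> iso ?C ?D3) \<and>
      (card (I \<union> set (j # js)) = n + 2 \<longrightarrow> g3 \<in> epi ?C ?D3 \<and> subgroup_generated ?C (kernel ?C ?D3 g3) \<cong> integer_group)"
      unfolding dj cU(2) [symmetric] by (rule Cons.IH) (use Cons.prems(1-3) g3 J True cI in auto)
    have epi3: "g3 \<in> epi ?C ?D3"
    proof (cases "card (I \<union> set (j # js)) \<le> n + 1")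
      case True
      then have "g3 \<in> iso ?C ?D3" using IH3 by blast
      then show ?thesis
        by (simp add: iso_def epi_def bij_betw_def)
    next
      case False
      then have "card (I \<union> set (j # js)) = n + 2"
        using bound by linarith
      then show ?thesis
        using IH3 by blast
    qed
    interpret R: sum_group_recursion "HS I (insert j ?J)" "HS I ?J" ?C "summand I"
      f1 f2 ?\<delta> g2 g3 g ?J j
      by (rule decomposition_map_step [OF Cons.prems(2,5) J ses f g2iso epi3]) (rule g)
    show ?thesis
      using R.g_iso R.g_epi R.g_kernel_iso IH3 unfolding list.set D D3 by blast
  next
    case False
    then have n: "card I = n" and d0: "?d = 0"
      using Cons.prems by auto
    have "card ?J \<le> 1"
      using bound fin J n unfolding cU by (simp add: card_Un_disjoint)
    then consider "js = []" | j' where "js = [j']"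
      using Cons.prems(1) by (cases js) (auto simp: distinct_card)
    note cases_js = this
    let ?C = "int_power (2 ^ card ?J - 1)"
    obtain \<delta> where ses: "HS_extension I j ?J ?C \<delta>"
      using ses_exists [OF Cons.prems(2,5) J(2-6)] False by blast
    \<comment> \<open>For \<open>|I| = n\<close> the recursive map sends the third component through
      degree -1, where all groups are trivial. It is factored through the true quotient
      \<open>?C\<close> by a trivial \<open>\<gamma>\<close>, so that the kernel becomes
      visible.\<close>
    define \<gamma> where "\<gamma> c = \<one>\<^bsub>?D3\<^esub>" for c :: "nat \<Rightarrow> int"
    have trivG: "trivial_group (summand I (insert j K))" if "K \<subseteq> ?J" "K \<noteq> {}" for K
    proof (rule trivial_summand)
      have "finite K" "j \<notin> K"
        using that finite_subset [OF that(1) fin(2)] J by auto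
      moreover have "card K > 0"
        using calculation that by (simp add: card_gt_0_iff)
      ultimately show "n + 2 \<le> card I + card (insert j K)" "finite (insert j K)"
        using n by simp_all
    qed (use fin J that in auto)
    have trivD3: "trivial_group ?D3"
    proof -
      have "carrier ?D3 = (\<Pi>\<^sub>E K\<in>{K. K \<subseteq> ?J \<and> K \<noteq> {}}. carrier (summand I (insert j K)))"
        unfolding D3 by (rule carrier_sum_group_finite) (use fin in auto)
      also have "\<dots> = (\<Pi>\<^sub>E K\<in>{K. K \<subseteq> ?J \<and> K \<noteq> {}}. {\<one>\<^bsub>summand I (insert j K)\<^esub>})"
        using trivG by (intro PiE_cong) (auto simp: trivial_group_def)
      also have "\<dots> = (\<Pi>\<^sub>E K\<in>{K. K \<subseteq> ?J \<and> K \<noteq> {}}. {\<one>\<^bsub>?D3\<^esub> K})"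
        unfolding D3 one_sum_group by (intro PiE_cong) simp
      also have "\<dots> = {\<one>\<^bsub>?D3\<^esub>}"
        unfolding D3 one_sum_group by (intro PiE_singleton restrict_extensional)
      finally show ?thesis
        using grD3 by (simp add: trivial_group_def)
    qed
    have \<gamma>hom: "\<gamma> \<in> hom ?C ?D3"
      unfolding \<gamma>_def by (rule trivial_hom [OF grD3])
    have "carrier ?C \<noteq> {}"
      using group_int_power monoid.one_closed group.is_monoid by blast
    then have \<gamma>: "\<gamma> \<in> epi ?C ?D3"
      using \<gamma>hom trivD3 by (auto simp: epi_def \<gamma>_def trivial_group_def)
    \<comment> \<open>Both sides are the identity of a trivial summand:
      \<open>mayer_vietoris\<close> in degree 0 returns the identity, and for
      \<open>js = [j']\<close> the only component of \<open>g3\<close> is \<open>f1'\<close>, with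
      values in a group of degree -1.\<close>
    have third: "g3 (mayer_vietoris ?d (cap_cup S I {j}) (cap_cup S I ?J) x) K = \<gamma> (\<delta> x) K"
      if K: "K \<subseteq> ?J" "K \<noteq> {}" for x K
      using cases_js
    proof cases
      case 1
      then show ?thesis
        using K by simp
    next
      case (2 j')
      let ?I' = "insert j I"
      have K': "K = {j'}"
        using K 2 by auto
      obtain f1' f2' g2' g3' where f': "splitting_homs n S ?I' j' {j'} f1' f2'"
        and g3': "\<And>x. x \<in> carrier (Hred (mid_degree n ?I') (cap_cup S ?I' {j'})) \<Longrightarrow>
          g3 x = (\<lambda>K\<in>{K. K \<subseteq> {j'} \<and> K \<noteq> {}}. if K = {j'} then f1' x else if j' \<notin> K then g2' (f2' x) K
        else g3' (mayer_vietoris (mid_degree n ?I') (cap_cup S ?I' {j'}) (cap_cup S ?I' {}) x) (K - {j'}))"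
        using g3 unfolding 2 decomposition_map.simps list.set by blast
      define y where "y = mayer_vietoris ?d (cap_cup S I {j}) (cap_cup S I ?J) x"
      have "y = \<one>\<^bsub>Hred (?d - 1) (cap_cup S I {j} \<inter> cap_cup S I ?J)\<^esub>"
        unfolding y_def mayer_vietoris_def d0 by simp
      also have "Hred (?d - 1) (cap_cup S I {j} \<inter> cap_cup S I ?J) = Hred (mid_degree n ?I') (cap_cup S ?I' {j'})"
        unfolding cap_cup_Int 2 using cI by (intro arg_cong2 [of _ _ _ _ reduced_homology_group]) simp_all
      finally have y: "y \<in> carrier (Hred (mid_degree n ?I') (cap_cup S ?I' {j'}))"
        using monoid.one_closed [OF group.is_monoid [OF group_reduced_homology_group]] by metis
      have "f1' y \<in> carrier (Hred (mid_degree n ?I') (cap_cup S ?I' {j'}))"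
        using f' y unfolding splitting_homs_def Let_def by (metis hom_in_carrier)
      moreover have "Hred (mid_degree n ?I') (cap_cup S ?I' {j'}) = summand I (insert j {j'})"
        using cI n fin J 2 by (simp add: cap_cup_singleton insert_commute Un_commute)
      ultimately have "f1' y = \<one>\<^bsub>summand I (insert j {j'})\<^esub>"
        using trivG [OF K] unfolding K' trivial_group_def by auto
      then have "g3 y K = \<one>\<^bsub>summand I (insert j K)\<^esub>"
        unfolding g3' [OF y] K' by simp
      then show ?thesis
        unfolding y_def \<gamma>_def D3 using K by simp
    qed
    have g': "g x = (\<lambda>K\<in>{K. K \<subseteq> insert j ?J \<and> K \<noteq> {}}. if K = {j} then f1 x else if j \<notin> K then g2 (f2 x) K
        else \<gamma> (\<delta> x) (K - {j}))" if "x \<in> carrier (HS I (insert j ?J))" for x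
      unfolding g [OF that]
    proof (rule restrict_ext)
      fix K assume K: "K \<in> {K. K \<subseteq> insert j ?J \<and> K \<noteq> {}}"
      show "(if K = {j} then f1 x else if j \<notin> K then g2 (f2 x) K
          else g3 (mayer_vietoris ?d (cap_cup S I {j}) (cap_cup S I ?J) x) (K - {j}))
        = (if K = {j} then f1 x else if j \<notin> K then g2 (f2 x) K else \<gamma> (\<delta> x) (K - {j}))"
      proof (cases "K = {j} \<or> j \<notin> K")
        case False
        then have "K - {j} \<subseteq> ?J" "K - {j} \<noteq> {}"
          using K by auto
        then show ?thesis
          using third False by simp
      qed auto
    qed
    interpret R: sum_group_recursion "HS I (insert j ?J)" "HS I ?J" ?C "summand I"
      f1 f2 \<delta> g2 \<gamma> g ?J j
      by (rule decomposition_map_step [OF Cons.prems(2,5) J ses f g2iso \<gamma>]) (rule g')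
    show ?thesis
      using cases_js
    proof cases
      case 1
      have "trivial_group ?C"
        using group_int_power carrier_int_power_0 1 by (simp add: trivial_group_def)
      then have "\<gamma> \<in> iso ?C ?D3"
        using trivD3 \<gamma>hom group_int_power by (intro trivial_groups_isoI)
      moreover have "card (I \<union> set (j # js)) = n + 1"
        using 1 n fin J by simp
      ultimately show ?thesis
        using R.g_iso unfolding list.set D D3 by simp
    next
      case (2 j')
      \<comment> \<open>As \<open>\<gamma>\<close> is trivial, its kernel is all of
        \<open>?C\<close>, which is infinite cyclic because one index is left. This is where the
        integers enter the kernel.\<close>
      have "kernel ?C ?D3 \<gamma> = carrier ?C"
        by (auto simp: kernel_def \<gamma>_def)
      then have "subgroup_generated ?C (kernel ?C ?D3 \<gamma>) = ?C"
        using group.subgroup_generated_group_carrier [OF group_int_power] by metis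
      also have "?C = int_power 1"
        using 2 by simp
      finally have "subgroup_generated ?C (kernel ?C ?D3 \<gamma>) \<cong> integer_group"
        using group.iso_sym [OF group_integer_group integer_group_isomorphic_int_power_1] by metis
      moreover have "card (I \<union> set (j # js)) = n + 2"
        using 2 n fin J by simp
      ultimately show ?thesis
        using R.g_kernel_iso R.g_epi unfolding list.set D D3 by simp
    qed
  qed
qed

text \<open>Summands with \<open>|I| + |K| \<le> n + 1\<close> are infinite cyclic and the others
  trivial. As at most \<open>n + 2\<close> indices occur, the only candidate for a trivial summand
  is \<open>K = J\<close>, exactly when \<open>|I \<union> J| = n + 2\<close>; this lowers the rank
  by one.\<close>

theorem decomposition_group_rank:
  assumes I: "I \<subseteq> {1..N}" and J: "J \<subseteq> {1..N}" "I \<inter> J = {}" and c: "card I \<le> n"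
  shows "decomposition_group n S I J
    \<cong> int_power (if card (I \<union> J) \<le> n + 1 then 2 ^ card J - 1 else 2 ^ card J - 2)"
proof -
  have fin: "finite I" "finite J"
    using I J finite_index by auto
  have cU: "card (I \<union> J) = card I + card J"
    using fin J by (simp add: card_Un_disjoint)
  have bound: "card (I \<union> J) \<le> n + 2"
    using I J by (intro card_bound) auto
  let ?\<K> = "{K. K \<subseteq> J \<and> K \<noteq> {}}"
  define T where "T = {K \<in> ?\<K>. card I + card K \<le> n + 1}"
  have cK: "card (I \<union> K) = card I + card K" if "K \<subseteq> J" for K
  proof (rule card_Un_disjoint)
    show "finite K" using that finite_subset [OF _ fin(2)] by blast
  qed (use that fin J in auto)
  have "decomposition_group n S I J \<cong> int_power (card T)"
    unfolding decomposition_group_def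
  proof (rule sum_group_isomorphic_int_power)
    show "finite ?\<K>"
      using fin by simp
    show "T \<subseteq> ?\<K>"
      unfolding T_def by blast
    show "Group.group (summand I K)" for K
      by simp
  next
    fix K assume K: "K \<in> T"
    then have K': "K \<subseteq> J" "K \<noteq> {}" "card I + card K \<le> n + 1"
      by (auto simp: T_def)
    have "Hred (int n + 1 - int (card (I \<union> K))) (\<Inter>i\<in>I \<union> K. S i) \<cong> integer_group"
      by (rule Hred_Inter) (use K' I J cK in auto)
    moreover have "int n + 1 - int (card (I \<union> K)) = int n - int (card I) - int (card K) + 1"
      using cK [OF K'(1)] by simp
    ultimately show "summand I K \<cong> integer_group"
      by (simp only:)
  next
    fix K assume K: "K \<in> ?\<K> - T"
    show "trivial_group (summand I K)"
    proof (rule trivial_summand)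
      show "finite K" using K finite_subset [OF _ fin(2), of K] by blast
      show "I \<inter> K = {}" "n + 2 \<le> card I + card K"
        using K J unfolding T_def by auto
    qed (rule fin)
  qed
  moreover have "card T = (if card (I \<union> J) \<le> n + 1 then 2 ^ card J - 1 else 2 ^ card J - 2)"
  proof -
    have PowJ: "?\<K> = Pow J - {{}}" by auto
    have c\<K>: "card ?\<K> = 2 ^ card J - 1"
      unfolding PowJ using fin by (simp add: card_Pow)
    have le: "card K \<le> card J" if "K \<subseteq> J" for K
      by (rule card_mono [OF fin(2) that])
    show ?thesis
    proof (cases "card (I \<union> J) \<le> n + 1")
      case True
      then have "card I + card K \<le> n + 1" if "K \<subseteq> J" for K
        using le [OF that] cU by linarith
      then have "T = ?\<K>"
        unfolding T_def by blast
      then show ?thesis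
        using True c\<K> by simp
    next
      case False
      then have eq: "card I + card J = n + 2"
        using bound cU by simp
      have "K \<in> T \<longleftrightarrow> K \<in> ?\<K> - {J}" for K
      proof -
        have "card K < card J" if "K \<subset> J"
          by (rule psubset_card_mono [OF fin(2) that])
        then have "card I + card K \<le> n + 1 \<longleftrightarrow> K \<noteq> J" if "K \<subseteq> J"
        proof (cases "K = J")
          case False
          then have "K \<subset> J" using that by blast
          then show ?thesis
            using \<open>K \<subset> J \<Longrightarrow> _\<close> False eq by simp
        qed (use eq in simp)
        then show ?thesis
          unfolding T_def by blast
      qed
      then have "T = ?\<K> - {J}" by blast
      \<comment> \<open>\<open>J\<close> is nonempty because \<open>|I| \<le> n\<close> and
        \<open>|I| + |J| = n + 2\<close>, so removing it does lower the count.\<close>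
      moreover have "J \<in> ?\<K>"
        using eq c by auto
      ultimately have "card T = card ?\<K> - 1"
        using fin by (simp add: card_Diff_singleton)
      then show ?thesis
        using False c\<K> by simp
    qed
  qed
  ultimately show ?thesis
    by (simp only:)
qed

end

section \<open>The decomposition for complex spheres\<close>

lemma bil_quadric_empty: "s \<noteq> 0 \<Longrightarrow> bil_quadric z0 e s 0 = {}"
  by (simp add: bil_quadric_def)

lemma bil_quadric_nonempty: "bil_quadric z0 e s (Suc l) \<noteq> {}"
proof -
  have "(\<Sum>k<Suc l. (if k = 0 then 1 else 0 :: complex)\<^sup>2) = 1"
    by (simp add: sum.lessThan_Suc_shift del: sum.lessThan_Suc)
  from quadric_point_in [OF this, of z0 e s] show ?thesis
    by blast
qed

text \<open>An intersection of \<open>|L|\<close> spheres has \<open>n + 2 - |L|\<close>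
  coordinates. If this number is \<open>l + 1\<close>, the quadric is nonempty and a homotopy
  \<open>l\<close>-sphere; if it is 0, the equation reads \<open>0 = s^2\<close> with
  \<open>s \<noteq> 0\<close> and has no solution.\<close>

lemma sphere_arrangement_csphere:
  fixes a :: "nat \<Rightarrow> complex ^ 'd"
  assumes dim: "CARD('d) = n + 1" and r: "\<And>i. i \<in> {1..N} \<Longrightarrow> r i \<noteq> 0"
    and gp: "spheres_in_general_position a r N"
  shows "sphere_arrangement (\<lambda>i. csphere (a i) (r i)) n N"
proof -
  let ?Q = "\<lambda>L. \<Inter>i\<in>L. csphere (a i) (r i)"
  have chart: "card L \<le> n + 2 \<and> (\<exists>z0 e s. s \<noteq> 0 \<and> bil_orthonormal (n + 2 - card L) e \<and> ?Q L = bil_quadric z0 e s (n + 2 - card L))"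
    if L: "L \<subseteq> {1..N}" "L \<noteq> {}" for L
  proof -
    obtain z0 e s where *: "card L \<le> n + 2" "s \<noteq> 0" "bil_orthonormal (n + 2 - card L) e"
      "?Q L = {z0 + (\<Sum>k<n + 2 - card L. c k *s e k) | c. (\<Sum>k<n + 2 - card L. (c k)\<^sup>2) = s\<^sup>2}"
      by (rule sphere_intersection_chart [OF dim r gp L])
    show ?thesis
      using * unfolding bil_quadric_def by blast
  qed
  have pos: "\<exists>l z0 e s. s \<noteq> 0 \<and> bil_orthonormal (Suc l) e \<and> ?Q L = bil_quadric z0 e s (Suc l) \<and> int l = int n + 1 - int (card L)"
    if L: "L \<subseteq> {1..N}" "L \<noteq> {}" "card L \<le> n + 1" for L
  proof -
    obtain z0 e s where "s \<noteq> 0" "bil_orthonormal (n + 2 - card L) e" "?Q L = bil_quadric z0 e s (n + 2 - card L)"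
      using chart [OF L(1,2)] by blast
    moreover have "n + 2 - card L = Suc (n + 1 - card L)" "int (n + 1 - card L) = int n + 1 - int (card L)"
      using L(3) by auto
    ultimately show ?thesis
      by metis
  qed
  have zero: "?Q L = {}" if L: "L \<subseteq> {1..N}" "card L = n + 2" for L
  proof -
    have "L \<noteq> {}" using L by auto
    then obtain z0 e s where "s \<noteq> 0" "?Q L = bil_quadric z0 e s (n + 2 - card L)"
      using chart [OF L(1)] by blast
    then show ?thesis
      using bil_quadric_empty L(2) by simp
  qed
  have hom: "Hred p (bil_quadric z0 e s (Suc l)) \<cong> reduced_homology_group p (nsphere l)"
    if "bil_orthonormal (Suc l) e" "s \<noteq> 0" for p z0 s l and e :: "nat \<Rightarrow> complex ^ 'd"
    by (rule homotopy_equivalent_space_imp_isomorphic_reduced_homology_groups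
        [OF bil_quadric_homotopy_equivalent_nsphere [OF that]])
  show ?thesis
  proof
    show "closed (csphere (a i) (r i))" for i
      by (rule closed_csphere)
  next
    fix L :: "nat set" assume L: "L \<subseteq> {1..N}"
    show "ANR (?Q L)"
    proof (cases "L = {}")
      case False
      then show ?thesis
        using chart [OF L] ENR_bil_quadric ENR_imp_ANR by metis
    qed simp
    show "card L \<le> n + 2"
      using chart [OF L] by (cases "L = {}") auto
  next
    fix L :: "nat set" assume L: "L \<subseteq> {1..N}" "card L \<le> n + 1"
    show "?Q L \<noteq> {}"
    proof (cases "L = {}")
      case False
      then show ?thesis
        using pos [OF L(1) _ L(2)] bil_quadric_nonempty by metis
    qed simp
  next
    fix L :: "nat set" assume L: "L \<subseteq> {1..N}" "L \<noteq> {}" "card L \<le> n + 1"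
    obtain l z0 e s where Q: "s \<noteq> 0" "bil_orthonormal (Suc l) e" "?Q L = bil_quadric z0 e s (Suc l)"
      "int l = int n + 1 - int (card L)"
      using pos [OF L] by blast
    show "Hred (int n + 1 - int (card L)) (?Q L) \<cong> integer_group"
      unfolding Q(3) Q(4) [symmetric] by (rule iso_trans [OF hom [OF Q(2,1)] reduced_homology_group_nsphere(1)])
  next
    fix L :: "nat set" and p :: int
    assume L: "L \<subseteq> {1..N}" "L \<noteq> {}" and p: "p \<noteq> int n + 1 - int (card L)"
    show "trivial_group (Hred p (?Q L))"
    proof (cases "card L \<le> n + 1")
      case True
      obtain l z0 e s where Q: "s \<noteq> 0" "bil_orthonormal (Suc l) e" "?Q L = bil_quadric z0 e s (Suc l)"
        "int l = int n + 1 - int (card L)"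
        using pos [OF L True] by blast
      have "trivial_group (reduced_homology_group p (nsphere l))"
        using reduced_homology_group_nsphere(2) p Q(4) by simp
      then show ?thesis
        unfolding Q(3) using isomorphic_group_triviality [OF hom [OF Q(2,1)]] by simp
    next
      case False
      then have "card L = n + 2"
        using chart [OF L] by simp
      show ?thesis
        unfolding zero [OF L(1) \<open>card L = n + 2\<close>] by (intro trivial_reduced_homology_group_empty) simp
    qed
  qed (rule zero)
qed

section \<open>The boundary homomorphism of the pair\<close>

lemma contractible_space_euclidean: "contractible_space (euclidean :: 'a::real_normed_vector topology)"
  using contractible_space_top_of_set [of "UNIV :: 'a set"] contractible_UNIV by simp

lemma trivial_homology_group_euclidean:
  assumes "p \<noteq> 0"
  shows "trivial_group (relative_homology_group p (euclidean :: 'a::real_normed_vector topology) {})"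
  using trivial_reduced_homology_group_contractible_space [OF contractible_space_euclidean, of p]
  by (simp add: un_reduced_homology_group [OF assms])

text \<open>For nonempty \<open>X\<close> this comes from contractibility of the ambient space. For
  empty \<open>X\<close> both groups must vanish; the left one is the homology of Euclidean space in
  degree \<open>p + 1\<close>, which is zero except for \<open>p = -1\<close>.\<close>

lemma hom_boundary_euclidean_iso:
  fixes X :: "'a::real_normed_vector set"
  assumes "p \<noteq> - 1"
  shows "hom_boundary (p + 1) euclidean X \<in> iso (relative_homology_group (p + 1) euclidean X) (Hred p X)"
proof (cases "X = {}")
  case True
  have "hom_boundary (p + 1) euclidean X \<in> hom (relative_homology_group (p + 1) euclidean X) (Hred p X)"
    using hom_boundary_reduced_hom [of "p + 1" euclidean X] by simp
  then show ?thesis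
    unfolding True using assms
    by (intro trivial_groups_isoI trivial_homology_group_euclidean trivial_reduced_homology_group_empty) auto
next
  case False
  then show ?thesis
    using iso_relative_homology_of_contractible [OF contractible_space_euclidean, of X "p + 1"] by simp
qed

theorem theorem3p9:
  fixes n N :: nat
    and a :: "nat \<Rightarrow> complex ^ 'd"
    and r :: "nat \<Rightarrow> complex"
    and S :: "nat \<Rightarrow> (complex ^ 'd) set"
    and I J :: "nat set"
  assumes dim: "CARD('d) = n + 1"
    and radii: "\<And>i. i \<in> {1..N} \<Longrightarrow> r i \<noteq> 0"
    and spheres: "S = (\<lambda>i. csphere (a i) (r i))"
    and general_position: "spheres_in_general_position a r N"
    and I: "I \<subseteq> {1..N}" "card I < n"
    and J: "J \<subseteq> {1..N} - I"
  shows
    "hom_boundary (mid_degree n I + 1) euclidean (cap_cup S I J)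
       \<in> iso (relative_homology_group (mid_degree n I + 1) euclidean (cap_cup S I J))
             (Hred (mid_degree n I) (cap_cup S I J)) \<and>
     (\<forall>j\<in>J. mayer_vietoris (mid_degree n I) (cap_cup S I {j}) (cap_cup S I (J - {j}))
              \<in> hom (Hred (mid_degree n I) (cap_cup S I J))
                    (Hred (mid_degree n I - 1) (cap_cup S (insert j I) (J - {j}))) \<and>
            (\<exists>f\<^sub>1 f\<^sub>2. splitting_homs n S I j J f\<^sub>1 f\<^sub>2)) \<and>
     (\<forall>js. distinct js \<and> set js = J \<longrightarrow>
        (\<exists>g. decomposition_map n S I js g) \<and>
        (\<forall>g. decomposition_map n S I js g \<longrightarrow>
           (let H = Hred (mid_degree n I) (cap_cup S I J); D = decomposition_group n S I J
            in if card (I \<union> J) \<le> n + 1 then g \<in> iso H D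
               else g \<in> epi H D \<and> subgroup_generated H (kernel H D g) \<cong> integer_group))) \<and>
     decomposition_group n S I J
       \<cong> int_power (if card (I \<union> J) \<le> n + 1 then 2 ^ card J - 1 else 2 ^ card J - 2) \<and>
     Hred (mid_degree n I) (cap_cup S I J) \<cong> int_power (2 ^ card J - 1) \<and>
     (\<forall>k::nat. int k \<noteq> mid_degree n I \<longrightarrow>
        trivial_group (relative_homology_group (int k + 1) euclidean (cap_cup S I J)) \<and>
        trivial_group (Hred (int k) (cap_cup S I J)))"
proof -
  interpret sphere_arrangement S n N
    unfolding spheres by (rule sphere_arrangement_csphere [OF dim radii general_position])
  have J': "J \<subseteq> {1..N}" "I \<inter> J = {}" and finJ: "finite J"
    using J finite_index by auto
  have bound: "card (I \<union> J) \<le> n + 2"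
    using I J' by (intro card_bound) auto
  show ?thesis
  proof (intro conjI ballI allI impI)
    show "hom_boundary (mid_degree n I + 1) euclidean (cap_cup S I J)
      \<in> iso (relative_homology_group (mid_degree n I + 1) euclidean (cap_cup S I J)) (Hred (mid_degree n I) (cap_cup S I J))"
      using I by (intro hom_boundary_euclidean_iso) simp
  next
    fix j assume j: "j \<in> J"
    have J'': "J - {j} \<subseteq> {1..N}" "j \<in> {1..N}" "I \<inter> (J - {j}) = {}" "j \<notin> I" "j \<notin> J - {j}"
      using j J' by auto
    have ins: "insert j (J - {j}) = J"
      using j by auto
    show "mayer_vietoris (mid_degree n I) (cap_cup S I {j}) (cap_cup S I (J - {j}))
        \<in> hom (Hred (mid_degree n I) (cap_cup S I J)) (Hred (mid_degree n I - 1) (cap_cup S (insert j I) (J - {j})))"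
      using mayer_vietoris_ses [OF I J''] unfolding ins short_exact_sum_def epi_def by blast
    show "\<exists>f\<^sub>1 f\<^sub>2. splitting_homs n S I j J f\<^sub>1 f\<^sub>2"
      using splitting_homs_exists [OF I(1) J''] unfolding ins .
  next
    fix js assume js: "distinct js \<and> set js = J"
    then show "\<exists>g. decomposition_map n S I js g"
      using decomposition_map_exists [of js I] I J' by simp
    fix g assume g: "decomposition_map n S I js g"
    have sj: "set js = J" and dj: "distinct js"
      using js by auto
    have prems: "set js \<subseteq> {1..N}" "I \<inter> set js = {}" "card I \<le> n"
      using I J' sj by auto
    have "(card (I \<union> J) \<le> n + 1 \<longrightarrow> g \<in> iso (Hred (mid_degree n I) (cap_cup S I J)) (decomposition_group n S I J)) \<and>
      (card (I \<union> J) = n + 2 \<longrightarrow> g \<in> epi (Hred (mid_degree n I) (cap_cup S I J)) (decomposition_group n S I J) \<and>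
        subgroup_generated (Hred (mid_degree n I) (cap_cup S I J))
          (kernel (Hred (mid_degree n I) (cap_cup S I J)) (decomposition_group n S I J) g) \<cong> integer_group)"
      using decomposition_map_iso [OF dj I(1) prems g] unfolding sj .
    moreover have "card (I \<union> J) \<le> n + 1 \<or> card (I \<union> J) = n + 2"
      using bound by linarith
    ultimately show "let H = Hred (mid_degree n I) (cap_cup S I J); D = decomposition_group n S I J
      in if card (I \<union> J) \<le> n + 1 then g \<in> iso H D
         else g \<in> epi H D \<and> subgroup_generated H (kernel H D g) \<cong> integer_group"
      unfolding Let_def by (cases "card (I \<union> J) \<le> n + 1") (simp_all only: if_True if_False simp_thms)
  next
    show "decomposition_group n S I J
      \<cong> int_power (if card (I \<union> J) \<le> n + 1 then 2 ^ card J - 1 else 2 ^ card J - 2)"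
      using I J' by (intro decomposition_group_rank) auto
    show "Hred (mid_degree n I) (cap_cup S I J) \<cong> int_power (2 ^ card J - 1)"
      using I J' finJ by (intro Hred_cap_cup) auto
  next
    fix k :: nat assume k: "int k \<noteq> mid_degree n I"
    show triv: "trivial_group (Hred (int k) (cap_cup S I J))"
      using I J' finJ k by (intro trivial_Hred_cap_cup) auto
    have "relative_homology_group (int k + 1) euclidean (cap_cup S I J) \<cong> Hred (int k) (cap_cup S I J)"
      by (rule is_isoI [OF hom_boundary_euclidean_iso]) simp
    then show "trivial_group (relative_homology_group (int k + 1) euclidean (cap_cup S I J))"
      using triv isomorphic_group_triviality by (metis group_reduced_homology_group group_relative_homology_group)
  qed
qed

end
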